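(* In the random graph setting described in the context, suppose that (1) there exist $\lambda_0>1$ and a function $p(\lambda)$ with $p(\lambda)\to0$ as $\lambda\to\infty$ such that $\mathbb P(R\in J(\lambda))\ge 1-p(\lambda)$ for each $R\ge1$, $\lambda\ge\lambda_0$; and (2) there is a constant $c>0$ such that $\mathbb E[R_{\rm eff}(0,B(R)^c)V(R)]\le c\,v(R)r(R)$ for all $R\ge 1$. Then there exist constants $c_1,c_2,c_3,c_4>0$ such that $$c_1v(R)r(R)\le\mathbb E(E^0_\omega\tau_R)\le c_2v(R)r(R)\quad\text{for all }R\ge1,$$ $$\frac{c_3}{v(\mathcal I(n))}\le\mathbb E(p^\omega_{2n}(0,0))\quad\text{for all }n\ge1,$$ $$c_4\,\mathcal I(n)\le\mathbb E(E^0_\omega d(0,X_n))\quad\text{for all }n\ge1.$$ Assume in addition that there exist $c_5>0$, $\lambda_0>1$ and $q_0'>2$ such that $$\mathbb P\big(\lambda^{-1}v(R)\le V(R),\ R_{\rm eff}(0,y)\le\lambda r(d(0,y))\ \forall y\in B(R)\big)\ge1-\frac{c_5}{\lambda^{q_0'}}$$ for each $R\ge1$, $\lambda\ge\lambda_0$. Then there is a constant $c_6>0$ such that $$\mathbb E(p^\omega_{2n}(0,0))\le\frac{c_6}{v(\mathcal I(n))}\quad\text{for all }n\ge1.$$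
   Context: Random graphs. $(\Omega,\mathcal F,\mathbb P)$ is a probability space (expectation $\mathbb E$) carrying a family of random graphs $\Gamma(\omega)=(G(\omega),E(\omega))$, $\omega\in\Omega$; for each $\omega$ the graph $\Gamma(\omega)$ is (unoriented) infinite, locally finite, connected, and contains a marked vertex $0$. $d=d_\omega$ is a metric on $G(\omega)$ (any metric, not necessarily the graph distance). $\mu_x$ is the number of edges containing $x$, extended to a measure $\mu$ on $G$; $B(x,R)=\{y:d(x,y)<R\}$, $B(R)=B(0,R)$, $V(R)=\mu(B(R))$. Random walk. $X=(X_n,n\ge0,P^x_\omega,x\in G(\omega))$ is the discrete-time simple random walk on $\Gamma(\omega)$ ($P^x_\omega(X_1=y)=1/\mu_x$ for $y\sim x$), with expectation $E^x_\omega$, and $p^\omega_n(x,y)=P^x_\omega(X_n=y)/\mu_y$. $\tau_R=\min\{n\ge0:X_n\notin B(R)\}$. Effective resistance. $\mathcal E(f,g)=\frac12\sum_{x\sim y}(f(x)-f(y))(g(x)-g(y))$ (sum over ordered pairs), $H^2=\{f\in\mathbb R^G:\mathcal E(f,f)<\infty\}$; for disjoint $A,B\subset G$, $R_{\rm eff}(A,B)^{-1}=\inf\{\mathcal E(f,f):f\in H^2,f|_A=1,f|_B=0\}$; $R_{\rm eff}(x,y)=R_{\rm eff}(\{x\},\{y\})$, $R_{\rm eff}(x,x)=0$. Growth functions. $v,r:[0,\infty]\to[0,\infty]$ are continuous strictly increasing functions with $v(0)=r(0)=0$, $v(1)=r(1)=1$, $v(\infty)=r(\infty)=\infty$, and for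 all $0<R'\le R<\infty$ $$C_1^{-1}(R/R')^{d_1}\le \frac{v(R)}{v(R')}\le C_1(R/R')^{d_2},\qquad C_2^{-1}(R/R')^{\alpha_1}\le \frac{r(R)}{r(R')}\le C_2(R/R')^{\alpha_2},$$ where $C_1,C_2\ge1$, $1\le d_1\le d_2$, $0<\alpha_1\le\alpha_2\le1$. $\mathcal I$ is the inverse function of $R\mapsto v(R)r(R)$. Good radii. For $\lambda>1$, $J(\lambda)$ is the (random) set of $R\in[1,\infty]$ such that $\lambda^{-1}v(R)\le V(R)\le\lambda v(R)$, $R_{\rm eff}(0,B(R)^c)\ge\lambda^{-1}r(R)$, and $R_{\rm eff}(0,y)\le\lambda r(d(0,y))$ for all $y\in B(R)$. *)

theory Defs
  imports "HOL-Probability.Probability"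
begin

text \<open>
  A graph is given by a vertex set and a set of unordered pairs of vertices; it carries a metric
  on its vertices and a marked vertex.  Lengths, times, volumes, energies and resistances are
  extended nonnegative reals, so that in particular the inverse of an energy $0$ is the resistance
  $\infty$ (the case of an empty complement of a ball).
\<close>

record 'v metric_graph =
  verts :: "'v set"
  edges :: "'v set set"
  gdist :: "'v \<Rightarrow> 'v \<Rightarrow> real"
  origin :: 'v

definition adj :: "('v, 'z) metric_graph_scheme \<Rightarrow> ('v \<times> 'v) set" where
  "adj \<Gamma> = {(x, y). {x, y} \<in> edges \<Gamma>}"

definition marked_graph :: "('v, 'z) metric_graph_scheme \<Rightarrow> bool" where
  "marked_graph \<Gamma> \<longleftrightarrow>
     edges \<Gamma> \<subseteq> {e. e \<subseteq> verts \<Gamma> \<and> card e = 2} \<and>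
     infinite (verts \<Gamma>) \<and>
     (\<forall>x\<in>verts \<Gamma>. finite {e \<in> edges \<Gamma>. x \<in> e}) \<and>
     (\<forall>x\<in>verts \<Gamma>. \<forall>y\<in>verts \<Gamma>. (x, y) \<in> (adj \<Gamma>)\<^sup>*) \<and>
     origin \<Gamma> \<in> verts \<Gamma> \<and>
     Metric_space (verts \<Gamma>) (gdist \<Gamma>)"

definition deg :: "('v, 'z) metric_graph_scheme \<Rightarrow> 'v \<Rightarrow> nat" where
  "deg \<Gamma> x = card {e \<in> edges \<Gamma>. x \<in> e}"

definition deg_measure :: "('v, 'z) metric_graph_scheme \<Rightarrow> 'v measure" where
  "deg_measure \<Gamma> = point_measure (verts \<Gamma>) (\<lambda>x. of_nat (deg \<Gamma> x))"

definition gball :: "('v, 'z) metric_graph_scheme \<Rightarrow> ennreal \<Rightarrow> 'v set" where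
  "gball \<Gamma> R = {y \<in> verts \<Gamma>. ennreal (gdist \<Gamma> (origin \<Gamma>) y) < R}"

definition vol :: "('v, 'z) metric_graph_scheme \<Rightarrow> ennreal \<Rightarrow> ennreal" where
  "vol \<Gamma> R = emeasure (deg_measure \<Gamma>) (gball \<Gamma> R)"


subsection \<open>Effective resistance\<close>

text \<open>The Dirichlet energy; each edge occurs twice in \<^const>\<open>adj\<close>, whence the factor one half.\<close>

definition energy :: "('v, 'z) metric_graph_scheme \<Rightarrow> ('v \<Rightarrow> real) \<Rightarrow> ennreal" where
  "energy \<Gamma> f = (\<integral>\<^sup>+(x, y). ennreal ((f x - f y)\<^sup>2) \<partial>count_space (adj \<Gamma>)) / 2"

definition finite_energy :: "('v, 'z) metric_graph_scheme \<Rightarrow> ('v \<Rightarrow> real) set" where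
  "finite_energy \<Gamma> = {f. energy \<Gamma> f < \<infinity>}"

definition Reff :: "('v, 'z) metric_graph_scheme \<Rightarrow> 'v set \<Rightarrow> 'v set \<Rightarrow> ennreal" where
  "Reff \<Gamma> A B =
     inverse (INF f\<in>{f \<in> finite_energy \<Gamma>. (\<forall>x\<in>A. f x = 1) \<and> (\<forall>x\<in>B. f x = 0)}. energy \<Gamma> f)"

definition Reff_pt :: "('v, 'z) metric_graph_scheme \<Rightarrow> 'v \<Rightarrow> 'v \<Rightarrow> ennreal" where
  "Reff_pt \<Gamma> x y = (if x = y then 0 else Reff \<Gamma> {x} {y})"

text \<open>The resistance from the marked vertex to the complement of the ball around it.\<close>

definition Reff_ball :: "('v, 'z) metric_graph_scheme \<Rightarrow> ennreal \<Rightarrow> ennreal" where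
  "Reff_ball \<Gamma> R = Reff \<Gamma> {origin \<Gamma>} (verts \<Gamma> - gball \<Gamma> R)"


subsection \<open>Simple random walk\<close>

definition nbr_step :: "('v, 'z) metric_graph_scheme \<Rightarrow> 'v \<Rightarrow> 'v pmf" where
  "nbr_step \<Gamma> x = pmf_of_set {y. (x, y) \<in> adj \<Gamma>}"

text \<open>The law of the \<open>n\<close>-th position given the positions before time \<open>n\<close>, for the walk started
  in \<open>x\<close>, and the resulting law on infinite trajectories.\<close>

definition walk_kernel ::
  "('v, 'z) metric_graph_scheme \<Rightarrow> 'v \<Rightarrow> nat \<Rightarrow> (nat \<Rightarrow> 'v) \<Rightarrow> 'v measure" where
  "walk_kernel \<Gamma> x n w = measure_pmf (if n = 0 then return_pmf x else nbr_step \<Gamma> (w (n - 1)))"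

definition walk :: "('v, 'z) metric_graph_scheme \<Rightarrow> 'v \<Rightarrow> (nat \<Rightarrow> 'v) measure" where
  "walk \<Gamma> x = projective_family.lim UNIV
     (Ionescu_Tulcea.CI (walk_kernel \<Gamma> x) (\<lambda>_. count_space UNIV)) (\<lambda>_. count_space UNIV)"

definition heat_kernel :: "('v, 'z) metric_graph_scheme \<Rightarrow> nat \<Rightarrow> 'v \<Rightarrow> 'v \<Rightarrow> real" where
  "heat_kernel \<Gamma> n x y = measure (walk \<Gamma> x) {w \<in> space (walk \<Gamma> x). w n = y} / real (deg \<Gamma> y)"

definition exit_time :: "('v, 'z) metric_graph_scheme \<Rightarrow> ennreal \<Rightarrow> (nat \<Rightarrow> 'v) \<Rightarrow> enat" where
  "exit_time \<Gamma> R w = Inf (enat ` {n. w n \<notin> gball \<Gamma> R})"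

definition mean_exit_time :: "('v, 'z) metric_graph_scheme \<Rightarrow> ennreal \<Rightarrow> ennreal" where
  "mean_exit_time \<Gamma> R = (\<integral>\<^sup>+w. ennreal_of_enat (exit_time \<Gamma> R w) \<partial>walk \<Gamma> (origin \<Gamma>))"

definition mean_displacement :: "('v, 'z) metric_graph_scheme \<Rightarrow> nat \<Rightarrow> ennreal" where
  "mean_displacement \<Gamma> n = (\<integral>\<^sup>+w. ennreal (gdist \<Gamma> (origin \<Gamma>) (w n)) \<partial>walk \<Gamma> (origin \<Gamma>))"

lemma Ionescu_Tulcea_walk: "Ionescu_Tulcea (walk_kernel \<Gamma> x) (\<lambda>_. count_space UNIV)"
proof (rule Ionescu_Tulcea.intro)
  fix n :: nat
  let ?K = "\<lambda>y. measure_pmf (nbr_step \<Gamma> y)"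
  have K: "?K \<in> measurable (count_space UNIV) (subprob_algebra (count_space UNIV))"
    by (auto simp: space_subprob_algebra measure_pmf.subprob_space_axioms)
  show "walk_kernel \<Gamma> x n \<in>
      measurable (PiM {0..<n} (\<lambda>_. count_space UNIV)) (subprob_algebra (count_space UNIV))"
  proof (cases n)
    case 0
    then show ?thesis
      by (auto simp: walk_kernel_def[abs_def] space_subprob_algebra
          measure_pmf.subprob_space_axioms intro!: measurable_const)
  next
    case (Suc m)
    have "(\<lambda>w. w m) \<in> measurable (PiM {0..<Suc m} (\<lambda>_. count_space UNIV)) (count_space UNIV)"
      by (rule measurable_component_singleton) simp
    from measurable_compose[OF this K] Suc show ?thesis
      by (simp add: walk_kernel_def[abs_def])
  qed
  show "prob_space (walk_kernel \<Gamma> x n w)" for w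
    unfolding walk_kernel_def by (rule measure_pmf.prob_space_axioms)
qed

text \<open>The finite-dimensional distributions characterise the simple random walk.\<close>

lemma walk_cylinder:
  "emeasure (walk \<Gamma> x) {w. \<forall>i\<le>n. w i = p i} =
     indicator {x} (p 0) * (\<Prod>i<n. ennreal (pmf (nbr_step \<Gamma> (p i)) (p (Suc i))))"
proof -
  interpret Ionescu_Tulcea "walk_kernel \<Gamma> x" "\<lambda>_. count_space UNIV"
    by (rule Ionescu_Tulcea_walk)
  let ?M = "\<lambda>m. PiM {0..<m} (\<lambda>_. count_space UNIV :: 'a measure)"
  let ?p = "\<lambda>m. restrict p {0..<m}"
  have single: "{?p m} = Pi\<^sub>E {0..<m} (\<lambda>i. {p i})" for m
    by (auto simp: PiE_iff extensional_def fun_eq_iff)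
  have sets_single[measurable]: "{?p m} \<in> sets (?M m)" for m
    unfolding single by (rule sets_PiM_I_finite) auto
  have eq: "w(m := y) = ?p (Suc m) \<longleftrightarrow> w = ?p m \<and> y = p m"
    if "w \<in> space (?M m)" for w m y
    using that by (auto simp: space_PiM PiE_iff extensional_def fun_eq_iff less_Suc_eq split: if_splits)
  have eP: "emeasure (eP m w) {?p (Suc m)} =
      emeasure (walk_kernel \<Gamma> x m (?p m)) {p m} * indicator {?p m} w"
    if w: "w \<in> space (?M m)" for w m
    using w by (subst emeasure_eP)
      (auto simp: vimage_def eq split: split_indicator)
  have step: "emeasure (C 0 (Suc m) (\<lambda>_. undefined)) {?p (Suc m)} =
      emeasure (walk_kernel \<Gamma> x m (?p m)) {p m} * emeasure (C 0 m (\<lambda>_. undefined)) {?p m}" for m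
  proof -
    have u: "(\<lambda>_. undefined) \<in> space (?M 0)"
      by (auto simp: space_PiM PiE_iff extensional_def)
    have sp: "space (C 0 m (\<lambda>_. undefined)) = space (?M m)"
      using space_C[OF u, of m] by simp
    have "emeasure (C 0 (Suc m) (\<lambda>_. undefined)) {?p (Suc m)} =
        (\<integral>\<^sup>+w. emeasure (eP m w) {?p (Suc m)} \<partial>C 0 m (\<lambda>_. undefined))"
      using sets_single[of "Suc m"] measurable_eP[of m]
      by (simp, subst emeasure_bind[where N="?M (Suc m)"])
         (auto simp: sp measurable_cong_sets[OF sets_C[OF u, of m]] space_PiM)
    also have "\<dots> = (\<integral>\<^sup>+w. emeasure (walk_kernel \<Gamma> x m (?p m)) {p m} * indicator {?p m} w
        \<partial>C 0 m (\<lambda>_. undefined))"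
      by (intro nn_integral_cong eP) (simp add: sp)
    also have "\<dots> = emeasure (walk_kernel \<Gamma> x m (?p m)) {p m} *
        emeasure (C 0 m (\<lambda>_. undefined)) {?p m}"
      using sets_single[of m] sets_C[OF u, of m] by (subst nn_integral_cmult_indicator) auto
    finally show ?thesis .
  qed
  have C: "emeasure (C 0 (Suc m) (\<lambda>_. undefined)) {?p (Suc m)} =
     indicator {x} (p 0) * (\<Prod>i<m. ennreal (pmf (nbr_step \<Gamma> (p i)) (p (Suc i))))" for m
  proof (induction m)
    case 0
    show ?case
      using sets_single[of 0]
      by (subst step) (auto simp: walk_kernel_def emeasure_pmf_single split: split_indicator)
  next
    case (Suc m)
    have "emeasure (walk_kernel \<Gamma> x (Suc m) (?p (Suc m))) {p (Suc m)} =
        ennreal (pmf (nbr_step \<Gamma> (p m)) (p (Suc m)))"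
      by (simp add: walk_kernel_def emeasure_pmf_single)
    then show ?case
      unfolding step[of "Suc m"] Suc.IH by (simp add: ac_simps)
  qed
  have emb: "prod_emb UNIV (\<lambda>_. count_space UNIV) {0..<Suc n} {?p (Suc n)} = {w. \<forall>i\<le>n. w i = p i}"
    by (auto simp: prod_emb_def space_PiM fun_eq_iff restrict_def less_Suc_eq_le) metis
  have "emeasure (walk \<Gamma> x) {w. \<forall>i\<le>n. w i = p i} = emeasure (CI {0..<Suc n}) {?p (Suc n)}"
    unfolding walk_def emb[symmetric] by (rule lim) auto
  also have "\<dots> = emeasure (C 0 (Suc n) (\<lambda>_. undefined)) {?p (Suc n)}"
    using emeasure_CI[of "{0..<Suc n}" "Suc n" "{?p (Suc n)}"] sets_single[of "Suc n"]
    by (simp add: prod_emb_id space_PiM)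
  finally show ?thesis
    by (simp only: C)
qed


subsection \<open>Growth functions\<close>

definition growth_function :: "real \<Rightarrow> real \<Rightarrow> real \<Rightarrow> (ennreal \<Rightarrow> ennreal) \<Rightarrow> bool" where
  "growth_function C a b f \<longleftrightarrow>
     continuous_on UNIV f \<and> strict_mono f \<and> f 0 = 0 \<and> f 1 = 1 \<and> f \<infinity> = \<infinity> \<and>
     (\<forall>R' R :: real. 0 < R' \<and> R' \<le> R \<longrightarrow>
        ennreal (inverse C * (R / R') powr a) \<le> f (ennreal R) / f (ennreal R') \<and>
        f (ennreal R) / f (ennreal R') \<le> ennreal (C * (R / R') powr b))"


subsection \<open>Good radii and random graphs\<close>

definition good_radii ::
  "(ennreal \<Rightarrow> ennreal) \<Rightarrow> (ennreal \<Rightarrow> ennreal) \<Rightarrow> ('v, 'z) metric_graph_scheme \<Rightarrow> real \<Rightarrow> ennreal set"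
where
  "good_radii v r \<Gamma> lam = {R. 1 \<le> R \<and>
     ennreal (inverse lam) * v R \<le> vol \<Gamma> R \<and> vol \<Gamma> R \<le> ennreal lam * v R \<and>
     ennreal (inverse lam) * r R \<le> Reff_ball \<Gamma> R \<and>
     (\<forall>y\<in>gball \<Gamma> R. Reff_pt \<Gamma> (origin \<Gamma>) y \<le> ennreal lam * r (ennreal (gdist \<Gamma> (origin \<Gamma>) y)))}"

text \<open>
  A random graph is a family of marked graphs for which the numerical quantities of interest are
  random variables.  For a continuous increasing \<open>r\<close>, measurability of the suprema
  of the resistances over balls gives measurability of the event
  \<open>\<forall>y\<in>gball \<Gamma> R. Reff_pt \<Gamma> (origin \<Gamma>) y \<le> lam * r (gdist \<Gamma> (origin \<Gamma>) y)\<close>: its complement is the union, over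
  rational \<open>0 < t \<le> R\<close>, of the events that the supremum over the ball of radius \<open>t\<close>
  exceeds \<open>lam * r t\<close>.
\<close>

definition random_graph :: "'w measure \<Rightarrow> ('w \<Rightarrow> ('v, 'z) metric_graph_scheme) \<Rightarrow> bool" where
  "random_graph M \<Gamma> \<longleftrightarrow> prob_space M \<and>
     (\<forall>\<omega>\<in>space M. marked_graph (\<Gamma> \<omega>)) \<and>
     (\<forall>R. (\<lambda>\<omega>. vol (\<Gamma> \<omega>) R) \<in> borel_measurable M) \<and>
     (\<forall>R. (\<lambda>\<omega>. Reff_ball (\<Gamma> \<omega>) R) \<in> borel_measurable M) \<and>
     (\<forall>R. (\<lambda>\<omega>. SUP y\<in>gball (\<Gamma> \<omega>) R. Reff_pt (\<Gamma> \<omega>) (origin (\<Gamma> \<omega>)) y) \<in> borel_measurable M) \<and>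
     (\<forall>R. (\<lambda>\<omega>. mean_exit_time (\<Gamma> \<omega>) R) \<in> borel_measurable M) \<and>
     (\<forall>n. (\<lambda>\<omega>. heat_kernel (\<Gamma> \<omega>) n (origin (\<Gamma> \<omega>)) (origin (\<Gamma> \<omega>))) \<in> borel_measurable M) \<and>
     (\<forall>n. (\<lambda>\<omega>. mean_displacement (\<Gamma> \<omega>) n) \<in> borel_measurable M)"

end

theory Submission
  imports Defs
begin

text \<open>
  All estimates are derived for the walk killed on leaving a finite set \<open>B\<close> of vertices, whose
  transition operator \<open>P\<close> is self-adjoint for the inner product weighted by the degrees.  For functions
  supported in \<open>B\<close> the form of \<open>I - P\<close> is the Dirichlet energy \<open>E\<close> of the graph
  (\<open>energy_dirichlet\<close>).  Upper bounds on resistances enter through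
  \<open>(f a - f b)\<^sup>2 \<le> R\<^sub>e\<^sub>f\<^sub>f(a, b) * E(f, f)\<close>, which is the definition of resistance
  (\<open>Reff_bound\<close>).  The main object is the Green function \<open>g\<close> with pole at the marked vertex \<open>0\<close>, truncated at
  a finite time; it satisfies \<open>E(g, f) = f 0 - (remainder)\<close> (\<open>dirichlet_green\<close>).

  \<^item> Exit times: \<open>g\<close> is largest at \<open>0\<close> (\<open>green_max\<close>), where it is at most \<open>R\<^sub>e\<^sub>f\<^sub>f(0, B\<^sup>c)\<close> and, for
    long truncation times, almost equal to it.  Summation over \<open>B = B(R)\<close> gives
    the expected exit time \<open>\<le> R\<^sub>e\<^sub>f\<^sub>f(0, B\<^sup>c) V(R)\<close> (\<open>mean_exit_time_upper\<close>).  Since the energy of \<open>g\<close> is at most \<open>g 0\<close>,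
    the values of \<open>g\<close> at vertices whose resistance to \<open>0\<close> is a small fraction of \<open>R\<^sub>e\<^sub>f\<^sub>f(0, B\<^sup>c)\<close> are
    comparable with \<open>g 0\<close>, which gives the lower bound (\<open>mean_exit_time_lower\<close>).

  \<^item> Heat kernel from below: an expected exit time that is large from \<open>0\<close> and not larger, up to a
    constant, from the other vertices forces the walk to survive up to a comparable time \<open>n\<close> with
    probability bounded below.  By the Cauchy--Schwarz inequality the square of this probability is at most the volume times
    \<open>p\<^sub>2\<^sub>n(0, 0)\<close> (\<open>heat_kernel_lower\<close>).

  \<^item> Heat kernel from above: the energy of \<open>f\<^sub>k = p\<^sub>k(0, \<cdot>) + p\<^sub>k\<^sub>+\<^sub>1(0, \<cdot>)\<close> is the decrement
    \<open>f\<^sub>2\<^sub>k(0) - f\<^sub>2\<^sub>k\<^sub>+\<^sub>2(0)\<close>, hence small for some \<open>k\<close> between \<open>n\<close> and \<open>2 n\<close>; for such a \<open>k\<close> the function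
    \<open>f\<^sub>k\<close> varies little on \<open>B(R)\<close>, where its mass is at most two.  The bound is
    \<open>p\<^sub>2\<^sub>n(0, 0) \<le> 3 / V(R) + 4 S / n\<close>, where \<open>S\<close> bounds the resistances to the vertices of \<open>B(R)\<close> (\<open>heat_kernel_upper\<close>).

  \<^item> Displacement: another application of the Cauchy--Schwarz inequality converts the upper heat kernel bound into
    \<open>P(X\<^sub>n \<in> B(R))\<^sup>2 \<le> V(R) p\<^sub>2\<^sub>n(0, 0)\<close>, which is small for \<open>R\<close> a small multiple of \<open>I(n)\<close>.

  The means of exit time, heat kernel and displacement are bounded below by fixing one \<open>lam\<close> for which
  every radius is good with probability at least \<open>5 / 6\<close>, and by applying the above at the radii
  \<open>R / A\<close>, \<open>R\<close> for the exit time from \<open>B(R)\<close>, at \<open>x\<close>, \<open>A x\<close>, \<open>A\<^sup>2 x\<close> for the heat kernel and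
  at \<open>x / D\<close>, \<open>x\<close> for the displacement, where \<open>x = I(n)\<close> satisfies \<open>v(x) r(x) = n\<close>.
  The upper bound on the mean exit time integrates \<open>mean_exit_time_upper\<close> and uses the bound on the
  mean of \<open>R\<^sub>e\<^sub>f\<^sub>f(0, B(R)\<^sup>c) V(R)\<close>.  For the last claim, the upper heat kernel bound at \<open>x = I(n)\<close> is linear in \<open>lam\<close>, so
  that \<open>v(x) p\<^sub>2\<^sub>n(0, 0)\<close> has a tail of order \<open>lam powr -q\<close> with \<open>q > 2\<close>, and such a tail is integrable.
\<close>

section \<open>Graphs and killed walks\<close>

locale random_walk_graph =
  fixes \<Gamma> :: "('v, 'z) metric_graph_scheme"
  assumes marked: "marked_graph \<Gamma>"
begin

abbreviation nbrs :: "'v \<Rightarrow> 'v set" where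
  "nbrs x \<equiv> {y. (x, y) \<in> adj \<Gamma>}"

abbreviation degr :: "'v \<Rightarrow> real" where
  "degr x \<equiv> real (deg \<Gamma> x)"

definition weight :: "'v \<Rightarrow> 'v \<Rightarrow> real" where
  "weight x y = of_bool ((x, y) \<in> adj \<Gamma>)"

lemma adj_sym: "(x, y) \<in> adj \<Gamma> \<longleftrightarrow> (y, x) \<in> adj \<Gamma>"
  by (simp add: adj_def insert_commute)

lemma weight_sym: "weight x y = weight y x"
  by (simp add: weight_def adj_sym[of x y])

lemma weight_nonneg [simp]: "0 \<le> weight x y"
  by (simp add: weight_def)

lemma edges_two: "e \<in> edges \<Gamma> \<Longrightarrow> e \<subseteq> verts \<Gamma> \<and> card e = 2"
  using marked by (auto simp: marked_graph_def)

lemma adj_verts: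
  assumes "(x, y) \<in> adj \<Gamma>" shows "x \<in> verts \<Gamma>" "y \<in> verts \<Gamma>" "x \<noteq> y"
proof -
  have "{x, y} \<in> edges \<Gamma>" using assms by (simp add: adj_def)
  then have "{x, y} \<subseteq> verts \<Gamma>" "card {x, y} = 2" using edges_two by auto
  then show "x \<in> verts \<Gamma>" "y \<in> verts \<Gamma>" "x \<noteq> y" by (auto split: if_splits)
qed

lemma nbrs_bij: "bij_betw (\<lambda>y. {x, y}) (nbrs x) {e \<in> edges \<Gamma>. x \<in> e}"
proof (rule bij_betw_imageI)
  show "inj_on (\<lambda>y. {x, y}) (nbrs x)"
    by (auto simp: inj_on_def doubleton_eq_iff)
  show "(\<lambda>y. {x, y}) ` nbrs x = {e \<in> edges \<Gamma>. x \<in> e}"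
  proof (intro equalityI subsetI)
    fix e assume e: "e \<in> {e \<in> edges \<Gamma>. x \<in> e}"
    then have "card e = 2" using edges_two by auto
    then obtain a b where ab: "e = {a, b}" "a \<noteq> b" by (auto simp: card_2_iff)
    with e show "e \<in> (\<lambda>y. {x, y}) ` nbrs x"
      by (auto simp: adj_def insert_commute image_iff intro: exI[of _ b] exI[of _ a])
  qed (auto simp: adj_def)
qed

lemma finite_nbrs [simp]: "finite (nbrs x)"
proof (cases "x \<in> verts \<Gamma>")
  case True
  then have "finite {e \<in> edges \<Gamma>. x \<in> e}" using marked by (auto simp: marked_graph_def)
  then show ?thesis using bij_betw_finite[OF nbrs_bij] by simp
next
  case False
  then have "nbrs x = {}" using adj_verts by auto
  then show ?thesis by simp
qed

lemma card_nbrs: "card (nbrs x) = deg \<Gamma> x"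
  using bij_betw_same_card[OF nbrs_bij] by (simp add: deg_def)

lemma infinite_verts: "infinite (verts \<Gamma>)"
  and origin_verts [simp]: "origin \<Gamma> \<in> verts \<Gamma>"
  and connected: "x \<in> verts \<Gamma> \<Longrightarrow> y \<in> verts \<Gamma> \<Longrightarrow> (x, y) \<in> (adj \<Gamma>)\<^sup>*"
  and metric: "Metric_space (verts \<Gamma>) (gdist \<Gamma>)"
  using marked by (auto simp: marked_graph_def)

lemma nbrs_nonempty: "x \<in> verts \<Gamma> \<Longrightarrow> nbrs x \<noteq> {}"
proof -
  assume x: "x \<in> verts \<Gamma>"
  obtain y where y: "y \<in> verts \<Gamma>" "y \<noteq> x"
    using infinite_verts by (metis finite.simps insertI1 insert_iff subsetI finite_subset)
  from connected[OF x y(1)] y(2) show ?thesis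
    by (cases rule: converse_rtranclE) auto
qed

lemma deg_pos: "x \<in> verts \<Gamma> \<Longrightarrow> 0 < degr x"
  using nbrs_nonempty[of x] by (simp add: card_nbrs[symmetric] card_gt_0_iff)

lemma sum_weight:
  assumes "finite A" "nbrs x \<subseteq> A" shows "(\<Sum>y\<in>A. weight x y) = degr x"
proof -
  have "(\<Sum>y\<in>A. weight x y) = (\<Sum>y\<in>nbrs x. weight x y)"
    using assms by (intro sum.mono_neutral_right) (auto simp: weight_def)
  also have "\<dots> = degr x" by (simp add: weight_def card_nbrs)
  finally show ?thesis .
qed

lemma sum_weight_le:
  assumes "finite A" shows "(\<Sum>y\<in>A. weight x y) \<le> degr x"
proof -
  have "(\<Sum>y\<in>A. weight x y) \<le> (\<Sum>y\<in>A \<union> nbrs x. weight x y)"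
    using assms by (intro sum_mono2) auto
  with sum_weight[of "A \<union> nbrs x" x] assms show ?thesis by simp
qed

text \<open>The transition operator \<open>P\<close> of the walk killed on leaving \<open>B\<close>, the degree-weighted inner product
  for which it is self-adjoint, and the form of \<open>I - P\<close>.\<close>

definition killed_step :: "'v set \<Rightarrow> ('v \<Rightarrow> real) \<Rightarrow> 'v \<Rightarrow> real" where
  "killed_step B f x = (if x \<in> B then (\<Sum>y\<in>B. weight x y * f y) / degr x else 0)"

definition deg_inner :: "'v set \<Rightarrow> ('v \<Rightarrow> real) \<Rightarrow> ('v \<Rightarrow> real) \<Rightarrow> real" where
  "deg_inner B f g = (\<Sum>x\<in>B. degr x * f x * g x)"

definition dirichlet :: "'v set \<Rightarrow> ('v \<Rightarrow> real) \<Rightarrow> ('v \<Rightarrow> real) \<Rightarrow> real" where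
  "dirichlet B f g = deg_inner B f g - deg_inner B f (killed_step B g)"

text \<open>The kernel is a density with respect to the degrees: the walk from \<open>x\<close> is at \<open>y\<close> at time \<open>n\<close>, and
  has not left \<open>B\<close> before, with probability \<open>degr y * killed_kernel B x n y\<close>.\<close>

definition killed_kernel :: "'v set \<Rightarrow> 'v \<Rightarrow> nat \<Rightarrow> 'v \<Rightarrow> real" where
  "killed_kernel B x n = (killed_step B ^^ n) (\<lambda>y. if y = x then 1 / degr x else 0)"

text \<open>The probability, as a function of the starting point, of staying in \<open>B\<close> up to time \<open>n\<close>.\<close>

definition survival :: "'v set \<Rightarrow> nat \<Rightarrow> 'v \<Rightarrow> real" where
  "survival B n = (killed_step B ^^ n) (indicator B)"

text \<open>The Green function (as a density, like the kernel) of the killed walk observed before time \<open>N\<close>.\<close>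

definition green :: "'v set \<Rightarrow> 'v \<Rightarrow> nat \<Rightarrow> 'v \<Rightarrow> real" where
  "green B x N y = (\<Sum>k<N. killed_kernel B x k y)"

end

locale killed_walk = random_walk_graph \<Gamma> for \<Gamma> :: "('v, 'z) metric_graph_scheme" +
  fixes B :: "'v set"
  assumes finite_B: "finite B" and B_verts: "B \<subseteq> verts \<Gamma>"
begin

lemma deg_B: "x \<in> B \<Longrightarrow> 0 < degr x"
  using deg_pos B_verts by auto

lemma deg_inner_killed_step: "deg_inner B f (killed_step B g) = (\<Sum>x\<in>B. \<Sum>y\<in>B. weight x y * f x * g y)"
  unfolding deg_inner_def
proof (intro sum.cong refl)
  fix x assume x: "x \<in> B"
  then have "degr x * f x * killed_step B g x = f x * (\<Sum>y\<in>B. weight x y * g y)"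
    using deg_B[OF x] by (simp add: killed_step_def)
  then show "degr x * f x * killed_step B g x = (\<Sum>y\<in>B. weight x y * f x * g y)"
    by (simp add: sum_distrib_left mult_ac)
qed

lemma deg_inner_commute: "deg_inner B f g = deg_inner B g f"
  by (simp add: deg_inner_def mult_ac)

lemma deg_inner_killed_step_sym: "deg_inner B (killed_step B f) g = deg_inner B f (killed_step B g)"
proof -
  have "deg_inner B (killed_step B f) g = (\<Sum>x\<in>B. \<Sum>y\<in>B. weight x y * g x * f y)"
    by (subst deg_inner_commute) (rule deg_inner_killed_step)
  also have "\<dots> = (\<Sum>y\<in>B. \<Sum>x\<in>B. weight x y * g x * f y)" by (rule sum.swap)
  also have "\<dots> = deg_inner B f (killed_step B g)"
    unfolding deg_inner_killed_step by (intro sum.cong refl) (simp add: weight_sym mult_ac)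
  finally show ?thesis .
qed

lemma deg_inner_add_left: "deg_inner B (\<lambda>x. f x + f' x) g = deg_inner B f g + deg_inner B f' g"
  by (simp add: deg_inner_def sum.distrib[symmetric] algebra_simps)

lemma deg_inner_add_right: "deg_inner B g (\<lambda>x. f x + f' x) = deg_inner B g f + deg_inner B g f'"
  by (simp add: deg_inner_def sum.distrib[symmetric] algebra_simps)

lemma deg_inner_scale_right: "deg_inner B g (\<lambda>x. c * f x) = c * deg_inner B g f"
  by (simp add: deg_inner_def sum_distrib_left mult_ac)

lemma deg_inner_sum_right: "deg_inner B g (\<lambda>x. \<Sum>k\<in>K. f k x) = (\<Sum>k\<in>K. deg_inner B g (f k))"
  by (simp add: deg_inner_def sum_distrib_left) (rule sum.swap)

lemma killed_step_outside: "x \<notin> B \<Longrightarrow> killed_step B f x = 0"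
  by (simp add: killed_step_def)

lemma killed_step_nonneg: "(\<And>y. 0 \<le> f y) \<Longrightarrow> 0 \<le> killed_step B f x"
  by (auto simp: killed_step_def intro!: divide_nonneg_nonneg sum_nonneg mult_nonneg_nonneg)

lemma dirichlet_alt: "dirichlet B f g = (\<Sum>x\<in>B. degr x * f x * g x) - (\<Sum>x\<in>B. \<Sum>y\<in>B. weight x y * f x * g y)"
  by (simp add: dirichlet_def deg_inner_killed_step) (simp add: deg_inner_def)

text \<open>For functions supported in \<open>B\<close> the form of the killed step is the Dirichlet energy of the whole
  graph: the killed edges contribute to the degrees in the diagonal part.\<close>

lemma dirichlet_gradient:
  assumes A: "finite A" "B \<subseteq> A" "\<And>x. x \<in> B \<Longrightarrow> nbrs x \<subseteq> A"
    and f: "\<And>x. x \<notin> B \<Longrightarrow> f x = 0" and g: "\<And>x. x \<notin> B \<Longrightarrow> g x = 0"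
  shows "dirichlet B f g = (\<Sum>x\<in>A. \<Sum>y\<in>A. weight x y * ((f x - f y) * (g x - g y))) / 2"
proof -
  have diag: "(\<Sum>x\<in>A. \<Sum>y\<in>A. weight x y * f x * g x) = (\<Sum>x\<in>B. degr x * f x * g x)"
  proof -
    have "(\<Sum>x\<in>A. \<Sum>y\<in>A. weight x y * f x * g x) = (\<Sum>x\<in>B. \<Sum>y\<in>A. weight x y * f x * g x)"
      using A f by (intro sum.mono_neutral_right) auto
    also have "\<dots> = (\<Sum>x\<in>B. degr x * f x * g x)"
      using A by (intro sum.cong refl) (simp add: sum_distrib_right[symmetric] sum_weight)
    finally show ?thesis .
  qed
  have diag': "(\<Sum>x\<in>A. \<Sum>y\<in>A. weight x y * f y * g y) = (\<Sum>x\<in>B. degr x * f x * g x)"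
    by (subst sum.swap, subst diag[symmetric]) (simp add: weight_sym)
  have off: "(\<Sum>x\<in>A. \<Sum>y\<in>A. weight x y * f x * g y) = (\<Sum>x\<in>B. \<Sum>y\<in>B. weight x y * f x * g y)"
  proof -
    have "(\<Sum>x\<in>A. \<Sum>y\<in>A. weight x y * f x * g y) = (\<Sum>x\<in>B. \<Sum>y\<in>A. weight x y * f x * g y)"
      using A f by (intro sum.mono_neutral_right) auto
    also have "\<dots> = (\<Sum>x\<in>B. \<Sum>y\<in>B. weight x y * f x * g y)"
      using A g by (intro sum.cong refl sum.mono_neutral_right) auto
    finally show ?thesis .
  qed
  have off': "(\<Sum>x\<in>A. \<Sum>y\<in>A. weight x y * f y * g x) = (\<Sum>x\<in>B. \<Sum>y\<in>B. weight x y * f x * g y)"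
    by (subst sum.swap, subst off[symmetric]) (simp add: weight_sym)
  have "(\<Sum>x\<in>A. \<Sum>y\<in>A. weight x y * ((f x - f y) * (g x - g y))) =
     (\<Sum>x\<in>A. \<Sum>y\<in>A. weight x y * f x * g x) + (\<Sum>x\<in>A. \<Sum>y\<in>A. weight x y * f y * g y)
      - (\<Sum>x\<in>A. \<Sum>y\<in>A. weight x y * f x * g y) - (\<Sum>x\<in>A. \<Sum>y\<in>A. weight x y * f y * g x)"
    by (simp add: sum.distrib[symmetric] sum_subtractf[symmetric] algebra_simps)
  then show ?thesis
    unfolding diag diag' off off' dirichlet_alt by simp
qed

text \<open>Large enough to contain every edge with an endpoint in \<open>B\<close>.\<close>

definition enlarged_B :: "'v set" where
  "enlarged_B = B \<union> (\<Union>x\<in>B. nbrs x)"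

lemma enlarged_B: "finite enlarged_B" "B \<subseteq> enlarged_B" "x \<in> B \<Longrightarrow> nbrs x \<subseteq> enlarged_B"
  using finite_B by (auto simp: enlarged_B_def)

lemma dirichlet_gradient_enlarged:
  assumes "\<And>x. x \<notin> B \<Longrightarrow> f x = 0" "\<And>x. x \<notin> B \<Longrightarrow> g x = 0"
  shows "dirichlet B f g =
    (\<Sum>x\<in>enlarged_B. \<Sum>y\<in>enlarged_B. weight x y * ((f x - f y) * (g x - g y))) / 2"
  by (rule dirichlet_gradient) (use enlarged_B assms in auto)

lemma dirichlet_nonneg:
  assumes "\<And>x. x \<notin> B \<Longrightarrow> f x = 0" shows "0 \<le> dirichlet B f f"
proof -
  have "dirichlet B f f =
      (\<Sum>x\<in>enlarged_B. \<Sum>y\<in>enlarged_B. weight x y * ((f x - f y) * (f x - f y))) / 2"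
    by (rule dirichlet_gradient_enlarged) (use assms in auto)
  also have "0 \<le> \<dots>"
    by (intro divide_nonneg_nonneg sum_nonneg mult_nonneg_nonneg zero_le_square weight_nonneg) simp
  finally show ?thesis .
qed

lemma dirichlet_commute: "dirichlet B f g = dirichlet B g f"
  unfolding dirichlet_def using deg_inner_commute[of f g] deg_inner_commute[of f "killed_step B g"] deg_inner_killed_step_sym[of g f] by simp

lemma dirichlet_diff_scale:
  "dirichlet B (\<lambda>x. f x - t * h x) (\<lambda>x. f x - t * h x) = dirichlet B f f - 2 * t * dirichlet B f h + t\<^sup>2 * dirichlet B h h"
proof -
  have *: "dirichlet B (\<lambda>x. f x - t * h x) (\<lambda>x. f x - t * h x) =
     dirichlet B f f - t * dirichlet B f h - t * dirichlet B h f + t\<^sup>2 * dirichlet B h h"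
  proof -
    let ?m = "\<lambda>f g. \<Sum>x\<in>B. degr x * f x * g x"
    let ?e = "\<lambda>f g. \<Sum>x\<in>B. \<Sum>y\<in>B. weight x y * f x * g y"
    let ?d = "\<lambda>x. f x - t * h x"
    have "?m ?d ?d = ?m f f - t * ?m f h - t * ?m h f + t\<^sup>2 * ?m h h"
      by (simp add: sum_distrib_left sum.distrib[symmetric] sum_subtractf[symmetric]
          algebra_simps power2_eq_square)
    moreover have "?e ?d ?d = ?e f f - t * ?e f h - t * ?e h f + t\<^sup>2 * ?e h h"
      by (simp add: sum_distrib_left sum.distrib[symmetric] sum_subtractf[symmetric]
          algebra_simps power2_eq_square)
    ultimately show ?thesis unfolding dirichlet_alt by (simp add: algebra_simps)
  qed
  then show ?thesis using dirichlet_commute[of h f] by simp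
qed

lemma energy_dirichlet:
  assumes f: "\<And>x. x \<notin> B \<Longrightarrow> f x = 0"
  shows "energy \<Gamma> f = ennreal (dirichlet B f f)"
proof -
  let ?A = enlarged_B
  let ?h = "\<lambda>p. case p of (x, y) \<Rightarrow> (f x - f y)\<^sup>2"
  let ?F = "adj \<Gamma> \<inter> ?A \<times> ?A"
  have fin: "finite ?F" using enlarged_B by auto
  have zero: "?h p = 0" if p: "p \<in> adj \<Gamma>" "p \<notin> ?F" for p
  proof -
    obtain x y where xy: "p = (x, y)" by (cases p)
    with p have a: "(x, y) \<in> adj \<Gamma>" "(y, x) \<in> adj \<Gamma>" using adj_sym by auto
    have "x \<notin> B \<and> y \<notin> B"
      using p a enlarged_B(2) enlarged_B(3)[of x] enlarged_B(3)[of y] xy by auto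
    then show ?thesis using f xy by simp
  qed
  have "(\<integral>\<^sup>+p. ennreal (?h p) \<partial>count_space (adj \<Gamma>)) = (\<Sum>p\<in>?F. ennreal (?h p))"
    by (rule nn_integral_count_space'[OF fin]) (use zero in auto)
  also have "\<dots> = ennreal (\<Sum>p\<in>?F. ?h p)"
    by (intro sum_ennreal) auto
  also have "(\<Sum>p\<in>?F. ?h p) = (\<Sum>p\<in>?A \<times> ?A. weight (fst p) (snd p) * ?h p)"
    using enlarged_B by (intro sum.mono_neutral_cong_left) (auto simp: weight_def)
  also have "\<dots> = (\<Sum>x\<in>?A. \<Sum>y\<in>?A. weight x y * ((f x - f y) * (f x - f y)))"
    by (subst sum.cartesian_product) (auto intro!: sum.cong simp: power2_eq_square)
  also have "\<dots> = 2 * dirichlet B f f"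
    by (simp add: dirichlet_gradient_enlarged f)
  finally have "(\<integral>\<^sup>+p. ennreal (?h p) \<partial>count_space (adj \<Gamma>)) = ennreal (2 * dirichlet B f f)" .
  then have "energy \<Gamma> f = ennreal (2 * dirichlet B f f) / 2"
    unfolding energy_def by (simp add: case_prod_unfold)
  also have "\<dots> = ennreal (dirichlet B f f)"
    using divide_ennreal[of "2 * dirichlet B f f" 2] dirichlet_nonneg[OF f] by simp
  finally show ?thesis .
qed

text \<open>A function without energy is constant on the connected graph; since \<open>B\<close> is finite and the graph
  infinite, it vanishes somewhere, hence everywhere.\<close>

lemma dirichlet_zero_imp:
  assumes f: "\<And>x. x \<notin> B \<Longrightarrow> f x = 0" and le: "dirichlet B f f \<le> 0"
  shows "f x = 0"
proof (cases "x \<in> B")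
  case True
  have terms: "weight x y * ((f x - f y) * (f x - f y)) = 0" if "x \<in> enlarged_B" "y \<in> enlarged_B" for x y
  proof -
    let ?s = "\<lambda>x. \<Sum>y\<in>enlarged_B. weight x y * ((f x - f y) * (f x - f y))"
    have "sum ?s enlarged_B = 0"
      using le dirichlet_nonneg[of f, OF f] dirichlet_gradient_enlarged[of f f, OF f f] by simp
    then have "?s x = 0"
      using that enlarged_B by (subst (asm) sum_nonneg_eq_0_iff) (auto intro!: sum_nonneg)
    then show ?thesis
      using that enlarged_B by (subst (asm) sum_nonneg_eq_0_iff) auto
  qed
  have edge: "f a = f b" if "(a, b) \<in> adj \<Gamma>" for a b
  proof (cases "a \<in> B \<or> b \<in> B")
    case True
    then have "a \<in> enlarged_B" "b \<in> enlarged_B"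
      using that adj_sym[of a b] enlarged_B(2) enlarged_B(3)[of a] enlarged_B(3)[of b] by auto
    from terms[OF this] that show ?thesis by (simp add: weight_def)
  qed (use f in auto)
  obtain z where z: "z \<in> verts \<Gamma>" "z \<notin> B"
    using infinite_verts finite_B by (meson finite_subset subsetI)
  have "(x, z) \<in> (adj \<Gamma>)\<^sup>*" using connected True B_verts z by auto
  then have "f x = f z"
    by (induction rule: rtrancl_induct) (use edge in auto)
  then show ?thesis using f z by simp
qed (use f in auto)

text \<open>Edge by edge: truncation \<open>t \<mapsto> max 0 (t - c)\<close> is nondecreasing and contracts differences.\<close>

lemma dirichlet_truncation:
  assumes g: "\<And>x. x \<notin> B \<Longrightarrow> g x = 0" and c: "0 \<le> c"
  shows "dirichlet B (\<lambda>x. max 0 (g x - c)) (\<lambda>x. max 0 (g x - c)) \<le> dirichlet B g (\<lambda>x. max 0 (g x - c))"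
proof -
  let ?u = "\<lambda>x. max 0 (g x - c)"
  have u: "\<And>x. x \<notin> B \<Longrightarrow> ?u x = 0" using g c by simp
  have "(\<Sum>x\<in>enlarged_B. \<Sum>y\<in>enlarged_B. weight x y * ((?u x - ?u y) * (?u x - ?u y)))
     \<le> (\<Sum>x\<in>enlarged_B. \<Sum>y\<in>enlarged_B. weight x y * ((g x - g y) * (?u x - ?u y)))"
  proof (intro sum_mono mult_left_mono)
    fix x y
    show "(?u x - ?u y) * (?u x - ?u y) \<le> (g x - g y) * (?u x - ?u y)"
    proof (cases "?u x - ?u y > 0")
      case True
      then have "?u x - ?u y \<le> g x - g y" by (auto simp: max_def split: if_splits)
      with True show ?thesis by (intro mult_right_mono) auto
    next
      case not_pos: False
      show ?thesis
      proof (cases "?u x = ?u y")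
        case False
        with not_pos have "g x - g y \<le> ?u x - ?u y" by (auto simp: max_def split: if_splits)
        with not_pos show ?thesis by (intro mult_right_mono_neg) auto
      qed simp
    qed
  qed auto
  then show ?thesis
    using dirichlet_gradient_enlarged[of ?u ?u, OF u u] dirichlet_gradient_enlarged[of g ?u, OF g u] by simp
qed

end

section \<open>Effective resistance\<close>

lemma ennreal_inverse_antimono:
  fixes x y :: ennreal
  assumes "x \<le> y" shows "inverse y \<le> inverse x"
proof (cases "x = 0 \<or> y = top")
  case False
  then obtain a where x: "x = ennreal a" "0 < a"
    using assms by (cases x) (auto simp: top_unique order.order_iff_strict)
  moreover obtain b where y: "y = ennreal b" "0 \<le> b" using False by (cases y) auto
  ultimately have "a \<le> b" using assms by (simp add: ennreal_le_iff)
  with x y show ?thesis by (simp add: inverse_ennreal)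
qed auto

lemma (in random_walk_graph) energy_cong:
  assumes "\<And>x. x \<in> verts \<Gamma> \<Longrightarrow> f x = g x"
  shows "energy \<Gamma> f = energy \<Gamma> g"
  unfolding energy_def
  by (intro arg_cong[where f="\<lambda>z. z / 2"] nn_integral_cong) (use assms adj_verts in auto)

lemma energy_affine:
  "energy \<Gamma> (\<lambda>x. c * (f x - b)) = ennreal (c\<^sup>2) * energy \<Gamma> f"
proof -
  have "energy \<Gamma> (\<lambda>x. c * (f x - b)) =
     (\<integral>\<^sup>+p. ennreal (c\<^sup>2) * ennreal ((f (fst p) - f (snd p))\<^sup>2) \<partial>count_space (adj \<Gamma>)) / 2"
    unfolding energy_def case_prod_unfold
  proof (intro arg_cong[where f="\<lambda>z. z / 2"] nn_integral_cong)
    fix p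
    have "(c * (f (fst p) - b) - c * (f (snd p) - b))\<^sup>2 = c\<^sup>2 * (f (fst p) - f (snd p))\<^sup>2"
      by (simp add: power2_eq_square algebra_simps)
    then show "ennreal ((c * (f (fst p) - b) - c * (f (snd p) - b))\<^sup>2) =
        ennreal (c\<^sup>2) * ennreal ((f (fst p) - f (snd p))\<^sup>2)"
      by (simp add: ennreal_mult)
  qed
  also have "\<dots> = ennreal (c\<^sup>2) * energy \<Gamma> f"
    unfolding energy_def case_prod_unfold
    by (subst nn_integral_cmult) (auto simp: ennreal_times_divide)
  finally show ?thesis .
qed

text \<open>The only way in which upper bounds on resistances are used: if \<open>a \<noteq> b\<close>, the affine image
  \<open>(f - b) / (a - b)\<close> is a competitor in the infimum that defines the resistance.\<close>

lemma Reff_bound: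
  assumes R: "Reff \<Gamma> A C \<le> ennreal S" and S: "0 \<le> S"
    and E: "energy \<Gamma> f = ennreal E" "0 \<le> E"
    and f: "\<And>x. x \<in> A \<Longrightarrow> f x = a" "\<And>x. x \<in> C \<Longrightarrow> f x = b"
  shows "(a - b)\<^sup>2 \<le> S * E"
proof (cases "a = b")
  case False
  define c where "c = 1 / (a - b)"
  define h where "h = (\<lambda>x. c * (f x - b))"
  have eh: "energy \<Gamma> h = ennreal (c\<^sup>2 * E)"
    unfolding h_def energy_affine E by (simp add: ennreal_mult E)
  let ?I = "INF f\<in>{f \<in> finite_energy \<Gamma>. (\<forall>x\<in>A. f x = 1) \<and> (\<forall>x\<in>C. f x = 0)}. energy \<Gamma> f"
  have "?I \<le> ennreal (c\<^sup>2 * E)"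
    unfolding eh[symmetric]
  proof (rule INF_lower)
    have "h \<in> finite_energy \<Gamma>" by (simp add: finite_energy_def eh)
    then show "h \<in> {f \<in> finite_energy \<Gamma>. (\<forall>x\<in>A. f x = 1) \<and> (\<forall>x\<in>C. f x = 0)}"
      using f False by (simp add: h_def c_def)
  qed
  moreover have "inverse ?I \<le> ennreal S" using R by (simp add: Reff_def)
  ultimately have le: "inverse (ennreal (c\<^sup>2 * E)) \<le> ennreal S"
    by (meson ennreal_inverse_antimono order_trans)
  have pos: "0 < c\<^sup>2 * E"
  proof (rule ccontr)
    assume "\<not> 0 < c\<^sup>2 * E"
    then have "c\<^sup>2 * E = 0" using mult_nonneg_nonneg[OF zero_le_power2 E(2), of c] by simp
    then show False using le by (simp only:) (simp add: top_unique)
  qed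
  then have "inverse (c\<^sup>2 * E) \<le> S" using le S by (simp add: inverse_ennreal)
  then have "1 \<le> S * (c\<^sup>2 * E)" using pos by (simp add: field_simps)
  then have "(a - b)\<^sup>2 * 1 \<le> (a - b)\<^sup>2 * (S * (c\<^sup>2 * E))" by (intro mult_left_mono) auto
  also have "\<dots> = S * E" using False by (simp add: c_def power_divide)
  finally show ?thesis by simp
qed (use S E in auto)

lemma Reff_le_if_energy_ge:
  assumes "0 < S"
    and "\<And>f e. (\<And>x. x \<in> A \<Longrightarrow> f x = 1) \<Longrightarrow> (\<And>x. x \<in> C \<Longrightarrow> f x = 0) \<Longrightarrow>
      energy \<Gamma> f = ennreal e \<Longrightarrow> 0 \<le> e \<Longrightarrow> 1 \<le> S * e"
  shows "Reff \<Gamma> A C \<le> ennreal S"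
proof -
  let ?I = "INF f\<in>{f \<in> finite_energy \<Gamma>. (\<forall>x\<in>A. f x = 1) \<and> (\<forall>x\<in>C. f x = 0)}. energy \<Gamma> f"
  have "ennreal (inverse S) \<le> ?I"
  proof (rule INF_greatest)
    fix f assume f: "f \<in> {f \<in> finite_energy \<Gamma>. (\<forall>x\<in>A. f x = 1) \<and> (\<forall>x\<in>C. f x = 0)}"
    then obtain e where e: "energy \<Gamma> f = ennreal e" "0 \<le> e"
      by (cases "energy \<Gamma> f") (auto simp: finite_energy_def)
    with f assms(2)[of f e] have "1 \<le> S * e" by auto
    then have "inverse S \<le> e" using assms(1) by (simp add: field_simps)
    then show "ennreal (inverse S) \<le> energy \<Gamma> f" using e by simp
  qed
  then have "inverse ?I \<le> inverse (ennreal (inverse S))"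
    by (rule ennreal_inverse_antimono)
  then show ?thesis using assms(1) by (simp add: Reff_def inverse_ennreal)
qed

section \<open>Green functions and kernels of the killed walk\<close>

context killed_walk begin

lemma killed_kernel_0: "killed_kernel B x 0 = (\<lambda>y. if y = x then 1 / degr x else 0)"
  by (simp add: killed_kernel_def)

lemma killed_kernel_Suc: "killed_kernel B x (Suc n) = killed_step B (killed_kernel B x n)"
  by (simp add: killed_kernel_def)

lemma killed_kernel_nonneg: "0 \<le> killed_kernel B x n y"
  by (induction n arbitrary: y) (auto simp: killed_kernel_0 killed_kernel_Suc intro: killed_step_nonneg)

lemma killed_kernel_outside: "x \<in> B \<Longrightarrow> y \<notin> B \<Longrightarrow> killed_kernel B x n y = 0"
  by (cases n) (auto simp: killed_kernel_0 killed_kernel_Suc killed_step_outside)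

lemma deg_inner_delta: "x \<in> B \<Longrightarrow> deg_inner B (killed_kernel B x 0) f = f x"
proof -
  assume x: "x \<in> B"
  have "deg_inner B (killed_kernel B x 0) f = (\<Sum>y\<in>B. if y = x then degr x * (1 / degr x) * f x else 0)"
    unfolding deg_inner_def killed_kernel_0 by (intro sum.cong) auto
  also have "\<dots> = f x" using x finite_B deg_B[OF x] by simp
  finally show ?thesis .
qed

text \<open>The duality between the semigroup acting on functions (expectations of the killed walk) and the
  kernel as a density: powers of the self-adjoint step move from \<open>f\<close> to the normalised point mass.\<close>

lemma killed_step_power_eq: "x \<in> B \<Longrightarrow> (killed_step B ^^ n) f x = deg_inner B (killed_kernel B x n) f"
proof (induction n arbitrary: f)
  case (Suc n)
  have "(killed_step B ^^ Suc n) f x = (killed_step B ^^ n) (killed_step B f) x"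
    by (simp add: funpow_Suc_right del: funpow.simps)
  also have "\<dots> = deg_inner B (killed_kernel B x (Suc n)) f"
    using Suc by (simp add: killed_kernel_Suc deg_inner_killed_step_sym)
  finally show ?case .
qed (simp add: deg_inner_delta)

lemma deg_inner_killed_kernels:
  assumes "x \<in> B" shows "deg_inner B (killed_kernel B x n) (killed_kernel B x m) = killed_kernel B x (n + m) x"
  unfolding killed_step_power_eq[OF assms, symmetric] by (simp add: killed_kernel_def funpow_add)

lemma deg_inner_killed_kernel_diag: "x \<in> B \<Longrightarrow> deg_inner B (killed_kernel B x n) (killed_kernel B x n) = killed_kernel B x (2 * n) x"
  using deg_inner_killed_kernels[of x n n] by (simp only: mult_2[of n])

lemma green_nonneg: "0 \<le> green B x N y"
  by (simp add: green_def sum_nonneg killed_kernel_nonneg)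

lemma green_outside: "x \<in> B \<Longrightarrow> y \<notin> B \<Longrightarrow> green B x N y = 0"
  by (simp add: green_def killed_kernel_outside)

text \<open>The Gauss--Green formula for the truncated Green function: the sum telescopes because
  \<open>(I - P) \<Sum>\<^sub>k\<^sub><\<^sub>N P\<^sup>k = I - P\<^sup>N\<close>.  Truncating at a finite time avoids all questions of
  convergence; the remainder has a favourable sign against nonnegative functions.\<close>

lemma dirichlet_green:
  assumes "x \<in> B" shows "dirichlet B (green B x N) f = f x - deg_inner B (killed_kernel B x N) f"
proof (induction N)
  case 0
  show ?case by (simp add: deg_inner_delta[OF assms]) (simp add: dirichlet_def deg_inner_def green_def)
next
  case (Suc N)
  have g: "green B x (Suc N) = (\<lambda>y. green B x N y + killed_kernel B x N y)"
    by (rule ext) (simp add: green_def)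
  have "dirichlet B (green B x (Suc N)) f = dirichlet B (green B x N) f + dirichlet B (killed_kernel B x N) f"
    unfolding g dirichlet_def by (simp add: deg_inner_add_left)
  also have "dirichlet B (killed_kernel B x N) f = deg_inner B (killed_kernel B x N) f - deg_inner B (killed_kernel B x (Suc N)) f"
    by (simp add: dirichlet_def killed_kernel_Suc deg_inner_killed_step_sym)
  finally show ?case using Suc by simp
qed

lemma deg_inner_nonneg: "(\<And>x. 0 \<le> f x) \<Longrightarrow> (\<And>x. 0 \<le> g x) \<Longrightarrow> 0 \<le> deg_inner B f g"
  by (simp add: deg_inner_def sum_nonneg)

lemma dirichlet_green_le:
  assumes "x \<in> B" shows "dirichlet B (green B x N) (green B x N) \<le> green B x N x"
  using dirichlet_green[OF assms, of N "green B x N"] deg_inner_nonneg[of "killed_kernel B x N" "green B x N", OF killed_kernel_nonneg green_nonneg]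
  by simp

text \<open>Maximum principle.  With \<open>u = max 0 (g - g x)\<close> the truncation inequality gives
  \<open>E(u, u) \<le> E(g, u)\<close>, and by the Gauss--Green formula \<open>E(g, u)\<close> is \<open>u x = 0\<close> minus a
  nonnegative remainder; so \<open>u\<close> has no energy and vanishes.\<close>

lemma green_max:
  assumes x: "x \<in> B" shows "green B x N y \<le> green B x N x"
proof -
  let ?g = "green B x N" and ?u = "\<lambda>z. max 0 (green B x N z - green B x N x)"
  have u: "?u z = 0" if "z \<notin> B" for z using that x by (simp add: green_outside green_nonneg)
  have "dirichlet B ?u ?u \<le> dirichlet B ?g ?u"
    by (rule dirichlet_truncation) (use x in \<open>auto simp: green_outside green_nonneg\<close>)
  also have "\<dots> = - deg_inner B (killed_kernel B x N) ?u" using x by (simp add: dirichlet_green)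
  also have "\<dots> \<le> 0" using deg_inner_nonneg[of "killed_kernel B x N" ?u] by (simp add: killed_kernel_nonneg)
  finally have "?u y = 0" using dirichlet_zero_imp[of ?u y] u by blast
  then show ?thesis by (simp add: max_def split: if_splits)
qed

lemma green_energy:
  assumes "x \<in> B"
  shows "energy \<Gamma> (green B x N) = ennreal (dirichlet B (green B x N) (green B x N))"
    "0 \<le> dirichlet B (green B x N) (green B x N)"
  using energy_dirichlet[of "green B x N"] dirichlet_nonneg[of "green B x N"] green_outside[OF assms] by auto

text \<open>The Green function vanishes outside \<open>B\<close> and its energy is at most its value at \<open>x\<close>, so the
  definition of the resistance gives \<open>(g x)\<^sup>2 \<le> S * g x\<close>.\<close>

lemma green_le_Reff:
  assumes x: "x \<in> B" and R: "Reff \<Gamma> {x} (verts \<Gamma> - B) \<le> ennreal S" and S: "0 \<le> S"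
  shows "green B x N x \<le> S"
proof -
  let ?g = "green B x N"
  have "(?g x - 0)\<^sup>2 \<le> S * dirichlet B ?g ?g"
    by (rule Reff_bound[OF R S green_energy[OF x]]) (auto simp: green_outside[OF x])
  also have "\<dots> \<le> S * ?g x" using dirichlet_green_le[OF x] S by (intro mult_left_mono) auto
  finally have "?g x * ?g x \<le> S * ?g x" by (simp add: power2_eq_square)
  then show ?thesis using green_nonneg[of x N x] S
    by (cases "?g x = 0") auto
qed

lemma green_diff:
  assumes x: "x \<in> B" and R: "Reff_pt \<Gamma> a b \<le> ennreal S" and S: "0 \<le> S"
  shows "(green B x N a - green B x N b)\<^sup>2 \<le> S * green B x N x"
proof (cases "a = b")
  case False
  let ?g = "green B x N"
  from False R have R: "Reff \<Gamma> {a} {b} \<le> ennreal S" by (simp add: Reff_pt_def)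
  have "(?g a - ?g b)\<^sup>2 \<le> S * dirichlet B ?g ?g"
    by (rule Reff_bound[OF R S green_energy[OF x]]) auto
  also have "\<dots> \<le> S * ?g x" using dirichlet_green_le[OF x] S by (intro mult_left_mono) auto
  finally show ?thesis .
qed (use S green_nonneg in auto)

text \<open>The converse bound holds only in the limit of infinite truncation time: for a competitor \<open>h\<close> of the
  resistance problem, \<open>E(g, h)\<close> tends to \<open>h x = 1\<close>, so that \<open>1 \<le> E(g, g) * E(h, h)\<close> by the
  Cauchy--Schwarz inequality, in the form that \<open>g - G * h\<close> has nonnegative energy.\<close>

lemma Reff_le_green:
  assumes x: "x \<in> B" and G: "\<And>N. green B x N x \<le> G" "0 < G"
  shows "Reff \<Gamma> {x} (verts \<Gamma> - B) \<le> ennreal G"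
proof (rule Reff_le_if_energy_ge[OF G(2)])
  fix f e assume f: "\<And>z. z \<in> {x} \<Longrightarrow> f z = (1::real)" "\<And>z. z \<in> verts \<Gamma> - B \<Longrightarrow> f z = 0"
    and e: "energy \<Gamma> f = ennreal e" "0 \<le> e"
  define h where "h = (\<lambda>z. if z \<in> B then f z else 0)"
  have h: "\<And>z. z \<notin> B \<Longrightarrow> h z = 0" "h x = 1" using f x by (auto simp: h_def)
  have "energy \<Gamma> h = energy \<Gamma> f" by (rule energy_cong) (use f in \<open>auto simp: h_def\<close>)
  then have eh: "dirichlet B h h = e"
    using e energy_dirichlet[OF h(1)] dirichlet_nonneg[OF h(1)] by simp
  have "summable (\<lambda>k. killed_kernel B x k y)" for y
  proof (rule summableI_nonneg_bounded[where x = G])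
    fix N show "(\<Sum>k<N. killed_kernel B x k y) \<le> G"
      using green_max[OF x, of N y] G(1)[of N] by (simp add: green_def)
  qed (simp add: killed_kernel_nonneg)
  then have lim: "(\<lambda>N. killed_kernel B x N y) \<longlonglongrightarrow> 0" for y
    by (rule summable_LIMSEQ_zero)
  have deg_inner_lim: "(\<lambda>N. deg_inner B (killed_kernel B x N) h) \<longlonglongrightarrow> 0"
    unfolding deg_inner_def by (intro tendsto_null_sum tendsto_mult_left_zero tendsto_mult_right_zero lim)
  have "0 \<le> G - 2 * G * (1 - deg_inner B (killed_kernel B x N) h) + G\<^sup>2 * e" for N
  proof -
    have "0 \<le> dirichlet B (\<lambda>z. green B x N z - G * h z) (\<lambda>z. green B x N z - G * h z)"
      by (rule dirichlet_nonneg) (simp add: h green_outside[OF x])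
    also have "\<dots> \<le> G - 2 * G * (1 - deg_inner B (killed_kernel B x N) h) + G\<^sup>2 * e"
      unfolding dirichlet_diff_scale using dirichlet_green_le[OF x, of N] G(1)[of N] dirichlet_green[OF x, of N h] h(2)
      by (simp add: eh)
    finally show ?thesis .
  qed
  moreover have "(\<lambda>N. G - 2 * G * (1 - deg_inner B (killed_kernel B x N) h) + G\<^sup>2 * e) \<longlonglongrightarrow> G - 2 * G * (1 - 0) + G\<^sup>2 * e"
    by (intro tendsto_intros deg_inner_lim)
  ultimately have "0 \<le> G - 2 * G * (1 - 0) + G\<^sup>2 * e"
    by (intro LIMSEQ_le_const) auto
  then have "0 \<le> G * (G * e - 1)" by (simp add: power2_eq_square algebra_simps)
  then show "1 \<le> G * e" using G(2) by (simp add: zero_le_mult_iff)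
qed

lemma survival_deg_inner: "x \<in> B \<Longrightarrow> survival B n x = deg_inner B (killed_kernel B x n) (indicator B)"
  by (simp add: survival_def killed_step_power_eq)

lemma survival_sum: "x \<in> B \<Longrightarrow> survival B n x = (\<Sum>y\<in>B. degr y * killed_kernel B x n y)"
  by (simp add: survival_deg_inner deg_inner_def)

lemma survival_nonneg: "0 \<le> survival B n x"
  unfolding survival_def by (induction n arbitrary: x) (auto intro: killed_step_nonneg)

lemma sum_survival_green:
  "x \<in> B \<Longrightarrow> (\<Sum>k<N. survival B k x) = (\<Sum>y\<in>B. degr y * green B x N y)"
  by (simp add: survival_sum green_def sum_distrib_left) (rule sum.swap)

lemma survival_le_1: "survival B n x \<le> 1"
proof (induction n arbitrary: x)
  case 0 show ?case by (simp add: survival_def indicator_def)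
next
  case (Suc n)
  have "survival B (Suc n) x = killed_step B (survival B n) x" by (simp add: survival_def)
  also have "\<dots> \<le> 1"
  proof (cases "x \<in> B")
    case True
    have "(\<Sum>y\<in>B. weight x y * survival B n y) \<le> (\<Sum>y\<in>B. weight x y * 1)"
      by (intro sum_mono mult_left_mono Suc) auto
    also have "\<dots> \<le> degr x" using sum_weight_le[OF finite_B] by simp
    finally show ?thesis using True deg_B[OF True] by (simp add: killed_step_def)
  qed (simp add: killed_step_def)
  finally show ?case .
qed

text \<open>The Markov property at time \<open>n\<close>: conditionally on survival up to \<open>n\<close>, the expected remaining time
  is at most \<open>T\<close>.  A large expected exit time therefore forces a large survival probability.\<close>

lemma sum_survival_split:
  assumes x: "x \<in> B" and T: "\<And>z. z \<in> B \<Longrightarrow> (\<Sum>k<N. survival B k z) \<le> T"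
  shows "(\<Sum>k<n + N. survival B k x) \<le> real n + T * survival B n x"
proof -
  have "(\<Sum>k<n + N. survival B k x) = (\<Sum>k<n. survival B k x) + (\<Sum>k<N. survival B (n + k) x)"
    by (induction N) auto
  moreover have "(\<Sum>k<n. survival B k x) \<le> (\<Sum>k<n. 1)"
    by (intro sum_mono survival_le_1)
  moreover have "(\<Sum>k<N. survival B (n + k) x) \<le> T * survival B n x"
  proof -
    have "survival B (n + k) x = deg_inner B (killed_kernel B x n) (survival B k)" for k
      using killed_step_power_eq[OF x, of n "survival B k"] by (simp add: survival_def funpow_add)
    then have "(\<Sum>k<N. survival B (n + k) x) = deg_inner B (killed_kernel B x n) (\<lambda>z. \<Sum>k<N. survival B k z)"
      by (simp add: deg_inner_sum_right)
    also have "\<dots> \<le> deg_inner B (killed_kernel B x n) (\<lambda>z. T * indicator B z)"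
      unfolding deg_inner_def by (intro sum_mono mult_left_mono) (auto simp: killed_kernel_nonneg T)
    also have "\<dots> = T * survival B n x" by (simp add: deg_inner_scale_right survival_deg_inner[OF x])
    finally show ?thesis .
  qed
  ultimately show ?thesis by simp
qed

lemma Cauchy_Schwarz_killed_kernel:
  assumes x: "x \<in> B" and A: "A \<subseteq> B"
  shows "(\<Sum>y\<in>A. degr y * killed_kernel B x n y)\<^sup>2 \<le> (\<Sum>y\<in>A. degr y) * killed_kernel B x (2 * n) x"
proof -
  have "(\<Sum>y\<in>A. degr y * killed_kernel B x n y)\<^sup>2 = (\<Sum>y\<in>A. sqrt (degr y) * (sqrt (degr y) * killed_kernel B x n y))\<^sup>2"
    by (simp add: mult.assoc[symmetric])
  also have "\<dots> \<le> (\<Sum>y\<in>A. (sqrt (degr y))\<^sup>2) * (\<Sum>y\<in>A. (sqrt (degr y) * killed_kernel B x n y)\<^sup>2)"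
    by (rule Cauchy_Schwarz_ineq_sum)
  also have "(\<Sum>y\<in>A. (sqrt (degr y) * killed_kernel B x n y)\<^sup>2) \<le> (\<Sum>y\<in>B. (sqrt (degr y) * killed_kernel B x n y)\<^sup>2)"
    using A finite_B by (intro sum_mono2) auto
  also have "\<dots> = deg_inner B (killed_kernel B x n) (killed_kernel B x n)"
    unfolding deg_inner_def by (simp add: power_mult_distrib) (simp add: power2_eq_square mult_ac)
  also have "\<dots> = killed_kernel B x (2 * n) x" by (rule deg_inner_killed_kernel_diag[OF x])
  finally show ?thesis by (simp add: mult_left_mono sum_nonneg)
qed

text \<open>Young's inequality on each edge; the degree dominates the number of edges that stay in \<open>B\<close>.
  It contains both that the step is a contraction (\<open>f = P g\<close>) and that the quadratic form of
  the step is at most the squared norm (\<open>f = g\<close>).\<close>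

lemma deg_inner_killed_step_le: "deg_inner B f (killed_step B g) \<le> (deg_inner B f f + deg_inner B g g) / 2"
proof -
  have half: "(\<Sum>x\<in>B. \<Sum>y\<in>B. weight x y * (f x)\<^sup>2) \<le> deg_inner B f f" for f
  proof -
    have "(\<Sum>y\<in>B. weight x y * (f x)\<^sup>2) \<le> degr x * (f x)\<^sup>2" for x
      using sum_weight_le[OF finite_B, of x]
      by (simp add: sum_distrib_right[symmetric] mult_right_mono)
    then show ?thesis unfolding deg_inner_def by (intro sum_mono) (simp add: power2_eq_square mult.assoc)
  qed
  have half': "(\<Sum>x\<in>B. \<Sum>y\<in>B. weight x y * (g y)\<^sup>2) \<le> deg_inner B g g"
    using half[of g] by (subst sum.swap) (simp add: weight_sym)
  have "deg_inner B f (killed_step B g) \<le> (\<Sum>x\<in>B. \<Sum>y\<in>B. (weight x y * (f x)\<^sup>2 + weight x y * (g y)\<^sup>2) / 2)"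
    unfolding deg_inner_killed_step
  proof (intro sum_mono)
    fix x y
    have "weight x y * (f x * g y) \<le> weight x y * (((f x)\<^sup>2 + (g y)\<^sup>2) / 2)"
      using sum_squares_bound[of "f x" "g y"] by (intro mult_left_mono) auto
    then show "weight x y * f x * g y \<le> (weight x y * (f x)\<^sup>2 + weight x y * (g y)\<^sup>2) / 2"
      by (simp add: algebra_simps add_divide_distrib)
  qed
  also have "\<dots> = ((\<Sum>x\<in>B. \<Sum>y\<in>B. weight x y * (f x)\<^sup>2) + (\<Sum>x\<in>B. \<Sum>y\<in>B. weight x y * (g y)\<^sup>2)) / 2"
    by (simp add: sum_divide_distrib[symmetric] sum.distrib)
  finally show ?thesis using half[of f] half' by simp
qed

lemma killed_step_contraction: "deg_inner B (killed_step B g) (killed_step B g) \<le> deg_inner B g g"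
  using deg_inner_killed_step_le[of "killed_step B g" g] by simp

lemma killed_kernel_even_decreasing:
  assumes x: "x \<in> B" and "m \<le> n" shows "killed_kernel B x (2 * n) x \<le> killed_kernel B x (2 * m) x"
  using \<open>m \<le> n\<close>
proof (induction rule: dec_induct)
  case (step n)
  have "killed_kernel B x (2 * Suc n) x \<le> killed_kernel B x (2 * n) x"
    using killed_step_contraction[of "killed_kernel B x n"]
    unfolding killed_kernel_Suc[symmetric] deg_inner_killed_kernel_diag[OF x] .
  with step show ?case by simp
qed simp

lemma killed_kernel_odd_le: 
  assumes x: "x \<in> B" shows "killed_kernel B x (2 * n + 1) x \<le> killed_kernel B x (2 * n) x"
proof -
  have "killed_kernel B x (2 * n + 1) x = deg_inner B (killed_kernel B x n) (killed_kernel B x (Suc n))"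
    using deg_inner_killed_kernels[OF x, of n "Suc n"] by (simp add: mult_2[symmetric])
  also have "\<dots> \<le> killed_kernel B x (2 * n) x"
    using deg_inner_killed_step_le[of "killed_kernel B x n" "killed_kernel B x n"]
    unfolding killed_kernel_Suc[symmetric] deg_inner_killed_kernel_diag[OF x] by simp
  finally show ?thesis .
qed

text \<open>The on-diagonal upper bound.  Two consecutive kernels are added, \<open>f\<^sub>k = p\<^sub>k + p\<^sub>k\<^sub>+\<^sub>1\<close>, to
  circumvent the parity of bipartite graphs.  The mass of \<open>f\<^sub>k\<close> is at most \<open>2\<close>, so somewhere in
  \<open>A\<close> its value is at most \<open>2 / W\<close>, and from there to \<open>x\<close> it changes by at most the square root
  of \<open>S\<close> times its energy.  This energy is the decrement \<open>\<phi> k - \<phi> (Suc k)\<close> of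
  \<open>\<phi> k = f\<^sub>2\<^sub>k x\<close>, so summing the resulting inequality over \<open>n \<le> k < 2 n\<close> telescopes and leaves a
  quadratic inequality for \<open>p\<^sub>2\<^sub>n x\<close>.\<close>

lemma killed_kernel_diag_upper:
  assumes x: "x \<in> B" and n: "1 \<le> n" and W: "0 < W" and S: "0 \<le> S"
    and A: "x \<in> A"
    and vol: "A \<subseteq> B \<Longrightarrow> W \<le> (\<Sum>y\<in>A. degr y)"
    and R: "\<And>y. y \<in> A \<Longrightarrow> Reff_pt \<Gamma> x y \<le> ennreal S"
  shows "killed_kernel B x (2 * n) x \<le> 3 / W + 4 * S / n"
proof -
  define q where "q j = killed_kernel B x j x" for j
  define f where "f k = (\<lambda>y. killed_kernel B x k y + killed_kernel B x (Suc k) y)" for k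
  define \<phi> where "\<phi> k = q (2 * k) + q (2 * k + 1)" for k
  have f_out: "f k y = 0" if "y \<notin> B" for k y using that x by (simp add: f_def killed_kernel_outside)
  have f_nonneg: "0 \<le> f k y" for k y by (simp add: f_def killed_kernel_nonneg)
  have ipq: "deg_inner B (killed_kernel B x i) (killed_kernel B x j) = q (i + j)" for i j
    using x by (simp add: q_def deg_inner_killed_kernels)
  have kf: "killed_step B (f k) = f (Suc k)" for k
    unfolding f_def killed_kernel_Suc by (rule ext) (simp add: killed_step_def sum.distrib distrib_left add_divide_distrib)
  have dirichlet_f: "dirichlet B (f k) (f k) = \<phi> k - \<phi> (Suc k)" for k
  proof -
    have e: "k + k = 2 * k" "k + Suc k = 2 * k + 1" "Suc k + k = 2 * k + 1" "Suc k + Suc k = 2 * k + 2"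
      "k + Suc (Suc k) = 2 * k + 2" "Suc k + Suc (Suc k) = 2 * k + 3"
      "2 * Suc k = 2 * k + 2" "2 * k + 2 + 1 = 2 * k + 3"
      by auto
    show ?thesis
      unfolding dirichlet_def kf unfolding f_def deg_inner_add_left deg_inner_add_right ipq \<phi>_def e by linarith
  qed
  \<comment> \<open>If \<open>f k\<close> were larger on all of \<open>A\<close>, then \<open>A\<close> would lie in \<open>B\<close> and carry more than the total mass.\<close>
  have small: "\<exists>y\<in>A. f k y \<le> 2 / W" for k
  proof (rule ccontr)
    assume "\<not> ?thesis"
    then have big: "2 / W < f k y" if "y \<in> A" for y using that by auto
    have AB: "A \<subseteq> B"
    proof
      fix y assume "y \<in> A"
      with big[OF this] W show "y \<in> B" using f_out[of y k] by (cases "y \<in> B") (auto simp: field_simps)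
    qed
    have "2 \<le> (2 / W) * (\<Sum>y\<in>A. degr y)" using vol[OF AB] W by (simp add: field_simps)
    also have "\<dots> = (\<Sum>y\<in>A. degr y * (2 / W))" by (simp add: sum_distrib_left mult_ac)
    also have "\<dots> < (\<Sum>y\<in>A. degr y * f k y)"
    proof (rule sum_strict_mono)
      show "finite A" using AB finite_B finite_subset by blast
      show "A \<noteq> {}" using A by auto
      show "degr y * (2 / W) < degr y * f k y" if "y \<in> A" for y
        by (rule mult_strict_left_mono[OF big[OF that]]) (use AB that deg_B in auto)
    qed
    also have "\<dots> \<le> (\<Sum>y\<in>B. degr y * f k y)"
      using AB finite_B f_nonneg by (intro sum_mono2) auto
    also have "\<dots> = survival B k x + survival B (Suc k) x"
      using x by (simp add: survival_sum f_def distrib_left sum.distrib)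
    also have "\<dots> \<le> 2" using survival_le_1[of k x] survival_le_1[of "Suc k" x] by simp
    finally show False by simp
  qed
  have f_sq: "(f k x)\<^sup>2 \<le> 8 / W\<^sup>2 + 2 * S * (\<phi> k - \<phi> (Suc k))" for k
  proof -
    obtain y where y: "y \<in> A" "f k y \<le> 2 / W" using small by blast
    have diff: "(f k x - f k y)\<^sup>2 \<le> S * (\<phi> k - \<phi> (Suc k))"
    proof (cases "x = y")
      case True
      then show ?thesis using S dirichlet_nonneg[of "f k"] f_out dirichlet_f by simp
    next
      case False
      with R[OF y(1)] have R: "Reff \<Gamma> {x} {y} \<le> ennreal S" by (simp add: Reff_pt_def)
      show ?thesis unfolding dirichlet_f[symmetric]
        by (rule Reff_bound[OF R S energy_dirichlet dirichlet_nonneg]) (auto simp: f_out)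
    qed
    have "(f k x)\<^sup>2 \<le> 2 * (f k y)\<^sup>2 + 2 * (f k x - f k y)\<^sup>2"
      using sum_squares_bound[of "f k y" "f k x - f k y"] by (simp add: power2_eq_square algebra_simps)
    moreover have "(f k y)\<^sup>2 \<le> (2 / W)\<^sup>2" using y f_nonneg by (intro power_mono) auto
    ultimately show ?thesis using diff by (simp add: power_divide)
  qed
  have q_nonneg: "0 \<le> q j" for j by (simp add: q_def killed_kernel_nonneg)
  \<comment> \<open>One of the two times \<open>k\<close>, \<open>k + 1\<close> is even and at most \<open>2 * n\<close>, and return probabilities
    decrease along even times.\<close>
  have q_le_f: "q (2 * n) \<le> f k x" if "k < 2 * n" for k
  proof (cases "even k")
    case True
    then obtain j where "k = 2 * j" by (auto elim: evenE)
    then show ?thesis using that killed_kernel_even_decreasing[OF x, of j n] q_nonneg[of "Suc k"] by (simp add: f_def q_def)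
  next
    case False
    then obtain j where "k = 2 * j + 1" by (auto elim: oddE)
    then show ?thesis using that killed_kernel_even_decreasing[OF x, of "Suc j" n] q_nonneg[of k] by (simp add: f_def q_def)
  qed
  have "real n * (q (2 * n))\<^sup>2 = (\<Sum>k = n..<2 * n. (q (2 * n))\<^sup>2)" by simp
  also have "\<dots> \<le> (\<Sum>k = n..<2 * n. 8 / W\<^sup>2 + 2 * S * (\<phi> k - \<phi> (Suc k)))"
    using q_nonneg by (intro sum_mono order_trans[OF power_mono[OF q_le_f] f_sq]) auto
  also have "\<dots> = real n * (8 / W\<^sup>2) + 2 * S * (\<Sum>k = n..<2 * n. \<phi> k - \<phi> (Suc k))"
    by (simp add: sum.distrib sum_distrib_left)
  also have "(\<Sum>k = n..<2 * n. \<phi> k - \<phi> (Suc k)) = \<phi> n - \<phi> (2 * n)"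
    using sum_Suc_diff'[of n "2 * n" "\<lambda>k. - \<phi> k"] by simp
  also have "\<phi> n - \<phi> (2 * n) \<le> 2 * q (2 * n)"
    using killed_kernel_odd_le[OF x, of n] q_nonneg[of "2 * (2 * n)"] q_nonneg[of "2 * (2 * n) + 1"]
    unfolding \<phi>_def q_def by linarith
  finally have "real n * (q (2 * n))\<^sup>2 \<le> real n * (8 / W\<^sup>2) + 2 * S * (2 * q (2 * n))"
    using S by (simp add: mult_left_mono)
  then have quad: "(q (2 * n))\<^sup>2 \<le> 8 / W\<^sup>2 + 4 * S / n * q (2 * n)"
    using n by (simp add: field_simps)
  show ?thesis
  proof (rule ccontr)
    assume "\<not> ?thesis"
    then have gt: "3 / W + 4 * S / n < q (2 * n)" by (simp add: q_def)
    \<comment> \<open>The constant \<open>3\<close> is an upper bound for the square root of \<open>8\<close>.\<close>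
    have "3 / W \<le> q (2 * n)" using gt S by (smt (verit) divide_nonneg_nonneg of_nat_0_le_iff)
    then have "(3 / W) * (3 / W) \<le> (3 / W) * q (2 * n)" using W by (intro mult_left_mono) auto
    moreover have "(3 / W + 4 * S / n) * q (2 * n) \<le> q (2 * n) * q (2 * n)"
      using gt q_nonneg by (intro mult_right_mono) auto
    ultimately have "9 / W\<^sup>2 + 4 * S / n * q (2 * n) \<le> (q (2 * n))\<^sup>2"
      by (simp add: power2_eq_square algebra_simps)
    with quad have "9 / W\<^sup>2 \<le> 8 / W\<^sup>2" by simp
    then show False using W by (simp add: field_simps)
  qed
qed

end

section \<open>The law of the walk\<close>

lemma sets_walk [measurable_cong]: "sets (walk \<Gamma> x) = sets (PiM UNIV (\<lambda>_. count_space UNIV))"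
  and space_walk [simp]: "space (walk \<Gamma> x) = UNIV"
proof -
  interpret Ionescu_Tulcea "walk_kernel \<Gamma> x" "\<lambda>_. count_space UNIV"
    by (rule Ionescu_Tulcea_walk)
  show s: "sets (walk \<Gamma> x) = sets (PiM UNIV (\<lambda>_. count_space UNIV))"
    unfolding walk_def by simp
  show "space (walk \<Gamma> x) = UNIV"
    using sets_eq_imp_space_eq[OF s] by (simp add: space_PiM)
qed

text \<open>The law on trajectories is a projective limit; a functional of finitely many positions is
  integrated against the corresponding finite-dimensional law, where the kernels can be composed.\<close>

lemma nn_integral_walk_prefix:
  fixes F :: "(nat \<Rightarrow> 'v) \<Rightarrow> ennreal"
  assumes F: "F \<in> borel_measurable (PiM {0..<n} (\<lambda>_. count_space UNIV))"
  shows "(\<integral>\<^sup>+w. F (restrict w {0..<n}) \<partial>walk \<Gamma> x) =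
    (\<integral>\<^sup>+w. F w \<partial>Ionescu_Tulcea.C (walk_kernel \<Gamma> x) (\<lambda>_. count_space UNIV) 0 n (\<lambda>_. undefined))"
proof -
  interpret Ionescu_Tulcea "walk_kernel \<Gamma> x" "\<lambda>_. count_space UNIV"
    by (rule Ionescu_Tulcea_walk)
  have u: "up_to {0..<n} = n"
  proof (rule antisym)
    show "up_to {0..<n} \<le> n" by (simp add: up_to_iff_Ico)
    show "n \<le> up_to {0..<n}"
      using up_to[of "{0..<n}"] by auto
  qed
  have "CI {0..<n} = C 0 n (\<lambda>_. undefined)"
    unfolding CI_def u using distr_C[of n n "\<lambda>_. undefined" 0] by simp
  moreover have "(\<integral>\<^sup>+w. F (restrict w {0..<n}) \<partial>walk \<Gamma> x) =
      (\<integral>\<^sup>+w. F w \<partial>distr PF.lim (PiM {0..<n} (\<lambda>_. count_space UNIV)) (\<lambda>w. restrict w {0..<n}))"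
    unfolding walk_def
  proof (rule nn_integral_distr[symmetric])
    show "(\<lambda>w. restrict w {0..<n}) \<in> measurable PF.lim (PiM {0..<n} (\<lambda>_. count_space UNIV))"
      unfolding measurable_cong_sets[OF PF.sets_lim refl] by (rule measurable_restrict_subset) simp
  qed (use F in simp)
  ultimately show ?thesis by (simp add: distr_lim)
qed

lemma prob_space_walk: "prob_space (walk \<Gamma> x)"
proof -
  interpret Ionescu_Tulcea "walk_kernel \<Gamma> x" "\<lambda>_. count_space UNIV"
    by (rule Ionescu_Tulcea_walk)
  have "(\<integral>\<^sup>+w. 1 \<partial>walk \<Gamma> x) = (\<integral>\<^sup>+w. 1 \<partial>C 0 0 (\<lambda>_. undefined))"
    using nn_integral_walk_prefix[of "\<lambda>_. 1" 0 \<Gamma> x] by simp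
  also have "\<dots> = 1"
    using prob_space.emeasure_space_1[OF prob_space_C[of "\<lambda>_. undefined" 0 0]] by simp
  finally show ?thesis by (intro prob_spaceI) simp
qed

lemma nn_integral_walk_start: "(\<integral>\<^sup>+w. h (w 0) \<partial>walk \<Gamma> x) = h x"
proof -
  interpret Ionescu_Tulcea "walk_kernel \<Gamma> x" "\<lambda>_. count_space UNIV"
    by (rule Ionescu_Tulcea_walk)
  have m: "(\<lambda>w. h (w 0)) \<in> borel_measurable (PiM {0..<Suc 0} (\<lambda>_. count_space UNIV))"
    by (rule measurable_compose[OF measurable_component_singleton]) auto
  have u: "(\<lambda>_. undefined) \<in> space (PiM {0..<0} (\<lambda>_. count_space UNIV))"
    by (auto simp: space_PiM)
  have "(\<integral>\<^sup>+w. h (w 0) \<partial>walk \<Gamma> x) = (\<integral>\<^sup>+w. h (w 0) \<partial>C 0 (Suc 0) (\<lambda>_. undefined))"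
    using nn_integral_walk_prefix[OF m] by (simp del: C.simps)
  also have "\<dots> = (\<integral>\<^sup>+w. h (w 0) \<partial>eP 0 (\<lambda>_. undefined))"
    using bind_return[OF measurable_eP[of 0] u] by simp
  also have "\<dots> = h x"
    using m u by (subst nn_integral_eP) (auto simp: walk_kernel_def nn_integral_return)
  finally show ?thesis .
qed

text \<open>The Markov property in the form of one step of the Ionescu-Tulcea construction.  All functions of
  finitely many positions are measurable here, even if the vertex type is uncountable,
  as long as they are built from single coordinates.\<close>

lemma nn_integral_walk_Suc:
  fixes G :: "(nat \<Rightarrow> 'v) \<Rightarrow> ennreal"
  assumes G: "G \<in> borel_measurable (PiM {0..<Suc n} (\<lambda>_. count_space UNIV))"
  shows "(\<integral>\<^sup>+w. G (restrict w {0..<Suc n}) * h (w (Suc n)) \<partial>walk \<Gamma> x) =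
    (\<integral>\<^sup>+w. G (restrict w {0..<Suc n}) * (\<integral>\<^sup>+y. h y \<partial>nbr_step \<Gamma> (w n)) \<partial>walk \<Gamma> x)"
proof -
  interpret Ionescu_Tulcea "walk_kernel \<Gamma> x" "\<lambda>_. count_space UNIV"
    by (rule Ionescu_Tulcea_walk)
  let ?M = "\<lambda>n. PiM {0..<n} (\<lambda>_. count_space UNIV :: 'v measure)"
  let ?u = "\<lambda>_. undefined :: 'v"
  let ?F = "\<lambda>w. G (restrict w {0..<Suc n}) * h (w (Suc n))"
  let ?H = "\<lambda>w. G w * (\<integral>\<^sup>+y. h y \<partial>nbr_step \<Gamma> (w n))"
  have u: "?u \<in> space (?M 0)" by (auto simp: space_PiM)
  have comp: "(\<lambda>w. g (w i)) \<in> borel_measurable (?M m)" if "i < m" for g :: "'v \<Rightarrow> ennreal" and i m :: nat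
    by (rule measurable_compose[OF measurable_component_singleton]) (use that in simp_all)
  have F: "?F \<in> borel_measurable (?M (Suc (Suc n)))"
    by (intro borel_measurable_times_ennreal comp measurable_compose[OF measurable_restrict_subset G]) auto
  have H: "?H \<in> borel_measurable (?M (Suc n))"
    by (intro borel_measurable_times_ennreal comp[of n "Suc n" "\<lambda>z. \<integral>\<^sup>+y. h y \<partial>nbr_step \<Gamma> z"] G) auto
  have sp: "space (C 0 (Suc n) ?u) = space (?M (Suc n))" using space_C[OF u, of "Suc n"] by simp
  have "(\<integral>\<^sup>+w. ?F w \<partial>walk \<Gamma> x) = (\<integral>\<^sup>+w. ?F (restrict w {0..<Suc (Suc n)}) \<partial>walk \<Gamma> x)"
    by (intro nn_integral_cong) (auto simp: restrict_def intro!: arg_cong2[where f="(*)"] arg_cong[where f=G])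
  also have "\<dots> = (\<integral>\<^sup>+w. ?F w \<partial>C 0 (Suc (Suc n)) ?u)"
    by (rule nn_integral_walk_prefix[OF F])
  also have "\<dots> = (\<integral>\<^sup>+w. (\<integral>\<^sup>+w'. ?F w' \<partial>eP (Suc n) w) \<partial>C 0 (Suc n) ?u)"
    using measurable_eP[of "Suc n"] F
    by (subst C.simps, subst nn_integral_bind[where B="?M (Suc (Suc n))"])
      (auto simp: measurable_cong_sets[OF sets_C[OF u, of "Suc n"] refl] simp del: C.simps)
  also have "\<dots> = (\<integral>\<^sup>+w. ?H w \<partial>C 0 (Suc n) ?u)"
  proof (intro nn_integral_cong)
    fix w assume "w \<in> space (C 0 (Suc n) ?u)"
    then have w: "w \<in> space (?M (Suc n))" by (simp only: sp)
    have r: "restrict (w(Suc n := y)) {0..<Suc n} = w" for y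
      using w by (auto simp: space_PiM PiE_iff extensional_def fun_eq_iff restrict_def)
    have "(\<integral>\<^sup>+w'. ?F w' \<partial>eP (Suc n) w) = (\<integral>\<^sup>+y. G w * h y \<partial>walk_kernel \<Gamma> x (Suc n) w)"
      by (subst nn_integral_eP[OF w F]) (simp only: r fun_upd_same)
    also have "\<dots> = ?H w"
      by (simp add: walk_kernel_def nn_integral_cmult)
    finally show "(\<integral>\<^sup>+w'. ?F w' \<partial>eP (Suc n) w) = ?H w" .
  qed
  also have "\<dots> = (\<integral>\<^sup>+w. ?H (restrict w {0..<Suc n}) \<partial>walk \<Gamma> x)"
    by (rule nn_integral_walk_prefix[OF H, symmetric])
  also have "\<dots> = (\<integral>\<^sup>+w. G (restrict w {0..<Suc n}) * (\<integral>\<^sup>+y. h y \<partial>nbr_step \<Gamma> (w n)) \<partial>walk \<Gamma> x)"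
    by (intro nn_integral_cong) simp
  finally show ?thesis .
qed

lemma measurable_walk_coordinate [measurable]:
  "(\<lambda>w. w i) \<in> measurable (walk \<Gamma> x) (count_space UNIV)"
  by (simp add: measurable_cong_sets[OF sets_walk refl])

lemma sets_walk_stay [measurable]: "{w. \<forall>i\<le>n. w i \<in> B} \<in> sets (walk \<Gamma> x)"
proof -
  have "(\<Inter>i\<in>{..n}. (\<lambda>w. w i) -` B \<inter> space (walk \<Gamma> x)) \<in> sets (walk \<Gamma> x)"
    by (intro sets.finite_INT measurable_sets[OF measurable_walk_coordinate]) auto
  also have "(\<Inter>i\<in>{..n}. (\<lambda>w. w i) -` B \<inter> space (walk \<Gamma> x)) = {w. \<forall>i\<le>n. w i \<in> B}"
    by auto
  finally show ?thesis .
qed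

lemma sets_walk_at [measurable]: "{w. w n \<in> A} \<in> sets (walk \<Gamma> x)"
  using measurable_sets[OF measurable_walk_coordinate, of A n \<Gamma> x] by (simp add: vimage_def)

context killed_walk begin

lemma nn_integral_nbr_step_killed:
  assumes x: "x \<in> B" and h: "\<And>y. 0 \<le> h y"
  shows "(\<integral>\<^sup>+y. indicator B y * ennreal (h y) \<partial>nbr_step \<Gamma> x) = ennreal (killed_step B h x)"
proof -
  have ne: "nbrs x \<noteq> {}" using nbrs_nonempty x B_verts by auto
  have "(\<integral>\<^sup>+y. indicator B y * ennreal (h y) \<partial>nbr_step \<Gamma> x) =
     (\<Sum>y\<in>nbrs x. indicator B y * ennreal (h y)) / ennreal (degr x)"
    unfolding nbr_step_def by (subst nn_integral_pmf_of_set) (use ne in \<open>auto simp: card_nbrs ennreal_of_nat_eq_real_of_nat\<close>)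
  also have "(\<Sum>y\<in>nbrs x. indicator B y * ennreal (h y)) = (\<Sum>y\<in>nbrs x. ennreal (indicator B y * h y))"
    by (intro sum.cong refl) (auto simp: indicator_def)
  also have "\<dots> = ennreal (\<Sum>y\<in>nbrs x. indicator B y * h y)"
    by (intro sum_ennreal) (auto simp: h)
  also have "(\<Sum>y\<in>nbrs x. indicator B y * h y) = (\<Sum>y\<in>nbrs x \<inter> B. h y)"
    by (simp add: sum.inter_restrict indicator_def if_distrib cong: if_cong)
  also have "\<dots> = (\<Sum>y\<in>B. weight x y * h y)"
    using finite_B by (intro sum.mono_neutral_cong_left) (auto simp: weight_def)
  also have "ennreal (\<Sum>y\<in>B. weight x y * h y) / ennreal (degr x) = ennreal (killed_step B h x)"
    using x deg_B[OF x] by (simp add: killed_step_def divide_ennreal sum_nonneg h)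
  finally show ?thesis .
qed

text \<open>Identifies the analytic semigroup with the probabilistic one by peeling off the last step.\<close>

lemma nn_integral_killed:
  assumes x: "x \<in> B" and "\<And>y. 0 \<le> h y"
  shows "(\<integral>\<^sup>+w. indicator {w. \<forall>i\<le>n. w i \<in> B} w * ennreal (h (w n)) \<partial>walk \<Gamma> x) =
    ennreal ((killed_step B ^^ n) h x)"
  using assms(2)
proof (induction n arbitrary: h)
  case 0
  have "(\<integral>\<^sup>+w. indicator {w. \<forall>i\<le>0. w i \<in> B} w * ennreal (h (w 0)) \<partial>walk \<Gamma> x) =
     (\<integral>\<^sup>+w. (\<lambda>y. indicator B y * ennreal (h y)) (w 0) \<partial>walk \<Gamma> x)"
    by (intro nn_integral_cong) (auto simp: indicator_def)
  also have "\<dots> = indicator B x * ennreal (h x)" by (rule nn_integral_walk_start)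
  finally show ?case using x by simp
next
  case (Suc n)
  let ?G = "\<lambda>w. \<Prod>i\<in>{0..<Suc n}. indicator B (w i) :: ennreal"
  have G: "?G \<in> borel_measurable (PiM {0..<Suc n} (\<lambda>_. count_space UNIV))"
    by (intro borel_measurable_prod_ennreal measurable_compose[OF measurable_component_singleton]) auto
  have Gr: "?G (restrict w {0..<Suc n}) = indicator {w. \<forall>i\<le>n. w i \<in> B} w" for w
  proof (cases "\<forall>i\<le>n. w i \<in> B")
    case False
    then obtain i where "i \<le> n" "w i \<notin> B" by auto
    then have "?G (restrict w {0..<Suc n}) = 0"
      by (intro prod_zero) (auto intro!: bexI[of _ i])
    with False show ?thesis by simp
  qed simp
  have "(\<integral>\<^sup>+w. indicator {w. \<forall>i\<le>Suc n. w i \<in> B} w * ennreal (h (w (Suc n))) \<partial>walk \<Gamma> x) =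
      (\<integral>\<^sup>+w. ?G (restrict w {0..<Suc n}) * (indicator B (w (Suc n)) * ennreal (h (w (Suc n)))) \<partial>walk \<Gamma> x)"
    unfolding Gr by (intro nn_integral_cong) (auto simp: indicator_def le_Suc_eq)
  also have "\<dots> = (\<integral>\<^sup>+w. ?G (restrict w {0..<Suc n}) * (\<integral>\<^sup>+y. indicator B y * ennreal (h y) \<partial>nbr_step \<Gamma> (w n)) \<partial>walk \<Gamma> x)"
    by (rule nn_integral_walk_Suc[OF G])
  also have "\<dots> = (\<integral>\<^sup>+w. indicator {w. \<forall>i\<le>n. w i \<in> B} w * ennreal (killed_step B h (w n)) \<partial>walk \<Gamma> x)"
    unfolding Gr by (intro nn_integral_cong)
      (auto simp: indicator_def nn_integral_nbr_step_killed[unfolded indicator_def, simplified] Suc.prems)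
  also have "\<dots> = ennreal ((killed_step B ^^ n) (killed_step B h) x)"
    by (rule Suc.IH) (rule killed_step_nonneg[OF Suc.prems])
  finally show ?case by (simp add: funpow_Suc_right del: funpow.simps)
qed

lemma emeasure_survive_in:
  assumes x: "x \<in> B"
  shows "emeasure (walk \<Gamma> x) {w. (\<forall>i\<le>n. w i \<in> B) \<and> w n \<in> A} =
    ennreal (\<Sum>y\<in>B \<inter> A. degr y * killed_kernel B x n y)"
proof -
  have "{w. \<forall>i\<le>n. w i \<in> B} \<inter> {w. w n \<in> A} \<in> sets (walk \<Gamma> x)"
    by (intro sets.Int sets_walk_stay sets_walk_at)
  moreover have "{w. \<forall>i\<le>n. w i \<in> B} \<inter> {w. w n \<in> A} = {w. (\<forall>i\<le>n. w i \<in> B) \<and> w n \<in> A}"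
    by auto
  ultimately have meas: "{w. (\<forall>i\<le>n. w i \<in> B) \<and> w n \<in> A} \<in> sets (walk \<Gamma> x)"
    by (simp only:)
  have "emeasure (walk \<Gamma> x) {w. (\<forall>i\<le>n. w i \<in> B) \<and> w n \<in> A} =
      (\<integral>\<^sup>+w. indicator {w. (\<forall>i\<le>n. w i \<in> B) \<and> w n \<in> A} w \<partial>walk \<Gamma> x)"
    by (rule nn_integral_indicator[OF meas, symmetric])
  also have "\<dots> = (\<integral>\<^sup>+w. indicator {w. \<forall>i\<le>n. w i \<in> B} w * ennreal (indicator A (w n)) \<partial>walk \<Gamma> x)"
    by (intro nn_integral_cong) (auto simp: indicator_def)
  also have "\<dots> = ennreal ((killed_step B ^^ n) (indicator A) x)"
    by (rule nn_integral_killed[OF x]) simp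
  also have "(killed_step B ^^ n) (indicator A) x = (\<Sum>y\<in>B. if y \<in> A then degr y * killed_kernel B x n y else 0)"
    unfolding killed_step_power_eq[OF x] deg_inner_def by (intro sum.cong) auto
  also have "\<dots> = (\<Sum>y\<in>B \<inter> A. degr y * killed_kernel B x n y)"
    by (rule sum.inter_restrict[OF finite_B, symmetric])
  finally show ?thesis .
qed

lemma emeasure_survive:
  "x \<in> B \<Longrightarrow> emeasure (walk \<Gamma> x) {w. \<forall>i\<le>n. w i \<in> B} = ennreal (survival B n x)"
  using emeasure_survive_in[of x n UNIV] by (simp add: survival_sum)

end

section \<open>Exit times, heat kernel and displacement on a fixed graph\<close>

lemma ennreal_top_if_ge_nat:
  assumes "\<And>n. of_nat n \<le> x" shows "x = (top :: ennreal)"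
proof -
  have "(SUP n. of_nat n) \<le> x" by (rule SUP_least) (rule assms)
  then show ?thesis by (simp add: ennreal_SUP_of_nat_eq_top top_unique)
qed

context random_walk_graph begin

lemma killed_walkI: "finite B \<Longrightarrow> B \<subseteq> verts \<Gamma> \<Longrightarrow> killed_walk \<Gamma> B"
  by unfold_locales

lemma gball_verts: "gball \<Gamma> R \<subseteq> verts \<Gamma>"
  by (auto simp: gball_def)

lemma origin_gball: "0 < R \<Longrightarrow> origin \<Gamma> \<in> gball \<Gamma> R"
  using Metric_space.mdist_zero[OF metric] by (simp add: gball_def)

lemma vol_eq_sum:
  assumes "finite (gball \<Gamma> R)"
  shows "vol \<Gamma> R = ennreal (\<Sum>y\<in>gball \<Gamma> R. degr y)"
  unfolding vol_def deg_measure_def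
  by (subst emeasure_point_measure_finite2)
    (auto simp: assms gball_verts ennreal_of_nat_eq_real_of_nat)

text \<open>Every vertex has degree at least one, so volume dominates cardinality.  For an arbitrary
  metric, balls can be infinite, and finiteness of the volume is what excludes it.\<close>

lemma finite_gball:
  assumes "vol \<Gamma> R < \<infinity>" shows "finite (gball \<Gamma> R)"
proof (rule ccontr)
  assume inf: "infinite (gball \<Gamma> R)"
  have "of_nat n \<le> vol \<Gamma> R" for n
  proof -
    obtain T where T: "T \<subseteq> gball \<Gamma> R" "finite T" "card T = n"
      using inf infinite_arbitrarily_large by blast
    have Tv: "T \<subseteq> verts \<Gamma>" using T gball_verts by blast
    have one: "1 \<le> deg \<Gamma> y" if "y \<in> T" for y
      using deg_pos[of y] that Tv by auto
    have "of_nat n = (\<Sum>y\<in>T. 1 :: ennreal)" using T by simp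
    also have "\<dots> \<le> (\<Sum>y\<in>T. of_nat (deg \<Gamma> y))"
      using of_nat_mono[OF one, where 'a=ennreal] by (intro sum_mono) simp
    also have "\<dots> = emeasure (deg_measure \<Gamma>) T"
      unfolding deg_measure_def by (rule emeasure_point_measure_finite2[symmetric]) (use T Tv in auto)
    also have "\<dots> \<le> vol \<Gamma> R"
      unfolding vol_def by (rule emeasure_mono) (use T gball_verts in \<open>auto simp: deg_measure_def sets_point_measure\<close>)
    finally show ?thesis .
  qed
  then have "vol \<Gamma> R = top"
    by (rule ennreal_top_if_ge_nat)
  with assms show False by simp
qed

lemma exit_time_suminf:
  "ennreal_of_enat (exit_time \<Gamma> R w) = (\<Sum>n. indicator {w. \<forall>i\<le>n. w i \<in> gball \<Gamma> R} w)"
proof (cases "\<exists>n. w n \<notin> gball \<Gamma> R")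
  case True
  define m where "m = (LEAST n. w n \<notin> gball \<Gamma> R)"
  have m: "w m \<notin> gball \<Gamma> R" using True unfolding m_def by (rule LeastI_ex)
  have least: "m \<le> n" if "w n \<notin> gball \<Gamma> R" for n using that unfolding m_def by (rule Least_le)
  have "exit_time \<Gamma> R w = enat m"
    unfolding exit_time_def
    by (rule antisym) (auto intro!: Inf_lower Inf_greatest m least)
  moreover have "indicator {w. \<forall>i\<le>n. w i \<in> gball \<Gamma> R} w = (if n < m then 1 else 0 :: ennreal)" for n
    using m least by (auto simp: indicator_def not_less) (meson leD le_less_trans)
  moreover have "(\<Sum>n. if n < m then 1 else 0 :: ennreal) = of_nat m"
    by (subst suminf_finite[of "{..<m}"]) auto
  ultimately show ?thesis by simp
next
  case False
  then have "exit_time \<Gamma> R w = \<infinity>" by (simp add: exit_time_def Inf_enat_def)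
  moreover have "(\<Sum>n. 1 :: ennreal) = top"
  proof (rule ennreal_top_if_ge_nat)
    show "of_nat n \<le> (\<Sum>n. 1 :: ennreal)" for n
      using sum_le_suminf[of "\<lambda>_. 1 :: ennreal" "{..<n}"] by simp
  qed
  ultimately show ?thesis using False by simp
qed

lemma mean_exit_time_eq:
  "mean_exit_time \<Gamma> R = (\<Sum>n. emeasure (walk \<Gamma> (origin \<Gamma>)) {w. \<forall>i\<le>n. w i \<in> gball \<Gamma> R})"
  unfolding mean_exit_time_def exit_time_suminf
  by (subst nn_integral_suminf[OF borel_measurable_indicator[OF sets_walk_stay]])
    (simp only: nn_integral_indicator[OF sets_walk_stay])

context
  fixes R assumes R: "0 < R" and fin: "finite (gball \<Gamma> R)"
begin

interpretation B: killed_walk \<Gamma> "gball \<Gamma> R"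
  by (rule killed_walkI[OF fin gball_verts])

lemma mean_exit_time_survival:
  "mean_exit_time \<Gamma> R = (\<Sum>n. ennreal (survival (gball \<Gamma> R) n (origin \<Gamma>)))"
  by (simp add: mean_exit_time_eq B.emeasure_survive[OF origin_gball[OF R]])

lemma mean_exit_time_le:
  assumes "\<And>N. (\<Sum>k<N. survival (gball \<Gamma> R) k (origin \<Gamma>)) \<le> T"
  shows "mean_exit_time \<Gamma> R \<le> ennreal T"
  unfolding mean_exit_time_survival suminf_eq_SUP
  by (rule SUP_least) (simp add: sum_ennreal B.survival_nonneg assms ennreal_leI)

lemma mean_exit_time_ge:
  "ennreal (\<Sum>k<N. survival (gball \<Gamma> R) k (origin \<Gamma>)) \<le> mean_exit_time \<Gamma> R"
proof -
  have "ennreal (\<Sum>k<N. survival (gball \<Gamma> R) k (origin \<Gamma>)) = (\<Sum>k<N. ennreal (survival (gball \<Gamma> R) k (origin \<Gamma>)))"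
    by (rule sum_ennreal[symmetric]) (rule B.survival_nonneg)
  also have "\<dots> \<le> (\<Sum>n. ennreal (survival (gball \<Gamma> R) n (origin \<Gamma>)))"
    by (rule sum_le_suminf[OF summableI]) (simp_all only: finite_lessThan zero_le)
  finally show ?thesis by (simp only: mean_exit_time_survival)
qed

text \<open>The lower bound on the exit time.  For a long truncation time the Green function \<open>g\<close> at the marked
  vertex \<open>o\<close> exceeds \<open>\<rho> / 2\<close>, and at vertices of small resistance to \<open>o\<close> it differs from \<open>g o\<close> by at most
  \<open>g o / 2\<close>, because \<open>(g o - g y)\<^sup>2 \<le> R\<^sub>e\<^sub>f\<^sub>f(o, y) * g o\<close>.\<close>

lemma sum_survival_ge:
  assumes rho: "0 < \<rho>" "ennreal \<rho> \<le> Reff_ball \<Gamma> R" and A: "A \<subseteq> gball \<Gamma> R"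
    and near: "\<And>y. y \<in> A \<Longrightarrow> Reff_pt \<Gamma> (origin \<Gamma>) y \<le> ennreal (\<rho> / 8)"
  shows "\<exists>N. \<rho> / 4 * (\<Sum>y\<in>A. degr y) \<le> (\<Sum>k<N. survival (gball \<Gamma> R) k (origin \<Gamma>))"
proof -
  let ?B = "gball \<Gamma> R" and ?o = "origin \<Gamma>"
  note o = origin_gball[OF R]
  have "\<exists>N. \<rho> / 2 < green ?B ?o N ?o"
  proof (rule ccontr)
    assume "\<not> ?thesis"
    then have "green ?B ?o N ?o \<le> \<rho> / 2" for N by (simp add: not_less)
    then have "Reff_ball \<Gamma> R \<le> ennreal (\<rho> / 2)"
      unfolding Reff_ball_def using rho by (intro B.Reff_le_green[OF o]) auto
    with rho have "ennreal \<rho> \<le> ennreal (\<rho> / 2)" by (meson order_trans)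
    with rho show False by (simp add: ennreal_le_iff)
  qed
  then obtain N where N: "\<rho> / 2 < green ?B ?o N ?o" ..
  let ?g = "green ?B ?o N"
  have "\<rho> / 4 \<le> ?g y" if "y \<in> A" for y
  proof -
    have "(?g ?o - ?g y)\<^sup>2 \<le> \<rho> / 8 * ?g ?o"
      using rho by (intro B.green_diff[OF o near[OF that]]) auto
    also have "\<dots> \<le> (?g ?o / 4) * ?g ?o"
      using N rho by (intro mult_right_mono) auto
    also have "\<dots> = (?g ?o / 2)\<^sup>2" by (simp add: power2_eq_square)
    finally have "?g ?o - ?g y \<le> ?g ?o / 2"
      by (rule power2_le_imp_le) (use N rho in auto)
    with N show ?thesis by simp
  qed
  then have "(\<Sum>y\<in>A. degr y * (\<rho> / 4)) \<le> (\<Sum>y\<in>A. degr y * ?g y)"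
    by (intro sum_mono mult_left_mono) auto
  also have "\<dots> \<le> (\<Sum>y\<in>?B. degr y * ?g y)"
    using A fin by (intro sum_mono2) (auto simp: B.green_nonneg)
  also have "\<dots> = (\<Sum>k<N. survival ?B k ?o)" by (rule B.sum_survival_green[OF o, symmetric])
  finally show ?thesis by (intro exI[of _ N]) (simp add: sum_distrib_left mult_ac)
qed

text \<open>The upper bound on exit times from every starting point \<open>z\<close>.  The resistance from \<open>z\<close>
  to the complement is controlled by passing through the marked vertex to \<open>y\<^sub>0\<close>; as \<open>g y\<^sub>0 = 0\<close>, two
  increments of \<open>g\<close>, each at most \<open>sqrt (S * g z)\<close>, give \<open>(g z)\<^sup>2 \<le> 4 * S * g z\<close>.\<close>

lemma sum_survival_le:
  assumes S: "0 \<le> S" and near: "\<And>y. y \<in> gball \<Gamma> R \<Longrightarrow> Reff_pt \<Gamma> (origin \<Gamma>) y \<le> ennreal S"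
    and out: "y\<^sub>0 \<in> verts \<Gamma> - gball \<Gamma> R" "Reff_pt \<Gamma> (origin \<Gamma>) y\<^sub>0 \<le> ennreal S"
    and z: "z \<in> gball \<Gamma> R"
  shows "(\<Sum>k<N. survival (gball \<Gamma> R) k z) \<le> 4 * S * (\<Sum>y\<in>gball \<Gamma> R. degr y)"
proof -
  let ?g = "green (gball \<Gamma> R) z N" and ?o = "origin \<Gamma>"
  have y0: "?g y\<^sub>0 = 0" using B.green_outside[OF z] out by auto
  have "(?g z)\<^sup>2 \<le> 2 * (?g ?o - ?g z)\<^sup>2 + 2 * (?g ?o - ?g y\<^sub>0)\<^sup>2"
    using sum_squares_bound[of "?g z - ?g ?o" "?g ?o"] y0 by (simp add: power2_eq_square algebra_simps)
  also have "\<dots> \<le> 2 * (S * ?g z) + 2 * (S * ?g z)"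
    using B.green_diff[OF z near[OF z] S, of N] B.green_diff[OF z out(2) S, of N] by simp
  finally have "?g z * ?g z \<le> 4 * S * ?g z" by (simp add: power2_eq_square)
  then have gz: "?g z \<le> 4 * S"
    using B.green_nonneg[of z N z] S by (cases "?g z = 0") auto
  have "(\<Sum>k<N. survival (gball \<Gamma> R) k z) = (\<Sum>y\<in>gball \<Gamma> R. degr y * ?g y)"
    by (rule B.sum_survival_green[OF z])
  also have "\<dots> \<le> (\<Sum>y\<in>gball \<Gamma> R. degr y * (4 * S))"
    by (intro sum_mono mult_left_mono order_trans[OF B.green_max[OF z] gz]) auto
  finally show ?thesis by (simp add: sum_distrib_left mult_ac)
qed

lemma killed_kernel_le_heat_kernel:
  "killed_kernel (gball \<Gamma> R) (origin \<Gamma>) n (origin \<Gamma>) \<le> heat_kernel \<Gamma> n (origin \<Gamma>) (origin \<Gamma>)"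
proof -
  let ?B = "gball \<Gamma> R" and ?o = "origin \<Gamma>"
  note o = origin_gball[OF R]
  interpret W: prob_space "walk \<Gamma> ?o" by (rule prob_space_walk)
  have "ennreal (degr ?o * killed_kernel ?B ?o n ?o) =
      emeasure (walk \<Gamma> ?o) {w. (\<forall>i\<le>n. w i \<in> ?B) \<and> w n \<in> {?o}}"
    using o by (subst B.emeasure_survive_in[OF o]) (simp add: Int_insert_right)
  also have "\<dots> \<le> emeasure (walk \<Gamma> ?o) {w. w n \<in> {?o}}"
    by (intro emeasure_mono sets_walk_at) auto
  also have "\<dots> = ennreal (degr ?o * heat_kernel \<Gamma> n ?o ?o)"
    using deg_pos[of ?o] by (simp add: heat_kernel_def W.emeasure_eq_measure)
  finally have "degr ?o * killed_kernel ?B ?o n ?o \<le> degr ?o * heat_kernel \<Gamma> n ?o ?o"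
    by (subst (asm) ennreal_le_iff) (auto simp: heat_kernel_def)
  then show ?thesis using deg_pos[of ?o] by simp
qed

text \<open>The Cauchy--Schwarz inequality over the ball and the Chapman--Kolmogorov equation.\<close>

lemma survival_sq_le:
  "(survival (gball \<Gamma> R) n (origin \<Gamma>))\<^sup>2 \<le>
    (\<Sum>y\<in>gball \<Gamma> R. degr y) * heat_kernel \<Gamma> (2 * n) (origin \<Gamma>) (origin \<Gamma>)"
  unfolding B.survival_sum[OF origin_gball[OF R]]
  by (rule order_trans[OF B.Cauchy_Schwarz_killed_kernel[OF origin_gball[OF R] subset_refl]])
    (intro mult_left_mono killed_kernel_le_heat_kernel sum_nonneg, simp)

end

text \<open>The indicator of the marked vertex has finite energy.\<close>

lemma Reff_ball_pos: "0 < R \<Longrightarrow> 0 < Reff_ball \<Gamma> R"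
proof (rule ccontr)
  assume R: "0 < R" and "\<not> 0 < Reff_ball \<Gamma> R"
  then have R0: "Reff \<Gamma> {origin \<Gamma>} (verts \<Gamma> - gball \<Gamma> R) \<le> ennreal 0"
    by (simp add: Reff_ball_def zero_less_iff_neq_zero)
  interpret K: killed_walk \<Gamma> "{origin \<Gamma>}" by (rule killed_walkI) auto
  let ?f = "indicator {origin \<Gamma>} :: 'v \<Rightarrow> real"
  have "(1 - 0)\<^sup>2 \<le> 0 * dirichlet {origin \<Gamma>} ?f ?f"
    by (rule Reff_bound[OF R0 order_refl K.energy_dirichlet K.dirichlet_nonneg])
      (use origin_gball[OF R] in \<open>auto simp: indicator_def\<close>)
  then show False by simp
qed

lemma vol_pos: "0 < R \<Longrightarrow> 0 < vol \<Gamma> R"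
proof -
  assume R: "0 < R"
  show ?thesis
  proof (cases "vol \<Gamma> R < \<infinity>")
    case True
    note fin = finite_gball[OF True]
    have "0 < (\<Sum>y\<in>gball \<Gamma> R. degr y)"
      using origin_gball[OF R] gball_verts deg_pos by (intro sum_pos fin) auto
    then show ?thesis by (simp add: vol_eq_sum[OF fin])
  next
    case False
    then show ?thesis by (simp add: zero_less_iff_neq_zero) (metis ennreal_zero_less_top)
  qed
qed

text \<open>The Green function at the marked vertex is largest on the diagonal, where it is at most the
  resistance to the complement; integration over the ball produces the volume.  If the volume or
  the resistance is infinite, so is the product, both factors being positive.\<close>

lemma mean_exit_time_upper:
  assumes R: "0 < R" shows "mean_exit_time \<Gamma> R \<le> Reff_ball \<Gamma> R * vol \<Gamma> R"
proof (cases "vol \<Gamma> R < \<infinity> \<and> Reff_ball \<Gamma> R < \<infinity>")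
  case True
  then have fin: "finite (gball \<Gamma> R)" using finite_gball by auto
  interpret B: killed_walk \<Gamma> "gball \<Gamma> R" by (rule killed_walkI[OF fin gball_verts])
  note o = origin_gball[OF R]
  obtain S where S: "Reff_ball \<Gamma> R = ennreal S" "0 \<le> S" using True by (cases "Reff_ball \<Gamma> R") auto
  have "mean_exit_time \<Gamma> R \<le> ennreal (S * (\<Sum>y\<in>gball \<Gamma> R. degr y))"
  proof (rule mean_exit_time_le[OF R fin])
    fix N
    have le: "green (gball \<Gamma> R) (origin \<Gamma>) N y \<le> S" for y
      by (rule order_trans[OF B.green_max[OF o] B.green_le_Reff[OF o]]) (use S in \<open>auto simp: Reff_ball_def\<close>)
    have "(\<Sum>k<N. survival (gball \<Gamma> R) k (origin \<Gamma>)) \<le> (\<Sum>y\<in>gball \<Gamma> R. degr y * S)"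
      unfolding B.sum_survival_green[OF o] by (intro sum_mono mult_left_mono le) auto
    then show "(\<Sum>k<N. survival (gball \<Gamma> R) k (origin \<Gamma>)) \<le> S * (\<Sum>y\<in>gball \<Gamma> R. degr y)"
      by (simp add: sum_distrib_left mult_ac)
  qed
  then show ?thesis using S by (simp add: vol_eq_sum[OF fin] ennreal_mult sum_nonneg)
next
  case False
  then have "Reff_ball \<Gamma> R * vol \<Gamma> R = top"
    using Reff_ball_pos[OF R] vol_pos[OF R] by (auto simp: ennreal_mult_eq_top_iff less_top[symmetric])
  then show ?thesis by simp
qed

lemma mean_exit_time_ge_1: "0 < R \<Longrightarrow> 1 \<le> mean_exit_time \<Gamma> R"
proof -
  assume R: "0 < R"
  have "1 = (indicator (gball \<Gamma> R) (origin \<Gamma>) :: ennreal)"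
    using origin_gball[OF R] by simp
  also have "\<dots> = (\<integral>\<^sup>+w. indicator (gball \<Gamma> R) (w 0) \<partial>walk \<Gamma> (origin \<Gamma>))"
    by (rule nn_integral_walk_start[symmetric])
  also have "\<dots> = (\<integral>\<^sup>+w. indicator {w. \<forall>i\<le>0. w i \<in> gball \<Gamma> R} w \<partial>walk \<Gamma> (origin \<Gamma>))"
    by (intro nn_integral_cong) (auto simp: indicator_def)
  also have "\<dots> = emeasure (walk \<Gamma> (origin \<Gamma>)) {w. \<forall>i\<le>0. w i \<in> gball \<Gamma> R}"
    by (rule nn_integral_indicator[OF sets_walk_stay])
  also have "\<dots> \<le> mean_exit_time \<Gamma> R"
    unfolding mean_exit_time_eq
    using sum_le_suminf[of "\<lambda>n. emeasure (walk \<Gamma> (origin \<Gamma>)) {w. \<forall>i\<le>n. w i \<in> gball \<Gamma> R}" "{0}"] by simp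
  finally show ?thesis .
qed

text \<open>Vertices within \<open>n\<close> steps of the marked one.  Up to time \<open>n\<close> the walk killed outside this finite set
  is the walk itself, which transfers the results on killed walks to the whole graph.\<close>

definition reach :: "nat \<Rightarrow> 'v set" where
  "reach n = ((\<lambda>A. A \<union> (\<Union>x\<in>A. nbrs x)) ^^ n) {origin \<Gamma>}"

lemma reach_Suc: "reach (Suc n) = reach n \<union> (\<Union>x\<in>reach n. nbrs x)"
  by (simp add: reach_def)

lemma finite_reach: "finite (reach n)"
  by (induction n) (simp add: reach_def, simp add: reach_Suc)

lemma reach_verts: "reach n \<subseteq> verts \<Gamma>"
  by (induction n) (simp add: reach_def, use adj_verts in \<open>auto simp: reach_Suc\<close>)

lemma reach_mono: "m \<le> n \<Longrightarrow> reach m \<subseteq> reach n"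
  by (induction rule: dec_induct) (auto simp: reach_Suc)

lemma origin_reach: "origin \<Gamma> \<in> reach n"
  using reach_mono[of 0 n] by (auto simp: reach_def)

interpretation reach: killed_walk \<Gamma> "reach n" for n
  by (rule killed_walkI[OF finite_reach reach_verts])

lemma survival_reach:
  "j + k \<le> n \<Longrightarrow> z \<in> reach j \<Longrightarrow> survival (reach n) k z = 1"
proof (induction k arbitrary: j z)
  case 0
  then show ?case using reach_mono[of j n] by (auto simp: survival_def)
next
  case (Suc k)
  have z: "z \<in> reach n" using Suc.prems reach_mono[of j n] by auto
  have nb: "nbrs z \<subseteq> reach (Suc j)" using Suc.prems by (auto simp: reach_Suc)
  have sub: "nbrs z \<subseteq> reach n" using nb reach_mono[of "Suc j" n] Suc.prems by auto
  have "(\<Sum>y\<in>reach n. weight z y * survival (reach n) k y) = (\<Sum>y\<in>reach n. weight z y)"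
  proof (intro sum.cong refl)
    fix y
    show "weight z y * survival (reach n) k y = weight z y"
    proof (cases "y \<in> nbrs z")
      case True
      then have "survival (reach n) k y = 1" using Suc.IH[of "Suc j" y] Suc.prems nb by auto
      then show ?thesis by simp
    qed (simp add: weight_def)
  qed
  also have "\<dots> = degr z" by (rule sum_weight[OF finite_reach sub])
  finally show ?case using z deg_pos[of z] reach_verts by (auto simp: survival_def killed_step_def)
qed

lemma emeasure_walk_in:
  assumes "k \<le> n"
  shows "emeasure (walk \<Gamma> (origin \<Gamma>)) {w. w k \<in> A} =
    ennreal (\<Sum>y\<in>reach n \<inter> A. degr y * killed_kernel (reach n) (origin \<Gamma>) k y)"
proof -
  let ?W = "walk \<Gamma> (origin \<Gamma>)"
  interpret W: prob_space ?W by (rule prob_space_walk)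
  have "emeasure ?W {w. \<forall>i\<le>k. w i \<in> reach n} = 1"
    using survival_reach[of 0 k n "origin \<Gamma>"] assms
    by (simp add: reach.emeasure_survive[OF origin_reach] origin_reach)
  then have "AE w in ?W. w \<in> {w. \<forall>i\<le>k. w i \<in> reach n}"
    by (intro W.AE_prob_1) (simp add: W.emeasure_eq_measure)
  then have "emeasure ?W {w. w k \<in> A} = emeasure ?W {w. (\<forall>i\<le>k. w i \<in> reach n) \<and> w k \<in> A}"
  proof (intro emeasure_eq_AE sets_walk_at)
    have "{w. \<forall>i\<le>k. w i \<in> reach n} \<inter> {w. w k \<in> A} \<in> sets ?W"
      by (intro sets.Int sets_walk_stay sets_walk_at)
    moreover have "{w. \<forall>i\<le>k. w i \<in> reach n} \<inter> {w. w k \<in> A} = {w. (\<forall>i\<le>k. w i \<in> reach n) \<and> w k \<in> A}"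
      by auto
    ultimately show "{w. (\<forall>i\<le>k. w i \<in> reach n) \<and> w k \<in> A} \<in> sets ?W" by (simp only:)
  qed auto
  then show ?thesis by (simp add: reach.emeasure_survive_in[OF origin_reach])
qed

lemma heat_kernel_eq_killed_kernel:
  assumes "k \<le> n"
  shows "heat_kernel \<Gamma> k (origin \<Gamma>) (origin \<Gamma>) = killed_kernel (reach n) (origin \<Gamma>) k (origin \<Gamma>)"
proof -
  interpret W: prob_space "walk \<Gamma> (origin \<Gamma>)" by (rule prob_space_walk)
  have "measure (walk \<Gamma> (origin \<Gamma>)) {w. w k \<in> {origin \<Gamma>}} =
      degr (origin \<Gamma>) * killed_kernel (reach n) (origin \<Gamma>) k (origin \<Gamma>)"
    using emeasure_walk_in[OF assms, of "{origin \<Gamma>}"] origin_reach[of n]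
    by (simp add: W.emeasure_eq_measure Int_insert_right reach.killed_kernel_nonneg)
  then show ?thesis using deg_pos[of "origin \<Gamma>"] by (simp add: heat_kernel_def)
qed

lemma heat_kernel_upper:
  assumes n: "1 \<le> n" and R: "0 < R" and W: "0 < W" "ennreal W \<le> vol \<Gamma> R" and S: "0 \<le> S"
    and near: "\<And>y. y \<in> gball \<Gamma> R \<Longrightarrow> Reff_pt \<Gamma> (origin \<Gamma>) y \<le> ennreal S"
  shows "heat_kernel \<Gamma> (2 * n) (origin \<Gamma>) (origin \<Gamma>) \<le> 3 / W + 4 * S / n"
  unfolding heat_kernel_eq_killed_kernel[OF order_refl]
proof (rule reach.killed_kernel_diag_upper[OF origin_reach n W(1) S origin_gball[OF R] _ near])
  assume "gball \<Gamma> R \<subseteq> reach (2 * n)"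
  then have "finite (gball \<Gamma> R)" using finite_reach finite_subset by blast
  with W show "W \<le> (\<Sum>y\<in>gball \<Gamma> R. degr y)"
    by (simp add: vol_eq_sum ennreal_le_iff sum_nonneg)
qed

text \<open>The same Cauchy--Schwarz bound as for survival, now read as an upper bound: a small return probability
  makes it unlikely to be found in a small ball.\<close>

lemma walk_in_gball_sq:
  assumes "vol \<Gamma> R \<le> ennreal V" "0 \<le> V"
  shows "(measure (walk \<Gamma> (origin \<Gamma>)) {w. w n \<in> gball \<Gamma> R})\<^sup>2 \<le>
    V * heat_kernel \<Gamma> (2 * n) (origin \<Gamma>) (origin \<Gamma>)"
proof -
  let ?W = "walk \<Gamma> (origin \<Gamma>)" and ?S = "reach (2 * n)" and ?o = "origin \<Gamma>"
  interpret W: prob_space ?W by (rule prob_space_walk)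
  have fin: "finite (gball \<Gamma> R)" using assms by (intro finite_gball) (auto simp: less_top[symmetric] top_unique)
  have "measure ?W {w. w n \<in> gball \<Gamma> R} = (\<Sum>y\<in>?S \<inter> gball \<Gamma> R. degr y * killed_kernel ?S ?o n y)"
    using emeasure_walk_in[of n "2 * n" "gball \<Gamma> R"]
    by (simp add: W.emeasure_eq_measure sum_nonneg reach.killed_kernel_nonneg)
  also have "\<dots>\<^sup>2 \<le> (\<Sum>y\<in>?S \<inter> gball \<Gamma> R. degr y) * killed_kernel ?S ?o (2 * n) ?o"
    by (rule reach.Cauchy_Schwarz_killed_kernel[OF origin_reach]) auto
  also have "\<dots> \<le> V * killed_kernel ?S ?o (2 * n) ?o"
  proof (rule mult_right_mono[OF _ reach.killed_kernel_nonneg])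
    have "(\<Sum>y\<in>?S \<inter> gball \<Gamma> R. degr y) \<le> (\<Sum>y\<in>gball \<Gamma> R. degr y)"
      using fin by (intro sum_mono2) auto
    also have "\<dots> \<le> V" using assms by (simp add: vol_eq_sum[OF fin] ennreal_le_iff)
    finally show "(\<Sum>y\<in>?S \<inter> gball \<Gamma> R. degr y) \<le> V" .
  qed
  finally show ?thesis by (simp add: heat_kernel_eq_killed_kernel[OF order_refl])
qed

lemma mean_displacement_ge:
  assumes R: "0 \<le> R" and p: "measure (walk \<Gamma> (origin \<Gamma>)) {w. w n \<in> gball \<Gamma> (ennreal R)} \<le> p"
  shows "ennreal (R * (1 - p)) \<le> mean_displacement \<Gamma> n"
proof -
  let ?W = "walk \<Gamma> (origin \<Gamma>)" and ?B = "gball \<Gamma> (ennreal R)"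
  interpret W: prob_space ?W by (rule prob_space_walk)
  have "1 = emeasure ?W {w. w n \<in> UNIV}" using W.emeasure_space_1 by simp
  also have "\<dots> = emeasure ?W {w. w n \<in> verts \<Gamma>}"
    using reach_verts[of n] by (simp only: emeasure_walk_in[OF order_refl]) (simp add: Int_absorb2)
  finally have v: "measure ?W {w. w n \<in> verts \<Gamma>} = 1" by (simp add: W.emeasure_eq_measure)
  have "{w. w n \<in> verts \<Gamma> - ?B} = {w. w n \<in> verts \<Gamma>} - {w. w n \<in> ?B}" by auto
  then have "measure ?W {w. w n \<in> verts \<Gamma> - ?B} = 1 - measure ?W {w. w n \<in> ?B}"
    using v gball_verts by (simp only:) (subst W.finite_measure_Diff, auto simp: sets_walk_at)
  with p have q: "1 - p \<le> measure ?W {w. w n \<in> verts \<Gamma> - ?B}" by simp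
  have "ennreal (R * (1 - p)) \<le> ennreal (R * measure ?W {w. w n \<in> verts \<Gamma> - ?B})"
    using q R by (intro ennreal_leI mult_left_mono)
  also have "\<dots> = ennreal R * emeasure ?W {w. w n \<in> verts \<Gamma> - ?B}"
    by (simp add: W.emeasure_eq_measure ennreal_mult R)
  also have "\<dots> = (\<integral>\<^sup>+w. ennreal R * indicator {w. w n \<in> verts \<Gamma> - ?B} w \<partial>?W)"
    by (rule nn_integral_cmult_indicator[OF sets_walk_at, symmetric])
  also have "\<dots> \<le> mean_displacement \<Gamma> n"
    unfolding mean_displacement_def
    by (intro nn_integral_mono) (auto simp: indicator_def gball_def not_less)
  finally show ?thesis .
qed

lemma exists_distance_two:
  obtains y z where "(origin \<Gamma>, y) \<in> adj \<Gamma>" "(y, z) \<in> adj \<Gamma>" "z \<noteq> origin \<Gamma>"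
proof (rule ccontr)
  assume neg: "\<not> thesis"
  then have neg_that: "\<not> ((origin \<Gamma>, y) \<in> adj \<Gamma> \<and> (y, z) \<in> adj \<Gamma> \<and> z \<noteq> origin \<Gamma>)" for y z
    using that by blast
  have two: "z = origin \<Gamma>" if "(origin \<Gamma>, y) \<in> adj \<Gamma>" "(y, z) \<in> adj \<Gamma>" for y z
    using neg_that that by blast
  \<comment> \<open>Otherwise the graph would be a finite star around the marked vertex.\<close>
  have "x \<in> insert (origin \<Gamma>) (nbrs (origin \<Gamma>))" if "x \<in> verts \<Gamma>" for x
    using connected[OF origin_verts that]
  proof (induction rule: rtrancl_induct)
    case (step y z) then show ?case using two[of y z] by auto
  qed simp
  then have "verts \<Gamma> \<subseteq> insert (origin \<Gamma>) (nbrs (origin \<Gamma>))" by (rule subsetI)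
  moreover have "finite (insert (origin \<Gamma>) (nbrs (origin \<Gamma>)))" by (simp only: finite_insert finite_nbrs)
  ultimately have "finite (verts \<Gamma>)" by (rule finite_subset)
  with infinite_verts show False by simp
qed

text \<open>Oscillation between a vertex at graph distance one and one at graph distance two ends away from
  the marked vertex, whatever the parity of \<open>n\<close>.\<close>

lemma mean_displacement_pos:
  assumes n: "1 \<le> n" shows "0 < mean_displacement \<Gamma> n"
proof -
  let ?W = "walk \<Gamma> (origin \<Gamma>)" and ?o = "origin \<Gamma>"
  obtain y z where yz: "(?o, y) \<in> adj \<Gamma>" "(y, z) \<in> adj \<Gamma>" "z \<noteq> ?o" by (rule exists_distance_two)
  define p where "p i = (if i = 0 then ?o else if odd i then y else z)" for i :: nat
  have step: "(p i, p (Suc i)) \<in> adj \<Gamma>" for i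
    using yz adj_sym[of y z] by (auto simp: p_def)
  have pn: "p n \<noteq> ?o" "p n \<in> verts \<Gamma>" using yz n adj_verts[OF yz(1)] adj_verts[OF yz(2)] by (auto simp: p_def)
  have "0 < pmf (nbr_step \<Gamma> (p i)) (p (Suc i))" for i
    unfolding nbr_step_def using step[of i] by (subst pmf_of_set) (auto simp: card_gt_0_iff)
  then have "0 < (\<Prod>i<n. pmf (nbr_step \<Gamma> (p i)) (p (Suc i)))" by (intro prod_pos) auto
  then have cyl: "0 < emeasure ?W {w. \<forall>i\<le>n. w i = p i}"
    unfolding walk_cylinder by (subst prod_ennreal) (auto simp: p_def)
  then have meas: "{w. \<forall>i\<le>n. w i = p i} \<in> sets ?W"
    using emeasure_notin_sets[of "{w. \<forall>i\<le>n. w i = p i}" ?W] by force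
  have "0 < gdist \<Gamma> ?o (p n)" using Metric_space.mdist_pos_less[OF metric] pn by auto
  with cyl have "0 < ennreal (gdist \<Gamma> ?o (p n)) * emeasure ?W {w. \<forall>i\<le>n. w i = p i}"
    by (simp add: ennreal_zero_less_mult_iff)
  also have "\<dots> = (\<integral>\<^sup>+w. ennreal (gdist \<Gamma> ?o (p n)) * indicator {w. \<forall>i\<le>n. w i = p i} w \<partial>?W)"
    by (rule nn_integral_cmult_indicator[OF meas, symmetric])
  also have "\<dots> \<le> mean_displacement \<Gamma> n"
    unfolding mean_displacement_def by (intro nn_integral_mono) (auto simp: indicator_def)
  finally show ?thesis .
qed

lemma mean_exit_time_lower:
  assumes R: "0 < R'" "R' \<le> R" "vol \<Gamma> R < \<infinity>"
    and W: "0 < W" "ennreal W \<le> vol \<Gamma> R'" and rho: "0 < \<rho>" "ennreal \<rho> \<le> Reff_ball \<Gamma> R"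
    and near: "\<And>y. y \<in> gball \<Gamma> R' \<Longrightarrow> Reff_pt \<Gamma> (origin \<Gamma>) y \<le> ennreal (\<rho> / 8)"
  shows "\<exists>N. \<rho> * W / 4 \<le> (\<Sum>k<N. survival (gball \<Gamma> R) k (origin \<Gamma>))"
    and "ennreal (\<rho> * W / 4) \<le> mean_exit_time \<Gamma> R"
proof -
  have sub: "gball \<Gamma> R' \<subseteq> gball \<Gamma> R" using R by (auto simp: gball_def)
  have R0: "0 < R" using R by auto
  have fin: "finite (gball \<Gamma> R)" using R finite_gball by auto
  then have fin': "finite (gball \<Gamma> R')" using sub finite_subset by blast
  obtain N where N: "\<rho> / 4 * (\<Sum>y\<in>gball \<Gamma> R'. degr y) \<le> (\<Sum>k<N. survival (gball \<Gamma> R) k (origin \<Gamma>))"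
    using sum_survival_ge[OF R0 fin rho sub near] by blast
  have "W \<le> (\<Sum>y\<in>gball \<Gamma> R'. degr y)"
    using W by (simp add: vol_eq_sum[OF fin'] ennreal_le_iff sum_nonneg)
  then have "\<rho> / 4 * W \<le> \<rho> / 4 * (\<Sum>y\<in>gball \<Gamma> R'. degr y)"
    using rho by (intro mult_left_mono) auto
  with N have le: "\<rho> * W / 4 \<le> (\<Sum>k<N. survival (gball \<Gamma> R) k (origin \<Gamma>))" by simp
  then show "\<exists>N. \<rho> * W / 4 \<le> (\<Sum>k<N. survival (gball \<Gamma> R) k (origin \<Gamma>))" ..
  show "ennreal (\<rho> * W / 4) \<le> mean_exit_time \<Gamma> R"
    by (rule order_trans[OF ennreal_leI[OF le] mean_exit_time_ge[OF R0 fin]])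
qed

text \<open>As \<open>\<rho> * W / 4\<close> bounds the expected exit time below and \<open>4 * S * V\<close> bounds it above from every
  starting point, the walk survives up to a time \<open>n\<close> of at most half the former with probability
  at least \<open>\<rho> * W / (32 * S * V)\<close>.  The larger ball is used to find a vertex
  outside the smaller one whose resistance to the marked vertex is bounded: for an arbitrary metric,
  none need lie near the boundary of the ball, but a strictly larger volume provides one.\<close>

lemma heat_kernel_lower:
  assumes R: "0 < R'" "R' \<le> R" "R \<le> R''"
    and V: "0 < V" "vol \<Gamma> R \<le> ennreal V" "vol \<Gamma> R < vol \<Gamma> R''"
    and W: "0 < W" "ennreal W \<le> vol \<Gamma> R'" and rho: "0 < \<rho>" "ennreal \<rho> \<le> Reff_ball \<Gamma> R"
    and near: "\<And>y. y \<in> gball \<Gamma> R' \<Longrightarrow> Reff_pt \<Gamma> (origin \<Gamma>) y \<le> ennreal (\<rho> / 8)"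
    and S: "0 < S" "\<And>y. y \<in> gball \<Gamma> R'' \<Longrightarrow> Reff_pt \<Gamma> (origin \<Gamma>) y \<le> ennreal S"
    and n: "2 * real n \<le> \<rho> * W / 4"
  shows "(\<rho> * W / (32 * S * V))\<^sup>2 / V \<le> heat_kernel \<Gamma> (2 * n) (origin \<Gamma>) (origin \<Gamma>)"
proof -
  let ?B = "gball \<Gamma> R" and ?o = "origin \<Gamma>"
  have R0: "0 < R" using R by auto
  have vfin: "vol \<Gamma> R < \<infinity>" using V(2) by (auto simp: less_top[symmetric] top_unique)
  note fin = finite_gball[OF vfin]
  interpret B: killed_walk \<Gamma> ?B by (rule killed_walkI[OF fin gball_verts])
  note o = origin_gball[OF R0]
  have sub: "?B \<subseteq> gball \<Gamma> R''" using R by (auto simp: gball_def)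
  have "gball \<Gamma> R'' \<noteq> ?B" using V(3) by (auto simp: vol_def)
  then obtain y0 where y0: "y0 \<in> gball \<Gamma> R''" "y0 \<in> verts \<Gamma> - ?B"
    using sub gball_verts by blast
  have VB: "(\<Sum>y\<in>?B. degr y) \<le> V" using V by (simp add: vol_eq_sum[OF fin] ennreal_le_iff)
  let ?T = "4 * S * V"
  have T: "(\<Sum>k<N. survival ?B k z) \<le> ?T" if "z \<in> ?B" for N z
  proof -
    have "(\<Sum>k<N. survival ?B k z) \<le> 4 * S * (\<Sum>y\<in>?B. degr y)"
      using S y0 sub by (intro sum_survival_le[OF R0 fin _ _ y0(2) _ that]) auto
    also have "\<dots> \<le> ?T" using VB S by (intro mult_left_mono) auto
    finally show ?thesis .
  qed
  obtain N where N: "\<rho> * W / 4 \<le> (\<Sum>k<N. survival ?B k ?o)"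
    using mean_exit_time_lower(1)[OF R(1,2) vfin W rho near] by blast
  also have "\<dots> \<le> (\<Sum>k<n + N. survival ?B k ?o)"
    by (intro sum_mono2) (auto simp: B.survival_nonneg)
  also have "\<dots> \<le> real n + ?T * survival ?B n ?o"
    by (rule B.sum_survival_split[OF o T])
  finally have "\<rho> * W / 8 \<le> ?T * survival ?B n ?o" using n by simp
  then have "\<rho> * W / (32 * S * V) \<le> survival ?B n ?o" using S V by (simp add: field_simps)
  then have "(\<rho> * W / (32 * S * V))\<^sup>2 \<le> (survival ?B n ?o)\<^sup>2"
    using S V W rho by (intro power_mono) auto
  also have "\<dots> \<le> (\<Sum>y\<in>?B. degr y) * heat_kernel \<Gamma> (2 * n) ?o ?o"
    by (rule survival_sq_le[OF R0 fin])
  also have "\<dots> \<le> heat_kernel \<Gamma> (2 * n) ?o ?o * V"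
    using mult_right_mono[OF VB, of "heat_kernel \<Gamma> (2 * n) ?o ?o"] by (simp add: heat_kernel_def mult.commute)
  finally show ?thesis by (subst pos_divide_le_eq[OF V(1)])
qed

end

lemma gdist_gball:
  assumes "y \<in> gball \<Gamma> (ennreal x)" "0 \<le> x"
  shows "gdist \<Gamma> (origin \<Gamma>) y \<le> x"
proof (rule ccontr)
  assume "\<not> ?thesis"
  then have "ennreal x \<le> ennreal (gdist \<Gamma> (origin \<Gamma>) y)" by (intro ennreal_leI) simp
  with assms show False by (auto simp: gball_def)
qed

section \<open>Growth functions\<close>

locale growth =
  fixes C a b :: real and f :: "ennreal \<Rightarrow> ennreal"
  assumes growth: "growth_function C a b f" and C_ge_1: "1 \<le> C"
begin

text \<open>Values at finite arguments are finite, which reduces the work to real-valued functions.\<close>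

definition real_growth :: "real \<Rightarrow> real" where
  "real_growth x = enn2real (f (ennreal x))"

lemma f_strict_mono: "strict_mono f" and f_0: "f 0 = 0" and f_1: "f 1 = 1" and f_top: "f \<infinity> = \<infinity>"
  and f_cont: "continuous_on UNIV f"
  using growth by (auto simp: growth_function_def)

lemma f_real: "f (ennreal x) = ennreal (real_growth x)"
proof -
  have "f (ennreal x) < f \<infinity>" by (rule strict_monoD[OF f_strict_mono]) simp
  then show ?thesis unfolding real_growth_def f_top by (intro ennreal_enn2real[symmetric]) simp
qed

lemma real_growth_nonneg: "0 \<le> real_growth x"
  by (simp add: real_growth_def)

lemma real_growth_pos: "0 < x \<Longrightarrow> 0 < real_growth x"
  using strict_monoD[OF f_strict_mono, of 0 "ennreal x"] by (simp add: f_0 f_real)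

lemma real_growth_mono: "x \<le> y \<Longrightarrow> real_growth x \<le> real_growth y"
proof -
  assume "x \<le> y"
  then have "f (ennreal x) \<le> f (ennreal y)"
    using strict_mono_mono[OF f_strict_mono] by (auto intro: monoD ennreal_leI)
  then show ?thesis by (simp add: f_real real_growth_nonneg)
qed

lemma real_growth_1: "real_growth 1 = 1"
  by (simp add: real_growth_def f_1)

lemma real_growth_less_1: "x < 1 \<Longrightarrow> real_growth x < 1"
  using strict_monoD[OF f_strict_mono, of "ennreal x" 1] by (simp add: f_1 f_real)

lemma real_growth_scale:
  assumes "0 < x" "1 \<le> t"
  shows "t powr a * real_growth x \<le> C * real_growth (t * x)"
    and "real_growth (t * x) \<le> C * t powr b * real_growth x"
proof -
  have pos: "0 < real_growth x" "0 < real_growth (t * x)" using assms by (auto intro: real_growth_pos)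
  have q: "t * x / x = t" "x \<le> t * x" using assms by auto
  have "ennreal (inverse C * t powr a) \<le> ennreal (real_growth (t * x)) / ennreal (real_growth x)"
    "ennreal (real_growth (t * x)) / ennreal (real_growth x) \<le> ennreal (C * t powr b)"
    using growth q assms(1) unfolding growth_function_def f_real by metis+
  then have "inverse C * t powr a \<le> real_growth (t * x) / real_growth x"
    "real_growth (t * x) / real_growth x \<le> C * t powr b"
    using pos C_ge_1 by (auto simp: divide_ennreal ennreal_le_iff)
  then show "t powr a * real_growth x \<le> C * real_growth (t * x)"
    "real_growth (t * x) \<le> C * t powr b * real_growth x"
    using pos C_ge_1 by (auto simp: field_simps)
qed

lemma continuous_on_real_growth: "continuous_on UNIV real_growth"
proof -
  have "continuous_on UNIV (\<lambda>x. f (ennreal x))"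
    by (rule continuous_on_compose2[OF f_cont]) (auto intro: continuous_on_ennreal continuous_on_id)
  then have "((\<lambda>x. f (ennreal x)) \<longlongrightarrow> ennreal (real_growth x)) (at x)" for x
    by (simp add: continuous_on_def f_real)
  then have "(real_growth \<longlongrightarrow> real_growth x) (at x)" for x
    unfolding real_growth_def[abs_def] using tendsto_enn2real real_growth_nonneg real_growth_def by metis
  then show ?thesis by (simp add: continuous_on_def)
qed

end

locale growth_pair =
  vol: growth C\<^sub>1 d\<^sub>1 d\<^sub>2 v + res: growth C\<^sub>2 \<alpha>\<^sub>1 \<alpha>\<^sub>2 r
  for C\<^sub>1 d\<^sub>1 d\<^sub>2 v C\<^sub>2 \<alpha>\<^sub>1 \<alpha>\<^sub>2 r +
  assumes d1: "1 \<le> d\<^sub>1" and alpha1: "0 < \<alpha>\<^sub>1"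
begin

abbreviation vol_growth :: "real \<Rightarrow> real" where "vol_growth \<equiv> vol.real_growth"
abbreviation res_growth :: "real \<Rightarrow> real" where "res_growth \<equiv> res.real_growth"

lemma product_real: "v (ennreal x) * r (ennreal x) = ennreal (vol_growth x * res_growth x)"
  by (simp add: vol.f_real res.f_real ennreal_mult vol.real_growth_nonneg res.real_growth_nonneg)

lemma ex_radius:
  assumes "1 \<le> y" shows "\<exists>x\<ge>1. vol_growth x * res_growth x = y"
proof -
  let ?T = "max 1 (C\<^sub>1 * y)"
  have "?T = ?T powr 1" by (simp add: powr_one)
  also have "\<dots> \<le> ?T powr d\<^sub>1" using d1 by (intro powr_mono) auto
  also have "\<dots> \<le> C\<^sub>1 * vol_growth ?T"
    using vol.real_growth_scale(1)[of 1 ?T] by (simp add: vol.real_growth_1)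
  finally have "C\<^sub>1 * y \<le> C\<^sub>1 * vol_growth ?T" by simp
  then have "y \<le> vol_growth ?T" using vol.C_ge_1 by simp
  moreover have "1 \<le> res_growth ?T" using res.real_growth_mono[of 1 ?T] by (simp add: res.real_growth_1)
  ultimately have "y * 1 \<le> vol_growth ?T * res_growth ?T"
    using assms by (intro mult_mono) auto
  moreover have "continuous_on {1..?T} (\<lambda>x. vol_growth x * res_growth x)"
    by (intro continuous_on_mult continuous_on_subset[OF vol.continuous_on_real_growth]
        continuous_on_subset[OF res.continuous_on_real_growth]) auto
  ultimately show ?thesis
    using IVT'[of "\<lambda>x. vol_growth x * res_growth x" 1 y ?T] assms
    by (auto simp: vol.real_growth_1 res.real_growth_1)
qed

text \<open>Continuity makes the natural numbers attained values of the product, so that \<open>inv\<close> yields a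
  genuine preimage; it is finite and at least \<open>1\<close>.\<close>

lemma inverse_product:
  assumes "1 \<le> n"
  obtains x where "1 \<le> x" "inv (\<lambda>R. v R * r R) (of_nat n) = ennreal x"
    "vol_growth x * res_growth x = real n"
proof -
  let ?F = "\<lambda>R. v R * r R" and ?I = "inv (\<lambda>R. v R * r R) (of_nat n)"
  obtain x0 where "vol_growth x0 * res_growth x0 = real n"
    using ex_radius[of "real n"] assms by auto
  then have "?F (ennreal x0) = of_nat n" by (simp add: product_real ennreal_of_nat_eq_real_of_nat)
  then have F: "?F ?I = of_nat n" by (intro f_inv_into_f) (auto intro: range_eqI[of _ _ "ennreal x0"])
  have "?I \<noteq> \<infinity>"
  proof
    assume I: "?I = \<infinity>"
    show False using F unfolding I vol.f_top res.f_top by (simp add: ennreal_top_mult)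
  qed
  then obtain x where x: "?I = ennreal x" "0 \<le> x" by (cases ?I) auto
  have "ennreal (vol_growth x * res_growth x) = ennreal (real n)"
    using F[unfolded x(1) product_real] by (simp only: ennreal_of_nat_eq_real_of_nat)
  then have eq: "vol_growth x * res_growth x = real n"
    by (subst (asm) ennreal_inj) (auto simp: vol.real_growth_nonneg res.real_growth_nonneg)
  moreover have "1 \<le> x"
  proof (rule ccontr)
    assume "\<not> 1 \<le> x"
    then have "vol_growth x < 1" "res_growth x < 1" by (auto intro: vol.real_growth_less_1 res.real_growth_less_1)
    then have "vol_growth x * res_growth x < 1"
      using mult_left_le[of "res_growth x" "vol_growth x"] vol.real_growth_nonneg[of x] by simp
    with eq assms show False by simp
  qed
  ultimately show thesis using that x by blast
qed

lemma ex_scale: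
  obtains A where "1 \<le> A" "K \<le> A powr \<alpha>\<^sub>1" "K < A powr d\<^sub>1"
proof
  define A where "A = max (max 1 K powr (1 / \<alpha>\<^sub>1)) (max 1 K + 1)"
  show A1: "1 \<le> A" by (simp add: A_def)
  have "K \<le> (max 1 K powr (1 / \<alpha>\<^sub>1)) powr \<alpha>\<^sub>1" using alpha1 by (simp add: powr_powr)
  also have "\<dots> \<le> A powr \<alpha>\<^sub>1" using alpha1 by (intro powr_mono2) (auto simp: A_def)
  finally show "K \<le> A powr \<alpha>\<^sub>1" .
  have "K < A" by (simp add: A_def)
  also have "A \<le> A powr d\<^sub>1" using powr_mono[of 1 d\<^sub>1 A] A1 d1 by (simp add: powr_one)
  finally show "K < A powr d\<^sub>1" .
qed

section \<open>Consequences of good radii\<close>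

text \<open>Monotonicity of \<open>r\<close> bounds the resistance to all vertices of the ball by its value at the
  radius of the ball.\<close>

lemma good_radii_real:
  assumes good: "ennreal x \<in> good_radii v r \<Gamma> lam" and x: "0 < x" and lam: "1 < lam"
  shows "ennreal (vol_growth x / lam) \<le> vol \<Gamma> (ennreal x)"
    "vol \<Gamma> (ennreal x) \<le> ennreal (lam * vol_growth x)"
    "ennreal (res_growth x / lam) \<le> Reff_ball \<Gamma> (ennreal x)"
    "y \<in> gball \<Gamma> (ennreal x) \<Longrightarrow> Reff_pt \<Gamma> (origin \<Gamma>) y \<le> ennreal (lam * res_growth x)"
proof -
  have m: "ennreal (inverse lam) * ennreal z = ennreal (z / lam)" "ennreal lam * ennreal z = ennreal (lam * z)"
    if "0 \<le> z" for z
    using that lam by (simp_all add: ennreal_mult[symmetric] divide_inverse mult.commute)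
  show "ennreal (vol_growth x / lam) \<le> vol \<Gamma> (ennreal x)"
    "vol \<Gamma> (ennreal x) \<le> ennreal (lam * vol_growth x)"
    "ennreal (res_growth x / lam) \<le> Reff_ball \<Gamma> (ennreal x)"
    using good by (auto simp: good_radii_def vol.f_real res.f_real m vol.real_growth_nonneg res.real_growth_nonneg)
  assume y: "y \<in> gball \<Gamma> (ennreal x)"
  then have "Reff_pt \<Gamma> (origin \<Gamma>) y \<le> ennreal lam * r (ennreal (gdist \<Gamma> (origin \<Gamma>) y))"
    using good by (auto simp: good_radii_def)
  also have "\<dots> = ennreal (lam * res_growth (gdist \<Gamma> (origin \<Gamma>) y))"
    by (simp add: res.f_real m res.real_growth_nonneg)
  also have "\<dots> \<le> ennreal (lam * res_growth x)"
    using y x lam by (intro ennreal_leI mult_left_mono res.real_growth_mono gdist_gball) auto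
  finally show "Reff_pt \<Gamma> (origin \<Gamma>) y \<le> ennreal (lam * res_growth x)" .
qed

text \<open>The ratio \<open>A\<close> of consecutive radii is chosen so large that the resistance to a vertex of one
  good ball is at most one eighth of the resistance to the complement of the next one.\<close>

context
  fixes lam A :: real
  assumes lam: "1 < lam" and A: "1 \<le> A" and A_res: "8 * lam\<^sup>2 * C\<^sub>2 \<le> A powr \<alpha>\<^sub>1"
begin

lemma res_growth_jump: "0 < x \<Longrightarrow> 8 * lam\<^sup>2 * res_growth x \<le> res_growth (A * x)"
proof -
  assume x: "0 < x"
  have "C\<^sub>2 * (8 * lam\<^sup>2 * res_growth x) \<le> A powr \<alpha>\<^sub>1 * res_growth x"
    using mult_right_mono[OF A_res res.real_growth_nonneg[of x]] by (simp add: mult_ac)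
  also have "\<dots> \<le> C\<^sub>2 * res_growth (A * x)" by (rule res.real_growth_scale(1)[OF x A])
  finally show ?thesis using res.C_ge_1 by simp
qed

lemma near_origin:
  assumes good: "ennreal x \<in> good_radii v r \<Gamma> lam" and x: "0 < x" and y: "y \<in> gball \<Gamma> (ennreal x)"
  shows "Reff_pt \<Gamma> (origin \<Gamma>) y \<le> ennreal (res_growth (A * x) / lam / 8)"
proof -
  have "lam * (8 * lam * res_growth x) \<le> res_growth (A * x)"
    using res_growth_jump[OF x] by (simp add: power2_eq_square mult_ac)
  then have "lam * res_growth x \<le> res_growth (A * x) / lam / 8" using lam by (simp add: field_simps)
  then show ?thesis
    using good_radii_real(4)[OF good x lam y] by (meson ennreal_leI order_trans)
qed

text \<open>The lower bound on exit times applied to the ball of radius \<open>A * x\<close>, with the smaller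
  good ball of radius \<open>x\<close> as the set of vertices close to the marked one.\<close>

lemma good_exit:
  assumes G: "marked_graph \<Gamma>" and x: "0 < x"
    and good: "ennreal x \<in> good_radii v r \<Gamma> lam" "ennreal (A * x) \<in> good_radii v r \<Gamma> lam"
  shows "ennreal (1 / (4 * lam\<^sup>2 * C\<^sub>1 * A powr d\<^sub>2) * (vol_growth (A * x) * res_growth (A * x)))
    \<le> mean_exit_time \<Gamma> (ennreal (A * x))"
proof -
  interpret random_walk_graph \<Gamma> by (rule random_walk_graph.intro[OF G])
  have Ax: "0 < A * x" "x \<le> A * x" using x A by auto
  note pos = vol.real_growth_pos[OF x] res.real_growth_pos[OF Ax(1)]
  have fin: "vol \<Gamma> (ennreal (A * x)) < \<infinity>"
    using good_radii_real(2)[OF good(2) Ax(1) lam] by (auto simp: less_top[symmetric] top_unique)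
  have "ennreal ((res_growth (A * x) / lam) * (vol_growth x / lam) / 4) \<le> mean_exit_time \<Gamma> (ennreal (A * x))"
    by (rule mean_exit_time_lower(2)[of "ennreal x"])
      (use x Ax fin pos lam good_radii_real[OF good(1) x lam] good_radii_real[OF good(2) Ax(1) lam]
        near_origin[OF good(1) x] in \<open>auto intro: ennreal_leI\<close>)
  moreover have "1 / (4 * lam\<^sup>2 * C\<^sub>1 * A powr d\<^sub>2) * (vol_growth (A * x) * res_growth (A * x))
     \<le> (res_growth (A * x) / lam) * (vol_growth x / lam) / 4"
  proof -
    have K: "0 < C\<^sub>1 * A powr d\<^sub>2" using vol.C_ge_1 A by simp
    have "vol_growth (A * x) * res_growth (A * x) \<le> (C\<^sub>1 * A powr d\<^sub>2 * vol_growth x) * res_growth (A * x)"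
      using vol.real_growth_scale(2)[OF x A] pos by (intro mult_right_mono) auto
    then have "1 / (4 * lam\<^sup>2 * (C\<^sub>1 * A powr d\<^sub>2)) * (vol_growth (A * x) * res_growth (A * x))
      \<le> 1 / (4 * lam\<^sup>2 * (C\<^sub>1 * A powr d\<^sub>2)) * ((C\<^sub>1 * A powr d\<^sub>2 * vol_growth x) * res_growth (A * x))"
      using K by (intro mult_left_mono) auto
    also have "\<dots> = (res_growth (A * x) / lam) * (vol_growth x / lam) / 4"
    proof -
      have "1 / (4 * lam\<^sup>2 * k) * ((k * p) * q) = (q / lam) * (p / lam) / 4" if "k \<noteq> 0" for k p q :: real
        using that by (simp add: power2_eq_square mult_ac)
      from this[of "C\<^sub>1 * A powr d\<^sub>2" "vol_growth x" "res_growth (A * x)"] K show ?thesis by argo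
    qed
    finally show ?thesis by (simp add: mult.assoc)
  qed
  ultimately show ?thesis by (meson ennreal_leI order_trans)
qed

text \<open>Three radii are needed: volume is collected in the first ball, the walk survives in the second, and the
  third has strictly larger volume than the second by the choice of \<open>A\<close>.  All ratios of growth functions
  at these radii are bounded by constant multiples of powers of \<open>A\<close>, which leaves \<open>vol_growth x\<close> only.\<close>

lemma good_heat_kernel_lower:
  assumes G: "marked_graph \<Gamma>" and x: "0 < x" and A_vol: "lam\<^sup>2 * C\<^sub>1 < A powr d\<^sub>1"
    and good: "ennreal x \<in> good_radii v r \<Gamma> lam" "ennreal (A * x) \<in> good_radii v r \<Gamma> lam"
      "ennreal (A * (A * x)) \<in> good_radii v r \<Gamma> lam"
    and n: "vol_growth x * res_growth x = real n"
  defines "\<kappa> \<equiv> 1 / (32 * lam ^ 4 * (C\<^sub>1 * A powr d\<^sub>2) * (C\<^sub>2 * A powr \<alpha>\<^sub>2))"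
  shows "\<kappa>\<^sup>2 / (lam * (C\<^sub>1 * A powr d\<^sub>2)) / vol_growth x \<le> heat_kernel \<Gamma> (2 * n) (origin \<Gamma>) (origin \<Gamma>)"
proof -
  interpret random_walk_graph \<Gamma> by (rule random_walk_graph.intro[OF G])
  define K where "K = C\<^sub>1 * A powr d\<^sub>2"
  define L where "L = C\<^sub>2 * A powr \<alpha>\<^sub>2"
  have K: "0 < K" and L: "0 < L" using vol.C_ge_1 res.C_ge_1 A by (auto simp: K_def L_def)
  have Ax: "0 < A * x" "x \<le> A * x" "0 < A * (A * x)" "A * x \<le> A * (A * x)" using x A by auto
  define \<rho> where "\<rho> = res_growth (A * x) / lam"
  define W where "W = vol_growth x / lam"
  define V where "V = lam * vol_growth (A * x)"
  define S where "S = lam * res_growth (A * (A * x))"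
  have pos: "0 < \<rho>" "0 < W" "0 < V" "0 < S" "0 < vol_growth x" "0 < res_growth (A * x)"
    using lam vol.real_growth_pos[OF x] vol.real_growth_pos[OF Ax(1)] res.real_growth_pos[OF Ax(1)]
      res.real_growth_pos[OF Ax(3)] by (auto simp: \<rho>_def W_def V_def S_def)
  note g1 = good_radii_real[OF good(1) x lam] and g2 = good_radii_real[OF good(2) Ax(1) lam]
    and g3 = good_radii_real[OF good(3) Ax(3) lam]
  have "C\<^sub>1 * (lam\<^sup>2 * vol_growth (A * x)) < A powr d\<^sub>1 * vol_growth (A * x)"
    using mult_strict_right_mono[OF A_vol vol.real_growth_pos[OF Ax(1)]] by (simp add: mult_ac)
  also have "\<dots> \<le> C\<^sub>1 * vol_growth (A * (A * x))" by (rule vol.real_growth_scale(1)[OF Ax(1) A])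
  finally have "lam\<^sup>2 * vol_growth (A * x) < vol_growth (A * (A * x))" using vol.C_ge_1 by simp
  then have "V < vol_growth (A * (A * x)) / lam" using lam by (simp add: V_def field_simps power2_eq_square)
  then have "ennreal V < ennreal (vol_growth (A * (A * x)) / lam)" using pos by (simp add: ennreal_lessI)
  then have more: "vol \<Gamma> (ennreal (A * x)) < vol \<Gamma> (ennreal (A * (A * x)))"
    using g2(2) g3(1) unfolding V_def by (meson le_less_trans less_le_trans)
  have nle: "2 * real n \<le> \<rho> * W / 4"
  proof -
    have "vol_growth x * (8 * lam\<^sup>2 * res_growth x) \<le> vol_growth x * res_growth (A * x)"
      using res_growth_jump[OF x] pos by (intro mult_left_mono) auto
    then show ?thesis unfolding n[symmetric] \<rho>_def W_def using lam by (simp add: field_simps power2_eq_square)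
  qed
  have heat: "(\<rho> * W / (32 * S * V))\<^sup>2 / V \<le> heat_kernel \<Gamma> (2 * n) (origin \<Gamma>) (origin \<Gamma>)"
    by (rule heat_kernel_lower[of "ennreal x" "ennreal (A * x)" "ennreal (A * (A * x))"])
      (use x Ax pos more nle g1 g2 g3 near_origin[OF good(1) x] in
        \<open>auto intro: ennreal_leI simp: \<rho>_def W_def V_def S_def\<close>)
  have vA: "vol_growth (A * x) \<le> K * vol_growth x" using vol.real_growth_scale(2)[OF x A] by (simp add: K_def)
  have rA: "res_growth (A * (A * x)) \<le> L * res_growth (A * x)" using res.real_growth_scale(2)[OF Ax(1) A] by (simp add: L_def)
  have VK: "V \<le> lam * K * vol_growth x" using vA lam by (simp add: V_def mult.assoc mult_left_mono)
  have SL: "S \<le> lam * L * res_growth (A * x)" using rA lam by (simp add: S_def mult.assoc mult_left_mono)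
  have "\<kappa> = \<rho> * W / (32 * (lam * L * res_growth (A * x)) * (lam * K * vol_growth x))"
    unfolding \<kappa>_def K_def[symmetric] L_def[symmetric] using K L lam pos
    by (simp add: \<rho>_def W_def field_simps power4_eq_xxxx)
  also have "\<dots> \<le> \<rho> * W / (32 * S * V)"
    using pos lam K L by (intro divide_left_mono mult_mono VK SL mult_left_mono mult_pos_pos) auto
  finally have \<kappa>: "\<kappa> \<le> \<rho> * W / (32 * S * V)" .
  have \<kappa>0: "0 \<le> \<kappa>" using K L lam by (simp add: \<kappa>_def K_def[symmetric] L_def[symmetric])
  have "\<kappa>\<^sup>2 / (lam * K) / vol_growth x = \<kappa>\<^sup>2 / (lam * K * vol_growth x)" by simp
  also have "\<dots> \<le> (\<rho> * W / (32 * S * V))\<^sup>2 / V"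
    using \<kappa> \<kappa>0 VK pos by (intro frac_le power_mono) auto
  finally show ?thesis using heat by (simp add: K_def)
qed

end

text \<open>The two terms of the upper bound are balanced at the radius with
  \<open>vol_growth x * res_growth x = n\<close>.\<close>

lemma heat_kernel_upper_real:
  assumes G: "marked_graph \<Gamma>" and x: "0 < x" and lam: "1 < lam" and n: "vol_growth x * res_growth x = real n" "1 \<le> n"
    and vol: "ennreal (inverse lam) * v (ennreal x) \<le> vol \<Gamma> (ennreal x)"
    and res: "\<And>y. y \<in> gball \<Gamma> (ennreal x) \<Longrightarrow>
      Reff_pt \<Gamma> (origin \<Gamma>) y \<le> ennreal lam * r (ennreal (gdist \<Gamma> (origin \<Gamma>) y))"
  shows "heat_kernel \<Gamma> (2 * n) (origin \<Gamma>) (origin \<Gamma>) \<le> 7 * lam / vol_growth x"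
proof -
  interpret random_walk_graph \<Gamma> by (rule random_walk_graph.intro[OF G])
  have pos: "0 < vol_growth x" "0 < res_growth x" using x by (auto intro: vol.real_growth_pos res.real_growth_pos)
  have W: "ennreal (vol_growth x / lam) \<le> vol \<Gamma> (ennreal x)"
    using vol pos lam by (simp add: vol.f_real ennreal_mult[symmetric] divide_inverse mult.commute)
  have S: "Reff_pt \<Gamma> (origin \<Gamma>) y \<le> ennreal (lam * res_growth x)" if y: "y \<in> gball \<Gamma> (ennreal x)" for y
  proof -
    have "gdist \<Gamma> (origin \<Gamma>) y \<le> x"
      using y x by (intro gdist_gball) auto
    have "Reff_pt \<Gamma> (origin \<Gamma>) y \<le> ennreal lam * r (ennreal (gdist \<Gamma> (origin \<Gamma>) y))" by (rule res[OF y])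
    also have "\<dots> = ennreal (lam * res_growth (gdist \<Gamma> (origin \<Gamma>) y))"
      using lam by (simp add: res.f_real ennreal_mult res.real_growth_nonneg)
    also have "\<dots> \<le> ennreal (lam * res_growth x)"
      using \<open>gdist \<Gamma> (origin \<Gamma>) y \<le> x\<close> lam by (intro ennreal_leI mult_left_mono res.real_growth_mono) auto
    finally show ?thesis .
  qed
  have "heat_kernel \<Gamma> (2 * n) (origin \<Gamma>) (origin \<Gamma>) \<le> 3 / (vol_growth x / lam) + 4 * (lam * res_growth x) / n"
    by (rule heat_kernel_upper[OF n(2) _ _ W _ S]) (use x lam pos in auto)
  also have "\<dots> = 7 * lam / vol_growth x"
    unfolding n(1)[symmetric] using pos lam by (simp add: field_simps)
  finally show ?thesis .
qed

text \<open>The ball of radius \<open>x / D\<close> has so much less volume than that of radius \<open>x\<close> that the walk is outside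
  with probability at least one half.\<close>

lemma good_displacement:
  assumes G: "marked_graph \<Gamma>" and x: "0 < x" and lam: "1 < lam" and n: "vol_growth x * res_growth x = real n" "1 \<le> n"
    and D: "1 \<le> D" "28 * lam\<^sup>2 * C\<^sub>1 \<le> D powr d\<^sub>1"
    and good: "ennreal x \<in> good_radii v r \<Gamma> lam" "ennreal (x / D) \<in> good_radii v r \<Gamma> lam"
  shows "ennreal (x / D / 2) \<le> mean_displacement \<Gamma> n"
proof -
  interpret random_walk_graph \<Gamma> by (rule random_walk_graph.intro[OF G])
  have xD: "0 < x / D" using x D by auto
  have pos: "0 < vol_growth x" "0 < vol_growth (x / D)" using x xD by (auto intro: vol.real_growth_pos)
  let ?h = "heat_kernel \<Gamma> (2 * n) (origin \<Gamma>) (origin \<Gamma>)"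
  let ?p = "measure (walk \<Gamma> (origin \<Gamma>)) {w. w n \<in> gball \<Gamma> (ennreal (x / D))}"
  have h: "?h \<le> 7 * lam / vol_growth x"
    by (rule heat_kernel_upper_real[OF G x lam n]) (use good in \<open>auto simp: good_radii_def\<close>)
  have "C\<^sub>1 * (28 * lam\<^sup>2 * vol_growth (x / D)) \<le> D powr d\<^sub>1 * vol_growth (x / D)"
    using mult_right_mono[OF D(2), of "vol_growth (x / D)"] pos by (simp add: mult_ac)
  also have "\<dots> \<le> C\<^sub>1 * vol_growth x"
    using vol.real_growth_scale(1)[OF xD D(1)] D by simp
  finally have vD: "28 * lam\<^sup>2 * vol_growth (x / D) \<le> vol_growth x" using vol.C_ge_1 by simp
  have "?p\<^sup>2 \<le> lam * vol_growth (x / D) * ?h"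
    by (rule walk_in_gball_sq[OF good_radii_real(2)[OF good(2) xD lam]]) (use lam pos in auto)
  also have "\<dots> \<le> lam * vol_growth (x / D) * (7 * lam / vol_growth x)"
    using h lam pos by (intro mult_left_mono) auto
  also have "\<dots> \<le> (1 / 2)\<^sup>2"
    using vD pos by (simp add: field_simps power2_eq_square)
  finally have "?p \<le> 1 / 2" by (rule power2_le_imp_le) simp
  from mean_displacement_ge[OF _ this] xD show ?thesis by simp
qed

end

section \<open>Averaging over the environment\<close>

text \<open>Non-measurable sets have measure zero, so the lower bounds imply measurability.\<close>

lemma (in prob_space) three_likely_events:
  assumes "5 / 6 \<le> prob A" "5 / 6 \<le> prob B" "5 / 6 \<le> prob C"
  shows "A \<inter> B \<inter> C \<in> events" "1 / 2 \<le> prob (A \<inter> B \<inter> C)"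
proof -
  have m: "X \<in> events" if "5 / 6 \<le> prob X" for X
    using that measure_notin_sets[of X M] by force
  note A = m[OF assms(1)] and B = m[OF assms(2)] and C = m[OF assms(3)]
  show "A \<inter> B \<inter> C \<in> events" using A B C by auto
  have "prob (X \<inter> Y) \<ge> prob X + prob Y - 1" if "X \<in> events" "Y \<in> events" for X Y
    using finite_measure_Union'[OF that] finite_measure_Diff'[OF that(2,1)] prob_le_1[of "X \<union> Y"]
    by (simp add: Int_commute)
  from this[OF A B] this[OF sets.Int[OF A B] C] assms show "1 / 2 \<le> prob (A \<inter> B \<inter> C)" by linarith
qed

lemma (in prob_space) nn_integral_ge_on_event:
  assumes "E \<in> events" "1 / 2 \<le> prob E" "0 \<le> c" "\<And>\<omega>. \<omega> \<in> E \<Longrightarrow> ennreal c \<le> f \<omega>"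
  shows "ennreal (c / 2) \<le> (\<integral>\<^sup>+\<omega>. f \<omega> \<partial>M)"
proof -
  have "c / 2 \<le> c * prob E" using assms(2,3) mult_left_mono[of "1 / 2" "prob E" c] by simp
  then have "ennreal (c / 2) \<le> ennreal c * emeasure M E"
    using assms(3) by (simp add: emeasure_eq_measure ennreal_mult[symmetric] ennreal_leI)
  also have "\<dots> = (\<integral>\<^sup>+\<omega>. ennreal c * indicator E \<omega> \<partial>M)"
    by (rule nn_integral_cmult_indicator[OF assms(1), symmetric])
  also have "\<dots> \<le> (\<integral>\<^sup>+\<omega>. f \<omega> \<partial>M)"
    by (intro nn_integral_mono) (use assms(4) in \<open>auto simp: indicator_def\<close>)
  finally show ?thesis .
qed

text \<open>A discrete layer-cake estimate: \<open>Y\<close> exceeds \<open>L\<close> by at most the number of the \<open>k\<close> with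
  \<open>L + k < Y\<close>.\<close>

lemma (in prob_space) nn_integral_le_tail_sum:
  fixes Y :: "'a \<Rightarrow> real"
  assumes Y: "Y \<in> borel_measurable M" and t: "summable t"
    and tail: "\<And>k. prob {\<omega> \<in> space M. real (L + k) < Y \<omega>} \<le> t k"
  shows "(\<integral>\<^sup>+\<omega>. ennreal (Y \<omega>) \<partial>M) \<le> ennreal (real L + suminf t)"
proof -
  let ?E = "\<lambda>k. {\<omega> \<in> space M. real (L + k) < Y \<omega>}"
  have E: "?E k \<in> events" for k using Y by measurable
  have t0: "0 \<le> t k" for k using tail[of k] measure_nonneg[of M "?E k"] by linarith
  have "ennreal (Y \<omega>) \<le> of_nat L + (\<Sum>k. indicator (?E k) \<omega>)" if \<omega>: "\<omega> \<in> space M" for \<omega>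
  proof (cases "Y \<omega> \<le> real L")
    case True
    then have "ennreal (Y \<omega>) \<le> of_nat L" by (simp add: ennreal_of_nat_eq_real_of_nat ennreal_leI)
    then show ?thesis by (rule order_trans) simp
  next
    case False
    define m where "m = nat \<lceil>Y \<omega> - real L\<rceil>"
    have in_E: "\<omega> \<in> ?E k" if "k < m" for k
    proof -
      have "int k < \<lceil>Y \<omega> - real L\<rceil>" using that by (simp add: m_def)
      then show ?thesis using \<omega> by (simp add: less_ceiling_iff)
    qed
    have "Y \<omega> \<le> real (L + m)" using False by (simp add: m_def) linarith
    then have "ennreal (Y \<omega>) \<le> of_nat (L + m)"
      by (simp only: ennreal_of_nat_eq_real_of_nat ennreal_leI)
    also have "\<dots> = of_nat L + (\<Sum>k<m. indicator (?E k) \<omega>)"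
      using in_E by simp
    also have "\<dots> \<le> of_nat L + (\<Sum>k. indicator (?E k) \<omega>)"
      by (intro add_left_mono sum_le_suminf) auto
    finally show ?thesis .
  qed
  then have "(\<integral>\<^sup>+\<omega>. ennreal (Y \<omega>) \<partial>M) \<le> (\<integral>\<^sup>+\<omega>. of_nat L + (\<Sum>k. indicator (?E k) \<omega>) \<partial>M)"
    by (rule nn_integral_mono)
  also have "\<dots> = of_nat L + (\<Sum>k. emeasure M (?E k))"
    using E by (simp add: nn_integral_add nn_integral_suminf emeasure_space_1)
  also have "\<dots> \<le> of_nat L + (\<Sum>k. ennreal (t k))"
    using tail by (intro add_left_mono suminf_le) (auto simp: emeasure_eq_measure intro: ennreal_leI)
  also have "\<dots> = ennreal (real L + suminf t)"
    using t t0 by (simp add: suminf_ennreal2 ennreal_of_nat_eq_real_of_nat ennreal_plus suminf_nonneg)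
  finally show ?thesis .
qed

lemma ex_uniform_lower_bound:
  fixes e :: "nat \<Rightarrow> ennreal"
  assumes "finite K" "\<And>n. n \<in> K \<Longrightarrow> 0 < e n"
  obtains \<delta> :: real where "0 < \<delta>" "\<And>n. n \<in> K \<Longrightarrow> ennreal \<delta> \<le> e n"
proof -
  define m where "m = Min (insert 1 (e ` K))"
  have m: "m \<le> 1" "0 < m" using assms by (auto simp: m_def)
  then obtain \<delta> where \<delta>: "m = ennreal \<delta>" "0 \<le> \<delta>" by (cases m) (auto simp: top_unique)
  with m have "0 < \<delta>" by (cases "\<delta> = 0") auto
  moreover have "ennreal \<delta> \<le> e n" if "n \<in> K" for n
    unfolding \<delta>(1)[symmetric] m_def using assms(1) that by (intro Min_le) auto
  ultimately show thesis by (rule that)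
qed

locale random_environment = growth_pair + prob_space M
  for M :: "'w measure" +
  fixes \<Gamma> :: "'w \<Rightarrow> ('v, 'z) metric_graph_scheme"
  assumes random: "random_graph M \<Gamma>"
begin

lemma graph: "\<omega> \<in> space M \<Longrightarrow> marked_graph (\<Gamma> \<omega>)"
  and measurable_heat_kernel:
    "(\<lambda>\<omega>. heat_kernel (\<Gamma> \<omega>) n (origin (\<Gamma> \<omega>)) (origin (\<Gamma> \<omega>))) \<in> borel_measurable M"
  and measurable_displacement: "(\<lambda>\<omega>. mean_displacement (\<Gamma> \<omega>) n) \<in> borel_measurable M"
  using random by (auto simp: random_graph_def)

lemma quenched: "\<omega> \<in> space M \<Longrightarrow> random_walk_graph (\<Gamma> \<omega>)"
  by (rule random_walk_graph.intro[OF graph])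

abbreviation return_mean :: "nat \<Rightarrow> ennreal" where
  "return_mean n \<equiv> \<integral>\<^sup>+\<omega>. ennreal (heat_kernel (\<Gamma> \<omega>) (2 * n) (origin (\<Gamma> \<omega>)) (origin (\<Gamma> \<omega>))) \<partial>M"

lemma displacement_pos:
  assumes "1 \<le> n" shows "0 < (\<integral>\<^sup>+\<omega>. mean_displacement (\<Gamma> \<omega>) n \<partial>M)"
proof (rule ccontr)
  assume "\<not> ?thesis"
  then have "(\<integral>\<^sup>+\<omega>. mean_displacement (\<Gamma> \<omega>) n \<partial>M) = 0" by simp
  then have "AE \<omega> in M. mean_displacement (\<Gamma> \<omega>) n = 0"
    by (simp add: nn_integral_0_iff_AE[OF measurable_displacement])
  moreover have "AE \<omega> in M. mean_displacement (\<Gamma> \<omega>) n \<noteq> 0"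
    using random_walk_graph.mean_displacement_pos[OF quenched assms] by (intro AE_I2) force
  ultimately have "AE \<omega> in M. False" by eventually_elim simp
  then show False by simp
qed

lemma exit_upper:
  assumes "\<And>R. 1 \<le> R \<Longrightarrow> R < \<infinity> \<Longrightarrow>
    (\<integral>\<^sup>+\<omega>. Reff_ball (\<Gamma> \<omega>) R * vol (\<Gamma> \<omega>) R \<partial>M) \<le> ennreal c * (v R * r R)"
    and R: "1 \<le> R" "R < \<infinity>"
  shows "(\<integral>\<^sup>+\<omega>. mean_exit_time (\<Gamma> \<omega>) R \<partial>M) \<le> ennreal c * (v R * r R)"
proof -
  have R0: "0 < R" using R(1) by (rule less_le_trans[rotated]) simp
  have "(\<integral>\<^sup>+\<omega>. mean_exit_time (\<Gamma> \<omega>) R \<partial>M) \<le> (\<integral>\<^sup>+\<omega>. Reff_ball (\<Gamma> \<omega>) R * vol (\<Gamma> \<omega>) R \<partial>M)"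
    by (intro nn_integral_mono random_walk_graph.mean_exit_time_upper[OF quenched R0])
  with assms show ?thesis by (meson order_trans)
qed

text \<open>One level \<open>lam\<close> is fixed at which every radius is good with probability at least \<open>5 / 6\<close>.  Up to
  three prescribed radii are then good together with probability at least one half, and lower
  bounds valid on this event pass to the mean with half the constant.\<close>

context
  fixes lam :: real
  assumes lam: "1 < lam"
    and likely: "\<And>x. 1 \<le> x \<Longrightarrow> 5 / 6 \<le> prob {\<omega> \<in> space M. ennreal x \<in> good_radii v r (\<Gamma> \<omega>) lam}"
begin

lemma average_ge:
  assumes "1 \<le> x" "1 \<le> y" "1 \<le> z" "0 \<le> c"
    and "\<And>\<omega>. \<omega> \<in> space M \<Longrightarrow> ennreal x \<in> good_radii v r (\<Gamma> \<omega>) lam \<Longrightarrow>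
      ennreal y \<in> good_radii v r (\<Gamma> \<omega>) lam \<Longrightarrow> ennreal z \<in> good_radii v r (\<Gamma> \<omega>) lam \<Longrightarrow> ennreal c \<le> f \<omega>"
  shows "ennreal (c / 2) \<le> (\<integral>\<^sup>+\<omega>. f \<omega> \<partial>M)"
  by (rule nn_integral_ge_on_event[OF three_likely_events[OF likely likely likely, OF assms(1-3)] assms(4)])
    (use assms(5) in auto)

lemma ex_jump:
  obtains A where "1 \<le> A" "8 * lam\<^sup>2 * C\<^sub>2 \<le> A powr \<alpha>\<^sub>1" "lam\<^sup>2 * C\<^sub>1 < A powr d\<^sub>1"
proof -
  obtain A where A: "1 \<le> A" "8 * lam\<^sup>2 * (C\<^sub>1 + C\<^sub>2) \<le> A powr \<alpha>\<^sub>1" "8 * lam\<^sup>2 * (C\<^sub>1 + C\<^sub>2) < A powr d\<^sub>1"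
    by (rule ex_scale)
  have "8 * lam\<^sup>2 * C\<^sub>2 \<le> 8 * lam\<^sup>2 * (C\<^sub>1 + C\<^sub>2)" using vol.C_ge_1 by (intro mult_left_mono) auto
  moreover have "lam\<^sup>2 * C\<^sub>1 \<le> lam\<^sup>2 * (8 * (C\<^sub>1 + C\<^sub>2))"
    using vol.C_ge_1 res.C_ge_1 by (intro mult_left_mono) auto
  moreover have "lam\<^sup>2 * (8 * (C\<^sub>1 + C\<^sub>2)) = 8 * lam\<^sup>2 * (C\<^sub>1 + C\<^sub>2)" by simp
  ultimately show thesis using A by (intro that[of A]) linarith+
qed

text \<open>Radii below \<open>A\<close>, for which \<open>R / A\<close> is not an admissible radius, use that the exit
  time is at least \<open>1\<close>.\<close>

lemma exit_lower:
  "\<exists>c>0. \<forall>R. 1 \<le> R \<and> R < \<infinity> \<longrightarrow> ennreal c * (v R * r R) \<le> (\<integral>\<^sup>+\<omega>. mean_exit_time (\<Gamma> \<omega>) R \<partial>M)"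
proof -
  obtain A where A: "1 \<le> A" "8 * lam\<^sup>2 * C\<^sub>2 \<le> A powr \<alpha>\<^sub>1" "lam\<^sup>2 * C\<^sub>1 < A powr d\<^sub>1" by (rule ex_jump)
  let ?F = "\<lambda>x. vol_growth x * res_growth x"
  define c0 where "c0 = 1 / (4 * lam\<^sup>2 * C\<^sub>1 * A powr d\<^sub>2)"
  define c where "c = min (c0 / 2) (1 / ?F A)"
  have F_pos: "0 < ?F x" if "0 < x" for x
    using that by (intro mult_pos_pos vol.real_growth_pos res.real_growth_pos)
  have c0: "0 < c0" using lam A vol.C_ge_1 by (simp add: c0_def)
  have c: "0 < c" "c \<le> c0 / 2" "c \<le> 1 / ?F A" using c0 F_pos[of A] A by (auto simp: c_def)
  have "ennreal c * (v R * r R) \<le> (\<integral>\<^sup>+\<omega>. mean_exit_time (\<Gamma> \<omega>) R \<partial>M)" if R: "1 \<le> R" "R < \<infinity>" for R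
  proof -
    obtain x where x: "R = ennreal x" "1 \<le> x"
      using R by (cases R) (auto simp: ennreal_1[symmetric] simp del: ennreal_1)
    have lhs: "ennreal c * (v R * r R) = ennreal (c * ?F x)"
      unfolding x(1) product_real using c F_pos[of x] x by (intro ennreal_mult[symmetric]) auto
    show ?thesis
    proof (cases "A \<le> x")
      case True
      have y: "1 \<le> x / A" "A * (x / A) = x" using True A by auto
      have "ennreal (c0 * ?F x / 2) \<le> (\<integral>\<^sup>+\<omega>. mean_exit_time (\<Gamma> \<omega>) R \<partial>M)"
      proof (rule average_ge[of "x / A" x x])
        fix \<omega> assume \<omega>: "\<omega> \<in> space M" "ennreal (x / A) \<in> good_radii v r (\<Gamma> \<omega>) lam"
          "ennreal x \<in> good_radii v r (\<Gamma> \<omega>) lam"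
        show "ennreal (c0 * ?F x) \<le> mean_exit_time (\<Gamma> \<omega>) R"
          using good_exit[OF lam A(1,2) graph[OF \<omega>(1)], of "x / A"] \<omega> y unfolding c0_def x(1) by simp
      qed (use x y c0 F_pos[of x] in auto)
      moreover have "c * ?F x \<le> c0 * ?F x / 2"
        using mult_right_mono[OF c(2), of "?F x"] F_pos[of x] x by simp
      ultimately show ?thesis unfolding lhs by (meson ennreal_leI order_trans)
    next
      case False
      then have Fx_FA: "?F x \<le> ?F A"
        by (intro mult_mono vol.real_growth_mono res.real_growth_mono vol.real_growth_nonneg res.real_growth_nonneg) auto
      have Fs: "0 \<le> ?F x" "0 < ?F A" using F_pos[of x] F_pos[of A] A x by auto
      have "c * ?F x \<le> 1 / ?F A * ?F A"
        using c Fx_FA Fs by (intro mult_mono[of c "1 / ?F A" "?F x" "?F A"]) auto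
      also have "1 / ?F A * ?F A = 1"
      proof -
        have "1 / z * z = 1" if "0 < z" for z :: real using that by simp
        then show ?thesis using Fs(2) .
      qed
      finally have "ennreal (c * ?F x) \<le> 1" by simp
      also have "1 = (\<integral>\<^sup>+\<omega>. 1 \<partial>M)" by (simp add: emeasure_space_1)
      also have "\<dots> \<le> (\<integral>\<^sup>+\<omega>. mean_exit_time (\<Gamma> \<omega>) R \<partial>M)"
        using x by (intro nn_integral_mono random_walk_graph.mean_exit_time_ge_1[OF quenched]) auto
      finally show ?thesis unfolding lhs .
    qed
  qed
  with c show ?thesis by blast
qed

lemma return_lower:
  "\<exists>c>0. \<forall>n\<ge>1. ennreal c / v (inv (\<lambda>R. v R * r R) (of_nat n)) \<le> return_mean n"
proof -
  obtain A where A: "1 \<le> A" "8 * lam\<^sup>2 * C\<^sub>2 \<le> A powr \<alpha>\<^sub>1" "lam\<^sup>2 * C\<^sub>1 < A powr d\<^sub>1" by (rule ex_jump)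
  define c where "c = (1 / (32 * lam ^ 4 * (C\<^sub>1 * A powr d\<^sub>2) * (C\<^sub>2 * A powr \<alpha>\<^sub>2)))\<^sup>2 / (lam * (C\<^sub>1 * A powr d\<^sub>2))"
  have c: "0 < c" using lam A vol.C_ge_1 res.C_ge_1 by (simp add: c_def)
  have "ennreal (c / 2) / v (inv (\<lambda>R. v R * r R) (of_nat n)) \<le> return_mean n" if n: "1 \<le> n" for n
  proof -
    obtain x where x: "1 \<le> x" "inv (\<lambda>R. v R * r R) (of_nat n) = ennreal x" "vol_growth x * res_growth x = real n"
      by (rule inverse_product[OF n])
    have pos: "0 < vol_growth x" using x by (intro vol.real_growth_pos) auto
    have Ax: "1 \<le> A * x" "1 \<le> A * (A * x)"
      using A(1) x(1) mult_mono[of 1 A 1 x] mult_mono[of 1 A 1 "A * x"] by auto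
    have "ennreal (c / vol_growth x / 2) \<le> return_mean n"
    proof (rule average_ge[OF x(1) Ax])
      fix \<omega> assume \<omega>: "\<omega> \<in> space M" "ennreal x \<in> good_radii v r (\<Gamma> \<omega>) lam"
          "ennreal (A * x) \<in> good_radii v r (\<Gamma> \<omega>) lam" "ennreal (A * (A * x)) \<in> good_radii v r (\<Gamma> \<omega>) lam"
      show "ennreal (c / vol_growth x) \<le> ennreal (heat_kernel (\<Gamma> \<omega>) (2 * n) (origin (\<Gamma> \<omega>)) (origin (\<Gamma> \<omega>)))"
        unfolding c_def using x(1)
        by (intro ennreal_leI good_heat_kernel_lower[OF lam A(1,2) graph[OF \<omega>(1)] _ A(3) \<omega>(2-4) x(3)]) simp
    qed (use c pos in auto)
    also have "ennreal (c / vol_growth x / 2) = ennreal (c / 2) / v (inv (\<lambda>R. v R * r R) (of_nat n))"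
      unfolding x(2) vol.f_real using c pos by (simp add: divide_ennreal)
    finally show ?thesis .
  qed
  with c show ?thesis by (intro exI[of _ "c / 2"]) auto
qed

text \<open>If \<open>I(n) < D\<close>, the radius \<open>I(n) / D\<close> is below \<open>1\<close> and nothing is known about it.  This concerns
  finitely many \<open>n\<close> only, for each of which the mean displacement is positive.\<close>

lemma displacement_lower:
  "\<exists>c>0. \<forall>n\<ge>1. ennreal c * inv (\<lambda>R. v R * r R) (of_nat n) \<le> (\<integral>\<^sup>+\<omega>. mean_displacement (\<Gamma> \<omega>) n \<partial>M)"
proof -
  obtain D where D: "1 \<le> D" "28 * lam\<^sup>2 * C\<^sub>1 \<le> D powr d\<^sub>1"
    using ex_scale[of "28 * lam\<^sup>2 * C\<^sub>1"] by (metis less_imp_le)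
  let ?e = "\<lambda>n. \<integral>\<^sup>+\<omega>. mean_displacement (\<Gamma> \<omega>) n \<partial>M"
  let ?K = "{1..nat \<lceil>vol_growth D * res_growth D\<rceil>}"
  obtain \<delta> where \<delta>: "0 < \<delta>" "\<And>n. n \<in> ?K \<Longrightarrow> ennreal \<delta> \<le> ?e n"
    by (rule ex_uniform_lower_bound[of ?K ?e]) (auto intro: displacement_pos)
  define c where "c = min (1 / (4 * D)) (\<delta> / D)"
  have c: "0 < c" "c \<le> 1 / (4 * D)" "c \<le> \<delta> / D" using D \<delta> by (auto simp: c_def)
  have "ennreal c * inv (\<lambda>R. v R * r R) (of_nat n) \<le> ?e n" if n: "1 \<le> n" for n
  proof -
    obtain x where x: "1 \<le> x" "inv (\<lambda>R. v R * r R) (of_nat n) = ennreal x" "vol_growth x * res_growth x = real n"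
      by (rule inverse_product[OF n])
    have lhs: "ennreal c * ennreal x = ennreal (c * x)" using c x by (simp add: ennreal_mult)
    show ?thesis
    proof (cases "D \<le> x")
      case True
      have "ennreal (x / D / 2 / 2) \<le> ?e n"
      proof (rule average_ge[of x "x / D" x])
        fix \<omega> assume \<omega>: "\<omega> \<in> space M" "ennreal x \<in> good_radii v r (\<Gamma> \<omega>) lam"
          "ennreal (x / D) \<in> good_radii v r (\<Gamma> \<omega>) lam"
        show "ennreal (x / D / 2) \<le> mean_displacement (\<Gamma> \<omega>) n"
          using x(1) by (intro good_displacement[OF graph[OF \<omega>(1)] _ lam x(3) n D \<omega>(2,3)]) simp
      qed (use x D True in auto)
      moreover have "c * x \<le> x / D / 2 / 2"
        using mult_right_mono[OF c(2), of x] x by (simp add: field_simps)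
      ultimately show ?thesis unfolding x(2) lhs by (meson ennreal_leI order_trans)
    next
      case False
      then have "real n \<le> vol_growth D * res_growth D"
        unfolding x(3)[symmetric]
        by (intro mult_mono vol.real_growth_mono res.real_growth_mono vol.real_growth_nonneg res.real_growth_nonneg) auto
      then have "n \<in> ?K" using n by simp linarith
      then have "ennreal \<delta> \<le> ?e n" by (rule \<delta>(2))
      moreover have "c * x \<le> \<delta> / D * D" using c False x D \<delta> by (intro mult_mono) auto
      then have "c * x \<le> \<delta>" using D by simp
      ultimately show ?thesis unfolding x(2) lhs by (meson ennreal_leI order_trans)
    qed
  qed
  with c show ?thesis by blast
qed

end

text \<open>On the event with parameter \<open>lam\<close>, the return probability times \<open>v(I(n))\<close> is at most \<open>7 * lam\<close>, so its
  tail is of order \<open>lam powr -q\<close> and its mean is bounded uniformly in \<open>n\<close>.\<close>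

lemma return_upper:
  assumes q: "2 < q" and lam0: "1 < lam\<^sub>0" and c5: "0 < c\<^sub>5"
    and tail: "\<And>R lam. 1 \<le> R \<Longrightarrow> R < \<infinity> \<Longrightarrow> lam\<^sub>0 \<le> lam \<Longrightarrow>
      1 - c\<^sub>5 / lam powr q \<le> prob {\<omega>\<in>space M. ennreal (inverse lam) * v R \<le> vol (\<Gamma> \<omega>) R \<and>
        (\<forall>y\<in>gball (\<Gamma> \<omega>) R. Reff_pt (\<Gamma> \<omega>) (origin (\<Gamma> \<omega>)) y \<le>
           ennreal lam * r (ennreal (gdist (\<Gamma> \<omega>) (origin (\<Gamma> \<omega>)) y)))}"
  shows "\<exists>c>0. \<forall>n\<ge>1. return_mean n \<le> ennreal c / v (inv (\<lambda>R. v R * r R) (of_nat n))"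
proof -
  \<comment> \<open>From \<open>L\<close> on the tail hypothesis applies, and it has a positive right-hand side, so that the events
    in it are measurable.\<close>
  define L where "L = nat \<lceil>max lam\<^sub>0 c\<^sub>5\<rceil> + 1"
  have L: "lam\<^sub>0 \<le> real (L + k)" "c\<^sub>5 < real (L + k)" "1 < real (L + k)" for k
  proof -
    have "max lam\<^sub>0 c\<^sub>5 + 1 \<le> real (L + k)"
      using real_nat_ceiling_ge[of "max lam\<^sub>0 c\<^sub>5"] unfolding L_def of_nat_add by simp
    then show "lam\<^sub>0 \<le> real (L + k)" "c\<^sub>5 < real (L + k)" "1 < real (L + k)" using lam0 by linarith+
  qed
  define t where "t k = c\<^sub>5 * inverse (real (L + k) ^ 2)" for k
  have t: "summable t"
    unfolding t_def
    using summable_ignore_initial_segment[OF inverse_power_summable[of 2, where 'a=real], of L]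
    by (intro summable_mult) (simp add: add.commute)
  have tsum: "0 \<le> suminf t" using c5 by (intro suminf_nonneg t) (simp add: t_def)
  have powr_q: "c\<^sub>5 / real (L + k) powr q \<le> t k" for k
  proof -
    have "real (L + k) powr 2 \<le> real (L + k) powr q" using q L(3)[of k] by (intro powr_mono) auto
    moreover have "real (L + k) powr 2 = real (L + k) ^ 2" using L(3)[of k] by (intro powr_numeral) simp
    ultimately have "real (L + k) ^ 2 \<le> real (L + k) powr q" by simp
    then show ?thesis unfolding t_def divide_inverse using c5 L(3)[of k]
      by (intro mult_left_mono le_imp_inverse_le) auto
  qed
  have t1: "t k < 1" for k
  proof -
    have "c\<^sub>5 < real (L + k) * 1" using L(2)[of k] by (simp only: mult_1_right)
    also have "\<dots> \<le> real (L + k) * real (L + k)"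
      using L(3)[of k] by (intro mult_left_mono) linarith+
    finally have "c\<^sub>5 < real (L + k) * real (L + k)" .
    moreover have "c\<^sub>5 * inverse (z ^ 2) < 1" if "c\<^sub>5 < z * z" "1 < z" for z :: real
    proof -
      have "c\<^sub>5 * inverse (z ^ 2) = c\<^sub>5 / (z * z)" by (simp add: power2_eq_square divide_inverse)
      also have "\<dots> < 1" using that by (subst divide_less_eq_1_pos) auto
      finally show ?thesis .
    qed
    ultimately show ?thesis using L(3)[of k] unfolding t_def by blast
  qed
  define c where "c = 7 * (real L + suminf t)"
  have c: "0 < c" using tsum L(3)[of 0] by (simp add: c_def)
  have "return_mean n \<le> ennreal c / v (inv (\<lambda>R. v R * r R) (of_nat n))" if n: "1 \<le> n" for n
  proof -
    obtain x where x: "1 \<le> x" "inv (\<lambda>R. v R * r R) (of_nat n) = ennreal x" "vol_growth x * res_growth x = real n"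
      by (rule inverse_product[OF n])
    have pos: "0 < vol_growth x" using x by (intro vol.real_growth_pos) auto
    let ?h = "\<lambda>\<omega>. heat_kernel (\<Gamma> \<omega>) (2 * n) (origin (\<Gamma> \<omega>)) (origin (\<Gamma> \<omega>))"
    let ?Y = "\<lambda>\<omega>. vol_growth x / 7 * ?h \<omega>"
    have Y: "?Y \<in> borel_measurable M" by (intro borel_measurable_times borel_measurable_const measurable_heat_kernel)
    have "(\<integral>\<^sup>+\<omega>. ennreal (?Y \<omega>) \<partial>M) \<le> ennreal (real L + suminf t)"
    proof (rule nn_integral_le_tail_sum[OF Y t])
      fix k
      let ?lam = "real (L + k)"
      let ?G = "{\<omega>\<in>space M. ennreal (inverse ?lam) * v (ennreal x) \<le> vol (\<Gamma> \<omega>) (ennreal x) \<and>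
        (\<forall>y\<in>gball (\<Gamma> \<omega>) (ennreal x). Reff_pt (\<Gamma> \<omega>) (origin (\<Gamma> \<omega>)) y \<le>
           ennreal ?lam * r (ennreal (gdist (\<Gamma> \<omega>) (origin (\<Gamma> \<omega>)) y)))}"
      let ?E = "{\<omega> \<in> space M. ?lam < ?Y \<omega>}"
      have E: "?E \<in> events" using Y by measurable
      have G1: "1 - t k \<le> prob ?G"
      proof -
        have "1 - c\<^sub>5 / ?lam powr q \<le> prob ?G"
          by (rule tail) (use x L in \<open>auto simp: ennreal_1[symmetric] simp del: ennreal_1\<close>)
        with powr_q[of k] show ?thesis by linarith
      qed
      have G: "?G \<in> events"
      proof (rule ccontr)
        assume "?G \<notin> events"
        then have "prob ?G = 0" by (rule measure_notin_sets)
        with G1 t1[of k] show False by linarith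
      qed
      have "?E \<inter> ?G = {}"
      proof -
        have "?Y \<omega> \<le> ?lam" if "\<omega> \<in> ?G" for \<omega>
        proof -
          have "?h \<omega> \<le> 7 * ?lam / vol_growth x"
            by (rule heat_kernel_upper_real[OF graph _ L(3) x(3) n]) (use that x in auto)
          then show ?thesis using pos by (simp add: field_simps)
        qed
        then show ?thesis by fastforce
      qed
      then have "prob ?E + prob ?G = prob (?E \<union> ?G)" using E G by (intro finite_measure_Union[symmetric])
      with G1 prob_le_1[of "?E \<union> ?G"] show "prob ?E \<le> t k" by linarith
    qed
    then have "ennreal (7 / vol_growth x) * (\<integral>\<^sup>+\<omega>. ennreal (?Y \<omega>) \<partial>M) \<le>
        ennreal (7 / vol_growth x) * ennreal (real L + suminf t)"
      by (rule mult_left_mono) simp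
    also have "ennreal (7 / vol_growth x) * (\<integral>\<^sup>+\<omega>. ennreal (?Y \<omega>) \<partial>M) = return_mean n"
    proof -
      have "ennreal (7 / vol_growth x) * (\<integral>\<^sup>+\<omega>. ennreal (?Y \<omega>) \<partial>M) =
        (\<integral>\<^sup>+\<omega>. ennreal (7 / vol_growth x) * ennreal (?Y \<omega>) \<partial>M)"
        by (rule nn_integral_cmult[symmetric]) (rule measurable_compose[OF Y measurable_ennreal])
      also have "\<dots> = return_mean n"
        using pos by (intro nn_integral_cong) (simp add: ennreal_mult'[symmetric])
      finally show ?thesis .
    qed
    also have "ennreal (7 / vol_growth x) * ennreal (real L + suminf t) = ennreal c / v (inv (\<lambda>R. v R * r R) (of_nat n))"
    proof -
      have "ennreal (7 / a) * ennreal z = ennreal (7 * z) / ennreal a" if "0 < a" "0 \<le> z" for a z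
        using that by (simp add: divide_ennreal ennreal_mult[symmetric])
      from this[of "vol_growth x" "real L + suminf t"] show ?thesis
        unfolding x(2) vol.f_real c_def using pos tsum by (simp only: add_nonneg_nonneg of_nat_0_le_iff)
    qed
    finally show ?thesis .
  qed
  with c show ?thesis by blast
qed

end

theorem proposition1p4:
  fixes M :: "'w measure" and \<Gamma> :: "'w \<Rightarrow> 'v metric_graph"
    and v r \<I> :: "ennreal \<Rightarrow> ennreal"
    and C\<^sub>1 C\<^sub>2 d\<^sub>1 d\<^sub>2 \<alpha>\<^sub>1 \<alpha>\<^sub>2 :: real
  assumes "random_graph M \<Gamma>"
    and "1 \<le> C\<^sub>1" "1 \<le> d\<^sub>1" "d\<^sub>1 \<le> d\<^sub>2" "growth_function C\<^sub>1 d\<^sub>1 d\<^sub>2 v"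
    and "1 \<le> C\<^sub>2" "0 < \<alpha>\<^sub>1" "\<alpha>\<^sub>1 \<le> \<alpha>\<^sub>2" "\<alpha>\<^sub>2 \<le> 1" "growth_function C\<^sub>2 \<alpha>\<^sub>1 \<alpha>\<^sub>2 r"
    and "\<I> = inv (\<lambda>R. v R * r R)"
    and "\<exists>lam\<^sub>0>1. \<exists>p :: real \<Rightarrow> real. (p \<longlongrightarrow> 0) at_top \<and>
      (\<forall>R lam. 1 \<le> R \<and> R < \<infinity> \<and> lam\<^sub>0 \<le> lam \<longrightarrow>
        measure M {\<omega>\<in>space M. R \<in> good_radii v r (\<Gamma> \<omega>) lam} \<ge> 1 - p lam)"
    and "\<exists>c>0. \<forall>R. 1 \<le> R \<and> R < \<infinity> \<longrightarrow>
      (\<integral>\<^sup>+\<omega>. Reff_ball (\<Gamma> \<omega>) R * vol (\<Gamma> \<omega>) R \<partial>M) \<le> ennreal c * (v R * r R)"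
  shows
    "(\<exists>c\<^sub>1>0. \<exists>c\<^sub>2>0. \<exists>c\<^sub>3>0. \<exists>c\<^sub>4>0.
       (\<forall>R. 1 \<le> R \<and> R < \<infinity> \<longrightarrow>
          ennreal c\<^sub>1 * (v R * r R) \<le> (\<integral>\<^sup>+\<omega>. mean_exit_time (\<Gamma> \<omega>) R \<partial>M) \<and>
          (\<integral>\<^sup>+\<omega>. mean_exit_time (\<Gamma> \<omega>) R \<partial>M) \<le> ennreal c\<^sub>2 * (v R * r R)) \<and>
       (\<forall>n\<ge>1. ennreal c\<^sub>3 / v (\<I> (of_nat n)) \<le>
          (\<integral>\<^sup>+\<omega>. ennreal (heat_kernel (\<Gamma> \<omega>) (2 * n) (origin (\<Gamma> \<omega>)) (origin (\<Gamma> \<omega>))) \<partial>M)) \<and>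
       (\<forall>n\<ge>1. ennreal c\<^sub>4 * \<I> (of_nat n) \<le> (\<integral>\<^sup>+\<omega>. mean_displacement (\<Gamma> \<omega>) n \<partial>M))) \<and>
     ((\<exists>c\<^sub>5>0. \<exists>lam\<^sub>0>1. \<exists>q\<^sub>0'>2. \<forall>R lam. 1 \<le> R \<and> R < \<infinity> \<and> lam\<^sub>0 \<le> lam \<longrightarrow>
         measure M {\<omega>\<in>space M. ennreal (inverse lam) * v R \<le> vol (\<Gamma> \<omega>) R \<and>
           (\<forall>y\<in>gball (\<Gamma> \<omega>) R. Reff_pt (\<Gamma> \<omega>) (origin (\<Gamma> \<omega>)) y \<le>
              ennreal lam * r (ennreal (gdist (\<Gamma> \<omega>) (origin (\<Gamma> \<omega>)) y)))}
         \<ge> 1 - c\<^sub>5 / lam powr q\<^sub>0') \<longrightarrow>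
      (\<exists>c\<^sub>6>0. \<forall>n\<ge>1.
         (\<integral>\<^sup>+\<omega>. ennreal (heat_kernel (\<Gamma> \<omega>) (2 * n) (origin (\<Gamma> \<omega>)) (origin (\<Gamma> \<omega>))) \<partial>M)
           \<le> ennreal c\<^sub>6 / v (\<I> (of_nat n))))"
proof -
  interpret prob_space M using assms(1) by (simp add: random_graph_def)
  interpret growth_pair C\<^sub>1 d\<^sub>1 d\<^sub>2 v C\<^sub>2 \<alpha>\<^sub>1 \<alpha>\<^sub>2 r
    using assms by unfold_locales
  interpret random_environment C\<^sub>1 d\<^sub>1 d\<^sub>2 v C\<^sub>2 \<alpha>\<^sub>1 \<alpha>\<^sub>2 r M \<Gamma>
    by unfold_locales (rule assms(1))
  obtain lam\<^sub>0 p where p: "1 < lam\<^sub>0" "(p \<longlongrightarrow> 0) at_top"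
    "\<And>R lam. 1 \<le> R \<Longrightarrow> R < \<infinity> \<Longrightarrow> lam\<^sub>0 \<le> lam \<Longrightarrow>
      1 - p lam \<le> measure M {\<omega>\<in>space M. R \<in> good_radii v r (\<Gamma> \<omega>) lam}"
    using assms(12) by blast
  have "eventually (\<lambda>lam. p lam < 1 / 6) at_top" using p(2) by (rule order_tendstoD) simp
  then have "eventually (\<lambda>lam. p lam < 1 / 6 \<and> lam\<^sub>0 \<le> lam) at_top"
    using eventually_ge_at_top[of lam\<^sub>0] by eventually_elim simp
  then obtain lam where lam: "p lam < 1 / 6" "lam\<^sub>0 \<le> lam"
    by (auto dest: eventually_happens)
  have lam1: "1 < lam" using lam p by simp
  have likely: "5 / 6 \<le> prob {\<omega> \<in> space M. ennreal x \<in> good_radii v r (\<Gamma> \<omega>) lam}" if "1 \<le> x" for x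
    using p(3)[of "ennreal x" lam] lam that by (force simp: ennreal_1[symmetric] simp del: ennreal_1)
  obtain c where c: "0 < c" "\<And>R. 1 \<le> R \<Longrightarrow> R < \<infinity> \<Longrightarrow>
      (\<integral>\<^sup>+\<omega>. Reff_ball (\<Gamma> \<omega>) R * vol (\<Gamma> \<omega>) R \<partial>M) \<le> ennreal c * (v R * r R)"
    using assms(13) by blast
  obtain c1 where c1: "0 < c1" "\<And>R. 1 \<le> R \<Longrightarrow> R < \<infinity> \<Longrightarrow>
      ennreal c1 * (v R * r R) \<le> (\<integral>\<^sup>+\<omega>. mean_exit_time (\<Gamma> \<omega>) R \<partial>M)"
    using exit_lower[OF lam1 likely] by blast
  obtain c3 where c3: "0 < c3" "\<And>n. 1 \<le> n \<Longrightarrow> ennreal c3 / v (\<I> (of_nat n)) \<le> return_mean n"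
    using return_lower[OF lam1 likely] unfolding assms(11) by blast
  obtain c4 where c4: "0 < c4" "\<And>n. 1 \<le> n \<Longrightarrow>
      ennreal c4 * \<I> (of_nat n) \<le> (\<integral>\<^sup>+\<omega>. mean_displacement (\<Gamma> \<omega>) n \<partial>M)"
    using displacement_lower[OF lam1 likely] unfolding assms(11) by blast
  show ?thesis
  proof (intro conjI impI)
    show "\<exists>c\<^sub>1>0. \<exists>c\<^sub>2>0. \<exists>c\<^sub>3>0. \<exists>c\<^sub>4>0.
       (\<forall>R. 1 \<le> R \<and> R < \<infinity> \<longrightarrow>
          ennreal c\<^sub>1 * (v R * r R) \<le> (\<integral>\<^sup>+\<omega>. mean_exit_time (\<Gamma> \<omega>) R \<partial>M) \<and>
          (\<integral>\<^sup>+\<omega>. mean_exit_time (\<Gamma> \<omega>) R \<partial>M) \<le> ennreal c\<^sub>2 * (v R * r R)) \<and>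
       (\<forall>n\<ge>1. ennreal c\<^sub>3 / v (\<I> (of_nat n)) \<le> return_mean n) \<and>
       (\<forall>n\<ge>1. ennreal c\<^sub>4 * \<I> (of_nat n) \<le> (\<integral>\<^sup>+\<omega>. mean_displacement (\<Gamma> \<omega>) n \<partial>M))"
      using c1(2) exit_upper[OF c(2)] c3(2) c4(2)
      by (intro exI[of _ c1] exI[of _ c] exI[of _ c3] exI[of _ c4] conjI allI impI c1(1) c(1) c3(1) c4(1))
        (simp_all only: simp_thms)
  next
    assume "\<exists>c\<^sub>5>0. \<exists>lam\<^sub>0>1. \<exists>q\<^sub>0'>2. \<forall>R lam. 1 \<le> R \<and> R < \<infinity> \<and> lam\<^sub>0 \<le> lam \<longrightarrow>
         measure M {\<omega>\<in>space M. ennreal (inverse lam) * v R \<le> vol (\<Gamma> \<omega>) R \<and>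
           (\<forall>y\<in>gball (\<Gamma> \<omega>) R. Reff_pt (\<Gamma> \<omega>) (origin (\<Gamma> \<omega>)) y \<le>
              ennreal lam * r (ennreal (gdist (\<Gamma> \<omega>) (origin (\<Gamma> \<omega>)) y)))}
         \<ge> 1 - c\<^sub>5 / lam powr q\<^sub>0'"
    then show "\<exists>c\<^sub>6>0. \<forall>n\<ge>1. return_mean n \<le> ennreal c\<^sub>6 / v (\<I> (of_nat n))"
      unfolding assms(11) by (elim exE conjE) (rule return_upper; blast)
  qed
qed

end
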